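(* Let $G=(V,E)$ be a finite simple connected graph. Then $\beth^{3}(K^{h(G)})\le \beth^{3}(G)$; that is, $$\binom{h(G)}{4}-\binom{h(G)}{3}+\binom{h(G)}{2}-\binom{h(G)}{1}\le \beth^{3}(G).$$
   Context: All graphs are finite and simple. $K^{t}$ is the complete graph on $t$ vertices. The Hadwiger number $h(G)$ is the maximum $t$ such that $K^{t}$ is a minor of $G$. $C(G)$ is the set of all induced cycles in $G$ (of length at least 3). Solid graphs are the graphs of the following four kinds. (1) Pyramid: a graph consisting of a cycle $C$ and a vertex $w\notin V(C)$ together with at least three edges between $w$ and $C$. (2) Trihedron: the union of three paths $P_1,P_2,P_3$, each of length at least 2, having the same two (distinct) endpoints, such that no interior vertex of any of the paths is used in another of the paths. (3) Stamp: the union of a triangle $T$ and three paths $P_1,P_2,P_3$ of length $\ge 1$ that start at the three different vertices of $T$ and all end at the same vertex $x\notin V(T)$, such that the $P_i-x$ are pairwise vertex-disjoint and each $P_i$ meets $T$ only in its starting vertex. (4) Prism: $T\cup T'\cup P_1\cup P_2\cup P_3$ where $T,T'$ are vertex-disjoint triangles with vertices $x_1,x_2,x_3$ and $y_1,y_2,y_3$ respectively, and the $P_i$ are pairwise vertex-disjoint paths from $x_i$ to $y_i$ (so $P_i$ meets $T\cup T'$ only in $x_i,y_i$). A solid in $G$ is an induced subgraph of $G$ that is isomorphic to a solid graph; $S(G)$ is the set of all solids in $G$. The third graph characteristic is $\beth^{3}(G)=|S(G)|-|C(G)|+|E(G)|-|V(G)|$. *)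

theory Defs
  imports Main "HOL.Binomial"
begin

text \<open>A graph is a pair of a vertex set and a set of two-element edges; only the pairs satisfying
  \<open>simple_graph\<close> are graphs in the mathematical sense.\<close>

type_synonym 'a graph = "'a set \<times> 'a set set"

abbreviation verts :: "'a graph \<Rightarrow> 'a set" where
  "verts G \<equiv> fst G"

abbreviation edges :: "'a graph \<Rightarrow> 'a set set" where
  "edges G \<equiv> snd G"

definition simple_graph :: "'a graph \<Rightarrow> bool" where
  "simple_graph G \<longleftrightarrow> finite (verts G) \<and> (\<forall>e\<in>edges G. e \<subseteq> verts G \<and> card e = 2)"

definition graph_Union :: "'a graph set \<Rightarrow> 'a graph" where
  "graph_Union \<G> = (\<Union>(verts ` \<G>), \<Union>(edges ` \<G>))"

definition complete_on :: "'a set \<Rightarrow> 'a graph" where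
  "complete_on X = (X, {e. e \<subseteq> X \<and> card e = 2})"

definition complete_graph :: "nat \<Rightarrow> nat graph" where
  "complete_graph t = complete_on {..<t}"

definition induced_subgraph :: "'a graph \<Rightarrow> 'a set \<Rightarrow> 'a graph" where
  "induced_subgraph G W = (W, {e \<in> edges G. e \<subseteq> W})"

definition isomorphic :: "'a graph \<Rightarrow> 'b graph \<Rightarrow> bool" where
  "isomorphic G H \<longleftrightarrow> (\<exists>f. bij_betw f (verts G) (verts H) \<and> edges H = (\<lambda>e. f ` e) ` edges G)"


section \<open>Paths, cycles, connectedness\<close>

text \<open>A path is given by the list of its distinct vertices in order, so its length (its number of
  edges) is one less than the length of the list.\<close>

definition path_graph :: "'a list \<Rightarrow> 'a graph" where
  "path_graph p = (set p, {{p ! i, p ! Suc i} | i. Suc i < length p})"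

definition is_path :: "'a \<Rightarrow> 'a list \<Rightarrow> 'a \<Rightarrow> bool" where
  "is_path u p v \<longleftrightarrow> p \<noteq> [] \<and> distinct p \<and> hd p = u \<and> last p = v"

definition path_length :: "'a list \<Rightarrow> nat" where
  "path_length p = length p - 1"

definition is_cycle :: "'a graph \<Rightarrow> bool" where
  "is_cycle G \<longleftrightarrow> (\<exists>c. distinct c \<and> 3 \<le> length c \<and>
     G = (set c, insert {last c, hd c} (edges (path_graph c))))"

definition connected_graph :: "'a graph \<Rightarrow> bool" where
  "connected_graph G \<longleftrightarrow> verts G \<noteq> {} \<and>
     (\<forall>u\<in>verts G. \<forall>v\<in>verts G. \<exists>p. is_path u p v \<and>
        set p \<subseteq> verts G \<and> edges (path_graph p) \<subseteq> edges G)"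


section \<open>Minors and the Hadwiger number\<close>

text \<open>\<open>B v\<close> is the branch set that is contracted to the vertex \<open>v\<close> of the minor.\<close>

definition is_minor :: "'b graph \<Rightarrow> 'a graph \<Rightarrow> bool" where
  "is_minor H G \<longleftrightarrow> (\<exists>B.
     (\<forall>v\<in>verts H. B v \<subseteq> verts G \<and> connected_graph (induced_subgraph G (B v))) \<and>
     (\<forall>u\<in>verts H. \<forall>v\<in>verts H. u \<noteq> v \<longrightarrow> B u \<inter> B v = {}) \<and>
     (\<forall>u v. {u, v} \<in> edges H \<longrightarrow> (\<exists>a\<in>B u. \<exists>b\<in>B v. {a, b} \<in> edges G)))"

text \<open>For a finite graph the set below contains 0 and is bounded by the number of vertices, so the
  maximum is attained.\<close>

definition hadwiger :: "'a graph \<Rightarrow> nat" where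
  "hadwiger G = Max {t. is_minor (complete_graph t) G}"


section \<open>Solid graphs\<close>

definition is_pyramid :: "'a graph \<Rightarrow> bool" where
  "is_pyramid G \<longleftrightarrow> (\<exists>C w N. is_cycle C \<and> w \<notin> verts C \<and> N \<subseteq> verts C \<and> card N \<ge> 3 \<and>
     G = (insert w (verts C), edges C \<union> {{w, v} | v. v \<in> N}))"

definition is_trihedron :: "'a graph \<Rightarrow> bool" where
  "is_trihedron G \<longleftrightarrow> (\<exists>x y P. x \<noteq> y \<and>
     (\<forall>i\<in>{1..3::nat}. is_path x (P i) y \<and> path_length (P i) \<ge> 2) \<and>
     (\<forall>i\<in>{1..3}. \<forall>j\<in>{1..3}. i \<noteq> j \<longrightarrow> (set (P i) - {x, y}) \<inter> set (P j) = {}) \<and>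
     G = graph_Union ((\<lambda>i. path_graph (P i)) ` {1..3}))"

definition is_stamp :: "'a graph \<Rightarrow> bool" where
  "is_stamp G \<longleftrightarrow> (\<exists>t x P. inj_on t {1..3::nat} \<and> x \<notin> t ` {1..3} \<and>
     (\<forall>i\<in>{1..3}. is_path (t i) (P i) x \<and> path_length (P i) \<ge> 1 \<and>
        set (P i) \<inter> t ` {1..3} = {t i}) \<and>
     (\<forall>i\<in>{1..3}. \<forall>j\<in>{1..3}. i \<noteq> j \<longrightarrow> (set (P i) - {x}) \<inter> (set (P j) - {x}) = {}) \<and>
     G = graph_Union (insert (complete_on (t ` {1..3})) ((\<lambda>i. path_graph (P i)) ` {1..3})))"

definition is_prism :: "'a graph \<Rightarrow> bool" where
  "is_prism G \<longleftrightarrow> (\<exists>x y P. inj_on x {1..3::nat} \<and> inj_on y {1..3::nat} \<and>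
     x ` {1..3} \<inter> y ` {1..3} = {} \<and>
     (\<forall>i\<in>{1..3}. is_path (x i) (P i) (y i) \<and>
        set (P i) \<inter> (x ` {1..3} \<union> y ` {1..3}) = {x i, y i}) \<and>
     (\<forall>i\<in>{1..3}. \<forall>j\<in>{1..3}. i \<noteq> j \<longrightarrow> set (P i) \<inter> set (P j) = {}) \<and>
     G = graph_Union ({complete_on (x ` {1..3}), complete_on (y ` {1..3})} \<union>
           (\<lambda>i. path_graph (P i)) ` {1..3}))"

definition solid_graph :: "'a graph \<Rightarrow> bool" where
  "solid_graph G \<longleftrightarrow> is_pyramid G \<or> is_trihedron G \<or> is_stamp G \<or> is_prism G"


section \<open>The third graph characteristic\<close>

definition induced_subgraphs :: "'a graph \<Rightarrow> 'a graph set" where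
  "induced_subgraphs G = {induced_subgraph G W | W. W \<subseteq> verts G}"

definition induced_cycles :: "'a graph \<Rightarrow> 'a graph set" where
  "induced_cycles G = {H \<in> induced_subgraphs G. is_cycle H}"

text \<open>Letting the solid graph \<open>K\<close> range over graphs on the same vertex type loses nothing, since
  \<open>H\<close> itself has that type.\<close>

definition solids :: "'a graph \<Rightarrow> 'a graph set" where
  "solids G = {H \<in> induced_subgraphs G. \<exists>K :: 'a graph. solid_graph K \<and> isomorphic H K}"

definition beth3 :: "'a graph \<Rightarrow> int" where
  "beth3 G = int (card (solids G)) - int (card (induced_cycles G))
     + int (card (edges G)) - int (card (verts G))"

end

theory Submission
  imports Defs "HOL-Library.Z2"
begin

text \<open>
  Everything is counted modulo 2. Call an induced cycle a hole, and let \<open>\<beta>\<close> assign a bit to every hole.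
  By Truemper's theorem, if \<open>\<beta>\<close> sums to zero over the holes of each solid, then \<open>\<beta>\<close> is induced by an
  assignment of bits to the edges. There are at most \<open>2 ^ (|E| - |V| + 1)\<close> such \<open>\<beta>\<close>, because cuts induce the
  zero assignment, and at least \<open>2 ^ (|C(G)| - k)\<close> if \<open>k\<close> solids suffice to test the condition.

  Given a model of the complete graph on \<open>{0..<h}\<close> with branch sets \<open>B i\<close>, for every four-element subset
  \<open>Q\<close> of \<open>{1..<h}\<close> one solid meeting exactly the branch sets in \<open>Q\<close> can be dropped from the test: its
  condition follows from those of the other solids inside the five branch sets of \<open>insert 0 Q\<close>, as the
  boundary of a 4-simplex is a cycle. Hence \<open>k\<close> may be \<open>|S(G)| - (h - 1 choose 4)\<close>, and
  \<open>(h - 1 choose 4) - 1\<close> is the alternating sum of binomial coefficients in the claim.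
\<close>

text \<open>The governing fact about solids is that each edge of a solid lies in exactly two of its
  induced cycles. So these cycles sum to zero in the edge space modulo 2, which makes the conditions
  in Truemper's theorem necessary. Sufficiency is by induction: labellings of the graph without
  \<open>u\<close> and of the graph without \<open>v\<close> agree up to a potential on the common
  part if that part is connected, and can then be glued; what remains are the induced cycles through
  both of the nonadjacent vertices \<open>u\<close> and \<open>v\<close>. A suitable pair exists
  unless the graph is disconnected, complete or a cycle.

  The obstacle in the count is circularity: a condition may be dropped only if it follows from
  conditions that are kept. Reserving branch set 0 as an apex resolves this: each of the other faces
  used for \<open>Q\<close> has only three branch sets besides 0, while every dropped solid meets
  four of these. Hence the four-subsets are taken in \<open>{1..<h}\<close>, and Pascal's rule turns
  \<open>(h - 1 choose 4) - 1\<close> into the alternating sum.\<close>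

section \<open>Paths and induced cycles\<close>

text \<open>Otherwise the simplifier turns sums in \<^typ>\<open>bit\<close> into bitwise operations.\<close>

declare add_bit_eq_xor [simp del] mult_bit_eq_and [simp del]

lemma bit_add_self [simp]: "x + x = (0::bit)"
  by (cases x) (simp_all flip: mult_2)

lemma bit_add_left_self [simp]: "x + (x + y) = (y::bit)"
  by (simp flip: add.assoc)

lemma bit_add_eq_0_iff: "x + y = 0 \<longleftrightarrow> x = (y::bit)"
  by (metis bit_add_left_self add.right_neutral bit_add_self)

section \<open>Edges of a path given as a list of vertices\<close>

abbreviation path_edges :: "'a list \<Rightarrow> 'a set set" where
  "path_edges p \<equiv> edges (path_graph p)"

lemma path_edges_Nil [simp]: "path_edges [] = {}"
  and path_edges_single [simp]: "path_edges [x] = {}"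
  by (auto simp: path_graph_def)

lemma path_edges_Cons_Cons [simp]:
  "path_edges (x # y # zs) = insert {x, y} (path_edges (y # zs))"
proof -
  have "e \<in> path_edges (x # y # zs) \<longleftrightarrow> e = {x, y} \<or> e \<in> path_edges (y # zs)" for e
  proof
    assume "e \<in> path_edges (x # y # zs)"
    then obtain i where "e = {(x # y # zs) ! i, (y # zs) ! i}" "i < Suc (length zs)"
      by (auto simp: path_graph_def)
    then show "e = {x, y} \<or> e \<in> path_edges (y # zs)"
      by (cases i) (auto simp: path_graph_def)
  next
    assume "e = {x, y} \<or> e \<in> path_edges (y # zs)"
    then show "e \<in> path_edges (x # y # zs)"
    proof
      assume "e = {x, y}"
      then show ?thesis by (auto simp: path_graph_def intro!: exI[of _ 0])
    next
      assume "e \<in> path_edges (y # zs)"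
      then obtain i where "e = {(y # zs) ! i, zs ! i}" "i < length zs"
        by (auto simp: path_graph_def)
      then show ?thesis by (auto simp: path_graph_def intro!: exI[of _ "Suc i"])
    qed
  qed
  then show ?thesis
    by auto
qed

lemma path_edges_append:
  "path_edges (xs @ y # ys) = path_edges (xs @ [y]) \<union> path_edges (y # ys)"
proof (induction xs)
  case (Cons a xs)
  then show ?case by (cases xs) auto
qed simp

lemma path_edges_Cons: "p \<noteq> [] \<Longrightarrow> path_edges (x # p) = insert {x, hd p} (path_edges p)"
  by (cases p) auto

lemma path_edges_subset: "e \<in> path_edges p \<Longrightarrow> e \<subseteq> set p"
  by (auto simp: path_graph_def)

lemma path_edges_card: "distinct p \<Longrightarrow> e \<in> path_edges p \<Longrightarrow> card e = 2"
  by (auto simp: path_graph_def nth_eq_iff_index_eq)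

lemma path_edges_in_middle:
  assumes "distinct (xs @ a # b # c # ys)" "{b, z} \<in> path_edges (xs @ a # b # c # ys)"
  shows "z = a \<or> z = c"
proof -
  have "path_edges (xs @ a # b # c # ys) =
      path_edges (xs @ [a]) \<union> {{a, b}, {b, c}} \<union> path_edges (c # ys)"
    using path_edges_append[of xs a "b # c # ys"] by auto
  moreover have "{b, z} \<notin> path_edges (xs @ [a])" "{b, z} \<notin> path_edges (c # ys)"
    using assms(1) path_edges_subset[of "{b, z}"] by fastforce+
  ultimately show ?thesis
    using assms by (auto simp: doubleton_eq_iff)
qed

text \<open>Only the edges are fixed. An induced subgraph is determined by its vertex set, so holes
  and solids are treated as sets of vertices, and passing to a subgraph means passing to a smaller
  set within the same locale.\<close>

locale edge_set =
  fixes E :: "'a set set"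
  assumes card_edge: "e \<in> E \<Longrightarrow> card e = 2"
begin

definition adj :: "'a \<Rightarrow> 'a \<Rightarrow> bool" where
  "adj x y \<longleftrightarrow> {x, y} \<in> E"

definition induced_edges :: "'a set \<Rightarrow> 'a set set" where
  "induced_edges W = {e \<in> E. e \<subseteq> W}"

lemma adj_irrefl [simp]: "\<not> adj x x"
  using card_edge[of "{x}"] by (auto simp: adj_def)

lemma adj_sym: "adj x y \<longleftrightarrow> adj y x"
  by (simp add: adj_def insert_commute)

lemma edgeE:
  assumes "e \<in> E"
  obtains x y where "e = {x, y}" "x \<noteq> y" "adj x y"
  using card_edge[OF assms] assms unfolding card_2_iff adj_def by auto

lemma in_induced_edges: "{x, y} \<in> induced_edges W \<longleftrightarrow> adj x y \<and> x \<in> W \<and> y \<in> W"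
  by (auto simp: induced_edges_def adj_def)

lemma finite_induced_edges: "finite W \<Longrightarrow> finite (induced_edges W)"
  by (rule finite_subset[of _ "Pow W"]) (auto simp: induced_edges_def)

lemma induced_edges_Un: "induced_edges (A \<union> B) = induced_edges A \<union> induced_edges B \<union> {{x, y} | x y. x \<in> A \<and> y \<in> B \<and> adj x y}"
proof -
  have "e \<in> induced_edges A \<or> e \<in> induced_edges B \<or> (\<exists>x y. e = {x, y} \<and> x \<in> A \<and> y \<in> B \<and> adj x y)"
    if "e \<in> induced_edges (A \<union> B)" for e
  proof -
    have "e \<in> E" using that by (simp add: induced_edges_def)
    then obtain x y where e: "e = {x, y}" "x \<noteq> y" "adj x y" by (rule edgeE)
    with that have "x \<in> A \<union> B" "y \<in> A \<union> B" by (auto simp: induced_edges_def)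
    with e show ?thesis
      using adj_sym[of x y] insert_commute[of x y "{}"] unfolding e(1) in_induced_edges
      by (metis Un_iff)
  qed
  moreover have "induced_edges A \<subseteq> induced_edges (A \<union> B)" "induced_edges B \<subseteq> induced_edges (A \<union> B)"
    by (auto simp: induced_edges_def)
  moreover have "{{x, y} | x y. x \<in> A \<and> y \<in> B \<and> adj x y} \<subseteq> induced_edges (A \<union> B)"
    by (auto simp: in_induced_edges)
  ultimately show ?thesis
    by blast
qed

lemma induced_edges_singleton [simp]: "induced_edges {x} = {}" "induced_edges {} = {}"
  using card_edge[of "{x}"] card_edge[of "{}"] by (auto simp: induced_edges_def subset_singleton_iff)

lemma induced_edges_insert: "induced_edges (insert x A) = induced_edges A \<union> {{x, y} | y. y \<in> A \<and> adj x y}"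
  using induced_edges_Un[of "{x}" A] by auto

text \<open>Induced paths, in a recursive form for which concatenation reduces to conditions on the
  two pieces and on the pairs between them (\<open>ipath_append\<close>). The meaning in terms of
  induced subgraphs is \<open>ipath_iff\<close>.\<close>

primrec ipath :: "'a list \<Rightarrow> bool" where
  "ipath [] = True"
| "ipath (x # xs) = (ipath xs \<and> x \<notin> set xs \<and> (\<forall>z\<in>set xs. adj x z \<longleftrightarrow> z = hd xs))"

lemma ipath_append:
  "ipath (xs @ ys) \<longleftrightarrow> ipath xs \<and> ipath ys \<and> set xs \<inter> set ys = {} \<and>
     (\<forall>x\<in>set xs. \<forall>y\<in>set ys. adj x y \<longleftrightarrow> x = last xs \<and> y = hd ys)"
proof (induction xs)
  case (Cons a xs)
  show ?case
  proof (cases "xs = []")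
    case True
    then show ?thesis by auto
  next
    case False
    have l: "last (a # xs) = last xs" "hd (xs @ ys) = hd xs" "last xs \<in> set xs" "hd xs \<in> set xs"
      using False by auto
    show ?thesis (is "?L \<longleftrightarrow> ?R")
    proof
      assume ?L
      then show ?R
        using l Cons.IH by (simp add: ball_Un) (metis disjoint_iff)
    next
      assume ?R
      then show ?L
        using l Cons.IH by (simp add: ball_Un) (metis disjoint_iff)
    qed
  qed
qed simp

lemma ipath_rev [simp]: "ipath (rev xs) \<longleftrightarrow> ipath xs"
  by (induction xs) (auto simp: ipath_append last_rev adj_sym)

lemma ipath_distinct: "ipath xs \<Longrightarrow> distinct xs"
  by (induction xs) auto

lemma ipath_iff: "ipath p \<longleftrightarrow> distinct p \<and> induced_edges (set p) = path_edges p"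
proof (induction p)
  case (Cons x p)
  have 1: "induced_edges (set (x # p)) = induced_edges (set p) \<union> {{x, y} | y. y \<in> set p \<and> adj x y}"
    by (simp add: induced_edges_insert)
  show ?case
  proof (cases "p = []")
    case False
    have h: "hd p \<in> set p" using False by simp
    show ?thesis
    proof
      assume *: "ipath (x # p)"
      then have "{{x, y} | y. y \<in> set p \<and> adj x y} = {{x, hd p}}" using h by auto
      then show "distinct (x # p) \<and> induced_edges (set (x # p)) = path_edges (x # p)"
        using Cons * 1 by (simp add: path_edges_Cons[OF False])
    next
      assume *: "distinct (x # p) \<and> induced_edges (set (x # p)) = path_edges (x # p)"
      have x: "x \<notin> set p" using * by simp
      have eq: "induced_edges (set p) \<union> {{x, y} | y. y \<in> set p \<and> adj x y} = insert {x, hd p} (path_edges p)"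
        using * 1 by (simp add: path_edges_Cons[OF False])
      have n1: "x \<notin> e" if "e \<in> induced_edges (set p)" for e using that x by (auto simp: induced_edges_def)
      have n2: "x \<notin> e" if "e \<in> path_edges p" for e using path_edges_subset[OF that] x by auto
      \<comment> \<open>Splitting the common edge set into the edges avoiding \<open>x\<close> and
        those at \<open>x\<close> yields the premise of the induction hypothesis and the condition
        on the head.\<close>
      have "induced_edges (set p) = {e \<in> induced_edges (set p) \<union> {{x, y} | y. y \<in> set p \<and> adj x y}. x \<notin> e}"
        using n1 by auto
      also have "\<dots> = path_edges p" unfolding eq using n2 by auto
      finally have "induced_edges (set p) = path_edges p" .
      moreover have "adj x z \<longleftrightarrow> z = hd p" if "z \<in> set p" for z
      proof -
        have "adj x z \<longleftrightarrow> {x, z} \<in> induced_edges (set p) \<union> {{x, y} | y. y \<in> set p \<and> adj x y}"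
          using that n1[of "{x, z}"] by (auto simp: doubleton_eq_iff)
        also have "\<dots> \<longleftrightarrow> {x, z} = {x, hd p}" unfolding eq using n2[of "{x, z}"] by auto
        finally show ?thesis by (auto simp: doubleton_eq_iff)
      qed
      ultimately show "ipath (x # p)" using Cons * by simp
    qed
  qed simp
qed simp

text \<open>An induced cycle cut open at a root; by \<open>ring_rotate\<close> any vertex of the
  cycle can be the root. A list \<open>p\<close> of length 2 gives a triangle, so in contrast to a
  common convention triangles count as holes.\<close>

definition ring :: "'a \<Rightarrow> 'a list \<Rightarrow> bool" where
  "ring x p \<longleftrightarrow> x \<notin> set p \<and> ipath p \<and> 2 \<le> length p \<and>
     (\<forall>z\<in>set p. adj x z \<longleftrightarrow> z = hd p \<or> z = last p)"

definition hole :: "'a set \<Rightarrow> bool" where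
  "hole D \<longleftrightarrow> (\<exists>x p. ring x p \<and> D = insert x (set p))"

lemma ring_rev: "ring x p \<Longrightarrow> ring x (rev p)"
  by (auto simp: ring_def hd_rev last_rev)

text \<open>The cyclic order stays the same and only the root moves from \<open>x\<close> to
  \<open>y\<close>. One of \<open>a\<close> and \<open>b\<close> may be empty, and then
  \<open>y\<close> is a neighbour of \<open>x\<close>; hence the case distinctions on where the list
  ends fall.\<close>

lemma ring_rotate:
  assumes "ring x (a @ y # b)"
  shows "ring y (b @ x # a)"
proof -
  have d: "x \<notin> set a" "x \<noteq> y" "x \<notin> set b" "ipath a" "ipath b" "y \<notin> set a" "y \<notin> set b"
    "set a \<inter> set b = {}" "1 \<le> length a + length b"
    and yb: "\<And>z. z \<in> set b \<Longrightarrow> adj y z \<longleftrightarrow> z = hd b"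
    and ay: "\<And>z. z \<in> set a \<Longrightarrow> adj y z \<longleftrightarrow> z = last a"
    and ab: "\<And>z w. z \<in> set a \<Longrightarrow> w \<in> set b \<Longrightarrow> \<not> adj w z"
    using assms by (auto simp: ring_def ipath_append adj_sym)
  have x: "\<And>z. z \<in> set a \<union> {y} \<union> set b \<Longrightarrow> adj x z \<longleftrightarrow> z = hd (a @ [y]) \<or> z = last (y # b)"
    using assms by (auto simp: ring_def hd_append split: if_splits)
  have xa: "adj x z \<longleftrightarrow> z = hd a" if "z \<in> set a" for z
    using x[of z] that d by (cases a) (auto simp: hd_append split: if_splits)
  have xb: "adj x z \<longleftrightarrow> z = last b" if "z \<in> set b" for z
    using x[of z] that d by (cases a) (auto simp: hd_append split: if_splits)
  have xy: "adj x y \<longleftrightarrow> a = [] \<or> b = []"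
    using x[of y] d by (cases a; cases b) (auto simp: hd_append split: if_splits)
  have bx: "adj z x \<longleftrightarrow> z = last b" if "z \<in> set b" for z
    using xb[OF that] by (simp add: adj_sym)
  have "ipath (b @ x # a)"
    unfolding ipath_append using d xa bx ab by auto
  moreover have "adj y z \<longleftrightarrow> z = hd (b @ x # a) \<or> z = last (b @ x # a)" if zin: "z \<in> set (b @ x # a)" for z
  proof -
    consider "z \<in> set b" | "z = x" | "z \<in> set a" using zin by auto
    then show ?thesis
    proof cases
      case 1
      then have "z \<noteq> last (x # a)" using d by (metis disjoint_iff last_in_set list.distinct(1) set_ConsD)
      moreover have "hd (b @ x # a) = hd b" using 1 by (cases b) auto
      ultimately show ?thesis using 1 yb by auto
    next
      case 2
      have "hd (b @ x # a) = x \<longleftrightarrow> b = []" using d by (cases b) auto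
      moreover have "last (b @ x # a) = x \<longleftrightarrow> a = []" using d last_in_set[of a] by auto
      ultimately show ?thesis using 2 xy adj_sym by metis
    next
      case 3
      then have "z \<noteq> hd (b @ x # a)" using d by (cases b) auto
      then show ?thesis using 3 ay by auto
    qed
  qed
  ultimately show ?thesis
    using d by (auto simp: ring_def)
qed

lemma is_cycle_iff_hole: "is_cycle (D, induced_edges D) \<longleftrightarrow> hole D"
proof
  assume "is_cycle (D, induced_edges D)"
  then obtain c where c: "distinct c" "3 \<le> length c" "D = set c"
    "induced_edges D = insert {last c, hd c} (path_edges c)"
    unfolding is_cycle_def by auto
  then obtain x p where cp: "c = x # p" by (cases c) auto
  have p: "p \<noteq> []" "2 \<le> length p" "x \<notin> set p" "distinct p" using c cp by auto
  have eq: "induced_edges (insert x (set p)) = insert {last p, x} (insert {x, hd p} (path_edges p))"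
    using c cp p by (simp add: path_edges_Cons)
  have "induced_edges (set p) = {e \<in> induced_edges (insert x (set p)). x \<notin> e}"
    using p by (auto simp: induced_edges_def)
  also have "\<dots> = path_edges p"
    unfolding eq using p(3) path_edges_subset by blast
  finally have "ipath p" using p by (simp add: ipath_iff)
  moreover have "adj x z \<longleftrightarrow> z = hd p \<or> z = last p" if "z \<in> set p" for z
  proof -
    have "adj x z \<longleftrightarrow> {x, z} \<in> induced_edges (insert x (set p))" using that by (simp add: in_induced_edges)
    also have "\<dots> \<longleftrightarrow> {x, z} = {last p, x} \<or> {x, z} = {x, hd p}"
      unfolding eq using p path_edges_subset by blast
    finally show ?thesis by (auto simp: doubleton_eq_iff)
  qed
  ultimately show "hole D"
    unfolding hole_def ring_def using c(3) cp p by auto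
next
  assume "hole D"
  then obtain x p where r: "ring x p" and D: "D = insert x (set p)"
    unfolding hole_def by auto
  from r have p: "p \<noteq> []" "2 \<le> length p" "x \<notin> set p" "distinct p" "induced_edges (set p) = path_edges p"
    and n: "\<And>z. z \<in> set p \<Longrightarrow> adj x z \<longleftrightarrow> z = hd p \<or> z = last p"
    by (auto simp: ring_def ipath_iff)
  have "induced_edges D = path_edges p \<union> {{x, y} | y. y \<in> set p \<and> adj x y}"
    by (simp add: D induced_edges_insert p)
  also have "{{x, y} | y. y \<in> set p \<and> adj x y} = {{x, hd p}, {last p, x}}"
    using n p(1) by (auto simp: insert_commute intro: exI[of _ "hd p"] exI[of _ "last p"])
  finally have "(D, induced_edges D) = (set (x # p), insert {last (x # p), hd (x # p)} (path_edges (x # p)))"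
    using p by (auto simp: D path_edges_Cons)
  moreover have "distinct (x # p)" "3 \<le> length (x # p)" using p by auto
  ultimately show "is_cycle (D, induced_edges D)" unfolding is_cycle_def by blast
qed

lemma hole_finite: "hole D \<Longrightarrow> finite D"
  by (auto simp: hole_def)

lemma hole_rooted:
  assumes "hole D" "y \<in> D"
  obtains p where "ring y p" "D = insert y (set p)"
proof -
  obtain x p where r: "ring x p" and D: "D = insert x (set p)"
    using assms unfolding hole_def by auto
  show thesis
  proof (cases "y = x")
    case True
    then show thesis using r D that by blast
  next
    case False
    then obtain a b where "p = a @ y # b" using assms D split_list[of y p] by auto
    then show thesis using ring_rotate[of x a y b] r D that[of "b @ x # a"] by auto
  qed
qed

lemma ring_hd_neq_last: "ring x p \<Longrightarrow> hd p \<noteq> last p"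
  by (cases p) (auto simp: ring_def ipath_distinct)

lemma hole_nbrs:
  assumes "hole D" "x \<in> D"
  obtains y z where "y \<noteq> z" "y \<in> D" "z \<in> D" "\<And>w. w \<in> D \<Longrightarrow> adj x w \<longleftrightarrow> w = y \<or> w = z"
proof -
  obtain p where r: "ring x p" "D = insert x (set p)" by (rule hole_rooted[OF assms])
  moreover have "p \<noteq> []" using r by (auto simp: ring_def)
  ultimately show thesis
    using ring_hd_neq_last[OF r(1)] that[of "hd p" "last p"]
    unfolding ring_def by (metis adj_irrefl hd_in_set insert_iff last_in_set)
qed

text \<open>A vertex of a hole has exactly two neighbours in it, so if there are only two
  candidates, both occur. This forces vertices into a hole; instantiated with \<open>a = b\<close>
  it yields a contradiction.\<close>

lemma hole_two:
  assumes "hole D" "x \<in> D" "\<And>w. w \<in> D \<Longrightarrow> adj x w \<Longrightarrow> w = a \<or> w = b"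
  shows "a \<in> D" "b \<in> D" "adj x a" "adj x b" "a \<noteq> b"
  using hole_nbrs[OF assms(1,2)] assms(3) by metis+

lemma hole_three:
  assumes "hole D" "x \<in> D" "a \<in> D" "b \<in> D" "c \<in> D" "adj x a" "adj x b" "adj x c"
  shows "a = b \<or> a = c \<or> b = c"
  using hole_nbrs[OF assms(1,2)] assms(3-) by metis

text \<open>The inner vertices of a thread have at most two neighbours in \<open>W\<close>. A hole
  inside \<open>W\<close> that contains one of them therefore cannot leave the thread before its
  ends, which is \<open>absorb\<close>.\<close>

definition thread :: "'a set \<Rightarrow> 'a list \<Rightarrow> bool" where
  "thread W xs \<longleftrightarrow> (\<forall>l a b c r. xs = l @ a # b # c # r \<longrightarrow> (\<forall>y\<in>W. adj b y \<longrightarrow> y = a \<or> y = c))"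

lemma thread_rev: "thread W xs \<Longrightarrow> thread W (rev xs)"
  unfolding thread_def
proof (intro allI impI)
  fix l a b c r
  assume *: "\<forall>l a b c r. xs = l @ a # b # c # r \<longrightarrow> (\<forall>y\<in>W. adj b y \<longrightarrow> y = a \<or> y = c)"
    and "rev xs = l @ a # b # c # r"
  then have "xs = rev r @ c # b # a # rev l"
    by (metis append.assoc append_Cons append_Nil rev.simps(2) rev_append rev_rev_ident)
  then show "\<forall>y\<in>W. adj b y \<longrightarrow> y = a \<or> y = c" using * by blast
qed

lemma absorb_forward:
  assumes "hole D" "D \<subseteq> W" "thread W (l @ a # b # r)" "b \<in> D"
  shows "set r \<subseteq> D \<and> (r \<noteq> [] \<longrightarrow> a \<in> D)"
  using assms(3,4)
proof (induction r arbitrary: l a b)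
  case (Cons c r)
  have "\<And>w. w \<in> D \<Longrightarrow> adj b w \<Longrightarrow> w = a \<or> w = c"
    using Cons.prems(1) assms(2) unfolding thread_def by blast
  then have "a \<in> D" "c \<in> D" using hole_two[OF assms(1) Cons.prems(2)] by blast+
  then show ?case using Cons.IH[of "l @ [a]" b c] Cons.prems by simp
qed simp

lemma absorb:
  assumes "hole D" "D \<subseteq> W" "thread W (l @ b # r)" "l \<noteq> []" "r \<noteq> []" "b \<in> D"
  shows "set (l @ b # r) \<subseteq> D"
proof -
  obtain l' a where l: "l = l' @ [a]" using assms(4) by (cases l rule: rev_cases) auto
  obtain c r' where r: "r = c # r'" using assms(5) by (cases r) auto
  have "set r \<subseteq> D" using absorb_forward[of D W l' a b r] assms l by auto
  moreover have "thread W (rev r' @ c # b # rev l)"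
    using thread_rev[OF assms(3)] r by simp
  then have "set (rev l) \<subseteq> D" using absorb_forward[of D W "rev r'" c b "rev l"] assms(1,2,6) by auto
  ultimately show ?thesis using assms(6) by auto
qed

lemma thread_ipath:
  assumes "ipath xs" "\<And>y z. y \<in> W \<Longrightarrow> y \<notin> set xs \<Longrightarrow> z \<in> set (butlast (tl xs)) \<Longrightarrow> \<not> adj z y"
  shows "thread W xs"
  unfolding thread_def
proof (intro allI impI ballI)
  fix l a b c r y
  assume xs: "xs = l @ a # b # c # r" and y: "y \<in> W" "adj b y"
  have "b \<in> set (butlast (tl xs))" by (cases l) (auto simp: xs butlast_append)
  then have "y \<in> set xs" using assms(2) y by blast
  then have "{b, y} \<in> path_edges xs" using assms(1) y in_induced_edges[of b y "set xs"] xs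
    by (auto simp: ipath_iff)
  then show "y = a \<or> y = c"
    using path_edges_in_middle ipath_distinct[OF assms(1)] xs by metis
qed

lemma ring_ipath_butlast: "ring x p \<Longrightarrow> ipath (x # butlast p)"
proof -
  assume r: "ring x p"
  then obtain q y where p: "p = q @ [y]" by (cases p rule: rev_cases) (auto simp: ring_def)
  then show ?thesis using r by (auto simp: ring_def ipath_append hd_append)
qed

lemma thread_ring: "ring x p \<Longrightarrow> thread (insert x (set p)) (x # p)"
  unfolding thread_def
proof (intro allI impI ballI)
  fix l a b c r y
  assume r: "ring x p" and eq: "x # p = l @ a # b # c # r" and y: "y \<in> insert x (set p)" "adj b y"
  have ip: "ipath p" "x \<notin> set p" and xz: "\<And>z. z \<in> set p \<Longrightarrow> adj x z \<longleftrightarrow> z = hd p \<or> z = last p"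
    using r by (auto simp: ring_def)
  show "y = a \<or> y = c"
  proof (cases l)
    case Nil
    then have "a = x" "p = b # c # r" using eq by auto
    then show ?thesis using y ip adj_sym by auto
  next
    case (Cons x' l')
    then have p: "p = l' @ a # b # c # r" using eq by auto
    then have "b \<noteq> hd p" "b \<noteq> last p" using ipath_distinct[OF ip(1)] by (cases l'; auto)+
    then have "y \<noteq> x" using xz[of b] p y adj_sym by auto
    then have "{b, y} \<in> path_edges p"
      using y ip in_induced_edges[of b y "set p"] p by (auto simp: ipath_iff)
    then show ?thesis
      using path_edges_in_middle ipath_distinct[OF ip(1)] p by metis
  qed
qed

text \<open>Within \<open>C\<close>, the list of its vertices is a thread, so a hole that has
  started on \<open>C\<close> is forced all the way round. This incomparability is how the holes of
  a solid get identified below.\<close>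

lemma hole_subset_hole:
  assumes "hole D" "hole C" "D \<subseteq> C"
  shows "D = C"
proof -
  obtain x where x: "x \<in> D" using assms(1) by (auto simp: hole_def)
  then obtain p where r: "ring x p" "C = insert x (set p)"
    using hole_rooted[OF assms(2)] assms(3) by blast
  then obtain b q where p: "p = b # q" by (cases p) (auto simp: ring_def)
  have nb: "w = hd p \<or> w = last p" if w: "w \<in> D" "adj x w" for w
  proof -
    have "w \<in> set p" using w assms(3) r(2) adj_irrefl by (metis insertE subsetD)
    then show ?thesis using r(1) w(2) by (simp add: ring_def)
  qed
  have "b \<in> D" using hole_two(1)[OF assms(1) x nb] p by simp
  then have "set q \<subseteq> D"
    using absorb_forward[OF assms(1,3), of "[]" x b q] thread_ring[OF r(1)] r p by simp
  then show ?thesis using x p r assms(3) \<open>b \<in> D\<close> by auto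
qed

lemma hole_triangle: "hole {a, b, c}" if "adj a b" "adj b c" "adj a c"
proof -
  have "ring a [b, c]" using that by (auto simp: ring_def)
  then show ?thesis unfolding hole_def by (intro exI[of _ a] exI[of _ "[b, c]"]) auto
qed

end

section \<open>Walks and edge labellings\<close>

text \<open>Repetitions count: an edge traversed twice cancels modulo 2.\<close>

primrec walk_sum :: "('a set \<Rightarrow> bit) \<Rightarrow> 'a list \<Rightarrow> bit" where
  "walk_sum \<mu> [] = 0"
| "walk_sum \<mu> (x # xs) = (if xs = [] then 0 else \<mu> {x, hd xs} + walk_sum \<mu> xs)"

lemma walk_sum_append:
  "xs \<noteq> [] \<Longrightarrow> ys \<noteq> [] \<Longrightarrow> walk_sum \<mu> (xs @ ys) = walk_sum \<mu> xs + \<mu> {last xs, hd ys} + walk_sum \<mu> ys"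
  by (induction xs) (auto simp: hd_append add.assoc)

lemma walk_sum_join:
  assumes "xs \<noteq> []" "ys \<noteq> []" "last xs = hd ys"
  shows "walk_sum \<mu> (xs @ tl ys) = walk_sum \<mu> xs + walk_sum \<mu> ys"
proof (cases "tl ys = []")
  case True
  then show ?thesis using assms(2) by (cases ys) auto
next
  case False
  then show ?thesis using assms walk_sum_append[of xs "tl ys" \<mu>] by (cases ys) (auto simp: add.assoc)
qed

lemma walk_sum_rev [simp]: "walk_sum \<mu> (rev xs) = walk_sum \<mu> xs"
proof (induction xs)
  case (Cons x xs)
  then show ?case
    by (cases "xs = []") (simp_all add: walk_sum_append last_rev insert_commute add.commute)
qed simp

lemma walk_sum_add: "walk_sum (\<lambda>e. \<mu> e + \<nu> e) xs = walk_sum \<mu> xs + walk_sum \<nu> xs"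
  by (induction xs) (auto simp: algebra_simps)

lemma walk_sum_zero [simp]: "walk_sum (\<lambda>e. 0) xs = 0"
  by (induction xs) auto

lemma walk_sum_sum: "walk_sum (\<lambda>e. \<Sum>i\<in>I. \<mu> i e) xs = (\<Sum>i\<in>I. walk_sum (\<mu> i) xs)"
  by (induction xs) (auto simp: sum.distrib)

lemma finite_path_edges [simp]: "finite (path_edges p)"
  by (rule finite_subset[of _ "Pow (set p)"]) (use path_edges_subset in auto)

lemma walk_sum_distinct: "distinct p \<Longrightarrow> walk_sum \<mu> p = sum \<mu> (path_edges p)"
proof (induction p)
  case (Cons x p)
  have "{x, hd p} \<notin> path_edges p" using Cons.prems path_edges_subset by fastforce
  then show ?case using Cons by (cases "p = []") (auto simp: path_edges_Cons)
qed simp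

lemma distinct_split_two:
  assumes "\<not> distinct l"
  obtains a x b c where "l = a @ x # b @ x # c"
proof -
  obtain xs ys zs y where "l = xs @ [y] @ ys @ [y] @ zs"
    using not_distinct_decomp[OF assms] by blast
  then show thesis using that by simp
qed

context edge_set
begin

abbreviation walk :: "'a list \<Rightarrow> bool" where
  "walk \<equiv> successively adj"

lemma walk_rev: "walk l \<Longrightarrow> walk (rev l)"
  by (simp add: adj_sym)

definition walk_between :: "'a set \<Rightarrow> 'a \<Rightarrow> 'a list \<Rightarrow> 'a \<Rightarrow> bool" where
  "walk_between W x l y \<longleftrightarrow> l \<noteq> [] \<and> set l \<subseteq> W \<and> walk l \<and> hd l = x \<and> last l = y"

definition label_sum :: "('a set \<Rightarrow> bit) \<Rightarrow> 'a set \<Rightarrow> bit" where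
  "label_sum \<mu> D = sum \<mu> (induced_edges D)"

lemma label_sum_add: "label_sum (\<lambda>e. \<mu> e + \<nu> e) D = label_sum \<mu> D + label_sum \<nu> D"
  by (simp add: label_sum_def sum.distrib)

lemma label_sum_sum: "label_sum (\<lambda>e. \<Sum>i\<in>I. \<mu> i e) D = (\<Sum>i\<in>I. label_sum (\<mu> i) D)"
  unfolding label_sum_def by (rule sum.swap)

lemma label_sum_zero [simp]: "label_sum (\<lambda>e. 0) D = 0"
  by (simp add: label_sum_def)

lemma label_sum_cong: "(\<And>x y. x \<in> D \<Longrightarrow> y \<in> D \<Longrightarrow> adj x y \<Longrightarrow> \<mu> {x, y} = \<nu> {x, y}) \<Longrightarrow> label_sum \<mu> D = label_sum \<nu> D"
proof -
  assume *: "\<And>x y. x \<in> D \<Longrightarrow> y \<in> D \<Longrightarrow> adj x y \<Longrightarrow> \<mu> {x, y} = \<nu> {x, y}"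
  have "\<mu> e = \<nu> e" if e: "e \<in> induced_edges D" for e
  proof -
    have "e \<in> E" using e by (simp add: induced_edges_def)
    then obtain x y where xy: "e = {x, y}" "x \<noteq> y" "adj x y" by (rule edgeE)
    then show ?thesis using * e by (simp add: in_induced_edges)
  qed
  then show ?thesis by (simp add: label_sum_def)
qed

lemma induced_edges_ring:
  assumes "ring x p"
  shows "induced_edges (insert x (set p)) = insert {x, hd p} (insert {x, last p} (path_edges p))"
proof -
  have p: "p \<noteq> []" "induced_edges (set p) = path_edges p"
    and n: "\<And>z. z \<in> set p \<Longrightarrow> adj x z \<longleftrightarrow> z = hd p \<or> z = last p"
    using assms by (auto simp: ring_def ipath_iff)
  have "{{x, y} | y. y \<in> set p \<and> adj x y} = {{x, hd p}, {x, last p}}"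
    using n p(1) by (auto intro: exI[of _ "hd p"] exI[of _ "last p"])
  then show ?thesis by (simp add: induced_edges_insert p)
qed

text \<open>A hole has no chords, so its induced edges are those of the closed walk around it, each
  used once.\<close>

lemma label_sum_ring: "ring x p \<Longrightarrow> label_sum \<mu> (insert x (set p)) = walk_sum \<mu> (x # p @ [x])"
proof -
  assume r: "ring x p"
  have p: "p \<noteq> []" "distinct p" "x \<notin> set p" using r by (auto simp: ring_def ipath_distinct)
  have n: "{x, last p} \<notin> path_edges p" "{x, hd p} \<notin> path_edges p"
    using p path_edges_subset by fastforce+
  have "{x, hd p} \<noteq> {x, last p}" using ring_hd_neq_last[OF r] by (auto simp: doubleton_eq_iff)
  then have "label_sum \<mu> (insert x (set p)) = \<mu> {x, hd p} + (\<mu> {x, last p} + sum \<mu> (path_edges p))"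
    using n by (simp add: label_sum_def induced_edges_ring[OF r])
  also have "\<dots> = \<mu> {x, hd p} + (walk_sum \<mu> p + \<mu> {last p, x})"
    using p by (simp add: walk_sum_distinct insert_commute add_ac)
  also have "\<dots> = walk_sum \<mu> (x # p @ [x])"
    using p by (simp add: walk_sum_append)
  finally show ?thesis .
qed

text \<open>The labels are the coboundary of \<open>p\<close>, and the sum telescopes.\<close>

lemma walk_sum_potential:
  assumes "walk l" "l \<noteq> []" "set l \<subseteq> W"
    "\<And>x y. x \<in> W \<Longrightarrow> y \<in> W \<Longrightarrow> adj x y \<Longrightarrow> \<mu> {x, y} = p x + p y"
  shows "walk_sum \<mu> l = p (hd l) + p (last l)"
  using assms(1-3)
proof (induction l)
  case (Cons x l)
  show ?case
  proof (cases l)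
    case (Cons y l')
    then have "walk_sum \<mu> (x # l) = (p x + p y) + (p y + p (last l))"
      using Cons.prems Cons.IH assms(4)[of x y] by simp
    then show ?thesis using Cons by (simp add: add.assoc)
  qed simp
qed simp

lemma ipath_walk: "ipath p \<Longrightarrow> walk p"
proof (induction p)
  case (Cons x p)
  then show ?case by (cases p) auto
qed simp

lemma ring_walk: "ring x p \<Longrightarrow> walk (x # p @ [x])"
  unfolding ring_def
  by (auto simp: successively_Cons successively_append_iff ipath_walk hd_append)
    (metis adj_sym last_in_set length_0_conv not_numeral_le_zero)

lemma label_sum_potential:
  assumes "hole D" "\<And>x y. x \<in> D \<Longrightarrow> y \<in> D \<Longrightarrow> adj x y \<Longrightarrow> \<mu> {x, y} = p x + p y"
  shows "label_sum \<mu> D = 0"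
proof -
  obtain x q where r: "ring x q" "D = insert x (set q)" using assms(1) by (auto simp: hole_def)
  then show ?thesis
    using walk_sum_potential[OF ring_walk[OF r(1)], of D \<mu> p] assms(2) by (auto simp: label_sum_ring)
qed

lemma not_ipath_chord:
  assumes "\<not> ipath p" "distinct p" "walk p"
  shows "\<exists>a y b z c. p = a @ y # b @ z # c \<and> b \<noteq> [] \<and> adj y z"
  using assms
proof (induction p)
  case (Cons x p)
  have w: "walk p" using Cons.prems by (auto simp: successively_Cons)
  show ?case
  proof (cases "ipath p")
    case False
    then obtain a y b z c where "p = a @ y # b @ z # c \<and> b \<noteq> [] \<and> adj y z"
      using Cons w by auto
    then show ?thesis by (intro exI[of _ "x # a"]) auto
  next
    case True
    then obtain z where z: "z \<in> set p" "adj x z \<noteq> (z = hd p)" using Cons.prems by auto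
    have "adj x (hd p)" using Cons.prems(3) z(1) by (auto simp: successively_Cons)
    with z have "adj x z" "z \<noteq> hd p" by auto
    moreover obtain b c where p: "p = b @ z # c" using z(1) split_list by metis
    ultimately have "b \<noteq> []" by auto
    then show ?thesis using p \<open>adj x z\<close>
      by (intro exI[of _ "[]"] exI[of _ x] exI[of _ b] exI[of _ z] exI[of _ c]) auto
  qed
qed simp

section \<open>Labellings that vanish on all holes are coboundaries\<close>

definition zero_on :: "'a set \<Rightarrow> ('a set \<Rightarrow> bit) \<Rightarrow> bool" where
  "zero_on W \<mu> \<longleftrightarrow> (\<forall>D. hole D \<longrightarrow> D \<subseteq> W \<longrightarrow> label_sum \<mu> D = 0)"

lemma walk_sum_rotate: "a \<noteq> [] \<Longrightarrow> b \<noteq> [] \<Longrightarrow> walk_sum \<mu> (a @ b @ [hd a]) = walk_sum \<mu> (b @ a @ [hd b])"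
  by (simp add: walk_sum_append hd_append add_ac)

text \<open>The holes generate the cycle space: a closed walk with a repeated vertex or a chord
  splits into two shorter closed walks with the same total, and one with neither is a hole or goes
  back and forth along one edge. Here \<open>l\<close> lists a closed walk without repeating its
  first vertex at the end.\<close>

lemma closed_walk_zero:
  assumes "zero_on W \<mu>" "set l \<subseteq> W" "l \<noteq> []" "walk l" "adj (last l) (hd l)"
  shows "walk_sum \<mu> (l @ [hd l]) = 0"
  using assms(2-)
proof (induction "length l" arbitrary: l rule: less_induct)
  case less
  \<comment> \<open>The chord from \<open>x\<close> to \<open>z\<close> closes both pieces and
    cancels. Writing \<open>l\<close> as \<open>l'' @ l'\<close> allows the walk to be rotated until
    it starts at an end of the chord.\<close>
  have chord: "walk_sum \<mu> (x # a @ z # b @ [x]) = 0"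
    if *: "x # a @ z # b = l' @ l''" "l = l'' @ l'" "a \<noteq> []" "b \<noteq> []" "adj x z" for x a z b l' l''
  proof -
    have w: "walk (x # a @ z # b)" "adj (last b) x"
    proof -
      show "walk (x # a @ z # b)"
        unfolding *(1) using less.prems(3,4) *(2) by (cases "l'' = []"; cases "l' = []") (auto simp: successively_append_iff)
      have e: "last (l' @ l'') = last b" "hd (l' @ l'') = x" using *(1,4) by (simp_all flip: *(1))
      show "adj (last b) x"
      proof (cases "l' = [] \<or> l'' = []")
        case True
        then show ?thesis using less.prems(4) *(2) e by auto
      next
        case False
        then have "adj (last l'') (hd l')"
          using less.prems(3) * by (auto simp: successively_append_iff)
        then show ?thesis using False e by simp
      qed
    qed
    have "length l = length (x # a @ z # b)" "set l = set (x # a @ z # b)"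
      unfolding *(1) using *(2) by auto
    moreover have "0 < length a" "0 < length b" using *(3,4) by auto
    ultimately have len: "length (x # a @ [z]) < length l" "length (z # b @ [x]) < length l"
      and sub: "set (x # a @ [z]) \<subseteq> W" "set (z # b @ [x]) \<subseteq> W"
      using less.prems(1) by auto
    have "walk_sum \<mu> ((x # a @ [z]) @ [hd (x # a @ [z])]) = 0"
      by (rule less.hyps[OF len(1) sub(1)])
        (use w *(3-) in \<open>auto simp: successively_Cons successively_append_iff hd_append adj_sym\<close>)
    moreover have "walk_sum \<mu> ((z # b @ [x]) @ [hd (z # b @ [x])]) = 0"
      by (rule less.hyps[OF len(2) sub(2)])
        (use w *(3-) in \<open>auto simp: successively_Cons successively_append_iff hd_append adj_sym\<close>)
    moreover have "walk_sum \<mu> (x # a @ z # b @ [x]) =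
        walk_sum \<mu> ((x # a @ [z]) @ [x]) + walk_sum \<mu> ((z # b @ [x]) @ [z])"
      using *(3,4) by (simp add: walk_sum_append insert_commute add_ac)
    ultimately show ?thesis by simp
  qed
  show ?case
  proof (cases "distinct l")
    case False
    then obtain a x b c where l: "l = a @ x # b @ x # c" by (rule distinct_split_two)
    \<comment> \<open>Rotate the walk so that it starts at the repeated vertex, and cut it at the
      second occurrence.\<close>
    have "walk_sum \<mu> (l @ [hd l]) = walk_sum \<mu> ((x # b @ x # c) @ a @ [x])"
    proof (cases "a = []")
      case False
      then show ?thesis using walk_sum_rotate[of a "x # b @ x # c" \<mu>] l by simp
    qed (use l in auto)
    also have "\<dots> = walk_sum \<mu> ((x # b) @ [x]) + walk_sum \<mu> ((x # c @ a) @ [x])"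
      using walk_sum_join[of "x # b @ [x]" "x # c @ a @ [x]" \<mu>] by simp
    also have "walk_sum \<mu> ((x # b) @ [hd (x # b)]) = 0"
      by (rule less.hyps) (use l less.prems in \<open>auto simp: successively_Cons successively_append_iff hd_append split: if_splits\<close>)
    then have "walk_sum \<mu> ((x # b) @ [x]) = 0" by simp
    also have "walk_sum \<mu> ((x # c @ a) @ [hd (x # c @ a)]) = 0"
      by (rule less.hyps) (use l less.prems in \<open>auto simp: successively_Cons successively_append_iff hd_append split: if_splits\<close>)
    then have "walk_sum \<mu> ((x # c @ a) @ [x]) = 0" by simp
    finally show ?thesis by simp
  next
    case True
    obtain x p where l: "l = x # p" using less.prems(2) by (cases l) auto
    show ?thesis
    proof (cases "ring x p")
      case True
      then have "hole (set l)" using l by (auto simp: hole_def)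
      then have "label_sum \<mu> (insert x (set p)) = 0" using assms(1) less.prems(1) l by (simp add: zero_on_def)
      then show ?thesis using label_sum_ring[OF True] l by simp
    next
      case nr: False
      have p: "p \<noteq> []" using less.prems(4) l by auto
      consider "length p = 1" | "2 \<le> length p" "\<not> ipath p" |
        z where "2 \<le> length p" "ipath p" "z \<in> set p" "adj x z \<noteq> (z = hd p \<or> z = last p)"
      proof -
        have "length p = 1 \<or> 2 \<le> length p" using p by (cases p) (auto simp: Suc_le_eq)
        then show ?thesis
          using nr True l that unfolding ring_def by auto
      qed
      then show ?thesis
      proof cases
        case 1
        then obtain y where "p = [y]" by (cases p) auto
        then show ?thesis using l by (simp add: insert_commute)
      next
        case 2
        have "walk p" using less.prems(3) l by (auto simp: successively_Cons)
        then obtain a y b z c where "p = a @ y # b @ z # c" "b \<noteq> []" "adj y z"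
          using not_ipath_chord[OF 2(2)] True l by auto
        then have "l = (x # a) @ (y # b @ z # c)" using l by simp
        then show ?thesis
          using chord[of y b z "c @ x # a" "y # b @ z # c" "x # a"] \<open>b \<noteq> []\<close> \<open>adj y z\<close>
            walk_sum_rotate[of "x # a" "y # b @ z # c" \<mu>] by simp
      next
        case 3
        have "adj x (hd p)" "adj x (last p)" using less.prems l p
          by (auto simp: successively_Cons adj_sym)
        then have z: "adj x z" "z \<noteq> hd p" "z \<noteq> last p" using 3(4) by auto
        obtain a b where ab: "p = a @ z # b" using 3(3) split_list by metis
        then have "a \<noteq> []" "b \<noteq> []" using z by auto
        then show ?thesis using chord[of x a z b "[]" l] z(1) l ab by simp
      qed
    qed
  qed
qed

lemma closed_walk_zero':
  assumes "zero_on W \<mu>" "set l \<subseteq> W" "walk l" "hd l = last l"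
  shows "walk_sum \<mu> l = 0"
proof (cases "length l \<le> 1")
  case True
  then show ?thesis by (cases l) auto
next
  case False
  then obtain x m y where l: "l = (x # m) @ [y]"
    by (cases l; cases "tl l" rule: rev_cases) auto
  then have "y = x" using assms(4) by simp
  moreover have "walk_sum \<mu> ((x # m) @ [hd (x # m)]) = 0"
    by (rule closed_walk_zero[OF assms(1)])
      (use assms(2,3) l \<open>y = x\<close> in \<open>auto simp: successively_append_iff simp del: append_Cons\<close>)
  ultimately show ?thesis using l by simp
qed

section \<open>Walks with given ends and connected sets\<close>

lemma walk_between_refl: "x \<in> W \<Longrightarrow> walk_between W x [x] x"
  by (simp add: walk_between_def)

lemma walk_between_edge: "x \<in> W \<Longrightarrow> y \<in> W \<Longrightarrow> adj x y \<Longrightarrow> walk_between W x [x, y] y"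
  by (simp add: walk_between_def)

lemma walk_between_rev: "walk_between W x l y \<Longrightarrow> walk_between W y (rev l) x"
  by (auto simp: walk_between_def walk_rev hd_rev last_rev simp del: successively_rev)

lemma walk_between_join:
  assumes "walk_between W x l y" "walk_between W y m z"
  shows "walk_between W x (l @ tl m) z"
proof (cases m)
  case (Cons a m')
  then show ?thesis using assms
    by (cases "m' = []") (auto simp: walk_between_def successively_append_iff successively_Cons)
qed (use assms in \<open>simp add: walk_between_def\<close>)

lemma walk_between_mono: "walk_between W x l y \<Longrightarrow> W \<subseteq> W' \<Longrightarrow> walk_between W' x l y"
  by (auto simp: walk_between_def)

lemma walk_sum_walk_between_join: "walk_between W x l y \<Longrightarrow> walk_between W y m z \<Longrightarrow> walk_sum \<mu> (l @ tl m) = walk_sum \<mu> l + walk_sum \<mu> m"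
  by (rule walk_sum_join) (auto simp: walk_between_def)

lemma walk_sum_walk_between_unique:
  assumes "zero_on W \<mu>" "walk_between W x l y" "walk_between W x m y"
  shows "walk_sum \<mu> l = walk_sum \<mu> m"
proof -
  have w: "walk_between W x (l @ tl (rev m)) x" using walk_between_join[OF assms(2) walk_between_rev[OF assms(3)]] .
  have "walk_sum \<mu> (l @ tl (rev m)) = 0"
    by (rule closed_walk_zero'[OF assms(1)]) (use w in \<open>auto simp: walk_between_def\<close>)
  then show ?thesis using walk_sum_walk_between_join[OF assms(2) walk_between_rev[OF assms(3)]]
    by (simp add: bit_add_eq_0_iff)
qed

lemma walk_to_ipath:
  assumes "walk_between W x l y"
  shows "\<exists>p. ipath p \<and> p \<noteq> [] \<and> set p \<subseteq> set l \<and> hd p = x \<and> last p = y"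
  using assms
proof (induction l arbitrary: x)
  case (Cons a l)
  show ?case
  proof (cases "l = []")
    case True
    then show ?thesis using Cons.prems by (intro exI[of _ "[a]"]) (auto simp: walk_between_def)
  next
    case False
    have ax: "a = x" using Cons.prems by (simp add: walk_between_def)
    have "walk_between W (hd l) l y" using Cons.prems False by (auto simp: walk_between_def successively_Cons)
    then obtain p where p: "ipath p" "p \<noteq> []" "set p \<subseteq> set l" "hd p = hd l" "last p = y"
      using Cons.IH by blast
    have "adj x (hd p)" using Cons.prems False p by (auto simp: walk_between_def successively_Cons)
    \<comment> \<open>Jumping from \<open>x\<close> to its last neighbour on \<open>p\<close> leaves
      no chord at \<open>x\<close>.\<close>
    then obtain b z c where pz: "p = b @ z # c" "adj x z" "\<forall>w\<in>set c. \<not> adj x w"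
      using split_list_last_prop[of p "adj x"] p(2) by (metis hd_in_set)
    show ?thesis
    proof (cases "x \<in> set p")
      case True
      then obtain b' c' where "p = b' @ x # c'" using split_list by metis
      then show ?thesis using p ax by (intro exI[of _ "x # c'"]) (auto simp: ipath_append)
    next
      case False
      have "ipath (z # c)" using p(1) pz(1) by (auto simp: ipath_append)
      then have "ipath (x # z # c)" using pz False by auto
      then show ?thesis using p pz ax by (intro exI[of _ "x # z # c"]) auto
    qed
  qed
qed (simp add: walk_between_def)

lemma walk_between_ipath:
  assumes "walk_between W x l y"
  obtains p where "ipath p" "p \<noteq> []" "set p \<subseteq> W" "hd p = x" "last p = y" "set p \<subseteq> set l"
  using walk_to_ipath[OF assms] assms unfolding walk_between_def by (metis subset_trans)

lemma walk_cross:
  assumes "walk l" "l \<noteq> []" "hd l \<in> B" "last l \<notin> B"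
  obtains l1 b z l2 where "l = l1 @ b # z # l2" "b \<in> B" "z \<notin> B" "adj b z"
  using assms
proof (induction l arbitrary: thesis)
  case (Cons x l)
  show ?case
  proof (cases "l = []")
    case False
    show ?thesis
    proof (cases "hd l \<in> B")
      case True
      obtain l1 b z l2 where "l = l1 @ b # z # l2" "b \<in> B" "z \<notin> B" "adj b z"
        by (rule Cons.IH) (use Cons.prems True False in \<open>auto simp: successively_Cons\<close>)
      then show ?thesis using Cons.prems(1)[of "x # l1"] by simp
    next
      case nB: False
      then show ?thesis using Cons.prems(1)[of "[]" x "hd l" "tl l"] Cons.prems(2-) False
        by (auto simp: successively_Cons)
    qed
  qed (use Cons.prems in auto)
qed simp

text \<open>Connectivity of the induced subgraph. Unlike \<open>connected_graph\<close>, it admits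
  the empty set.\<close>

definition conn :: "'a set \<Rightarrow> bool" where
  "conn X \<longleftrightarrow> (\<forall>x\<in>X. \<forall>y\<in>X. \<exists>l. walk_between X x l y)"

lemma connI_root:
  assumes "\<And>x. x \<in> X \<Longrightarrow> \<exists>l. walk_between X r l x"
  shows "conn X"
  unfolding conn_def using assms walk_between_join walk_between_rev by meson

lemma conn_singleton [simp]: "conn {x}"
  using walk_between_refl[of x "{x}"] by (auto simp: conn_def)

lemma conn_walk: "walk l \<Longrightarrow> conn (set l)"
proof (induction l)
  case (Cons x l)
  show ?case
  proof (cases "l = []")
    case False
    show ?thesis
    proof (rule connI_root[of _ x])
      fix y assume y: "y \<in> set (x # l)"
      show "\<exists>m. walk_between (set (x # l)) x m y"
      proof (cases "y = x")
        case True then show ?thesis using walk_between_refl[of x "set (x # l)"] by auto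
      next
        case ne: False
        have "conn (set l)" using Cons by (auto simp: successively_Cons)
        moreover have "y \<in> set l" "hd l \<in> set l" using y ne False by auto
        ultimately obtain m where "walk_between (set l) (hd l) m y" unfolding conn_def by blast
        then have "walk_between (set (x # l)) (hd l) m y" by (rule walk_between_mono) auto
        moreover have "walk_between (set (x # l)) x [x, hd l] (hd l)"
          by (rule walk_between_edge) (use Cons.prems False in \<open>auto simp: successively_Cons\<close>)
        ultimately show ?thesis using walk_between_join by blast
      qed
    qed
  qed simp
qed (simp add: conn_def)

lemma conn_Un_common:
  assumes "conn A" "conn B" "r \<in> A" "r \<in> B"
  shows "conn (A \<union> B)"
proof (rule connI_root[of _ r])
  fix x assume "x \<in> A \<union> B"
  then obtain l where "walk_between A r l x \<or> walk_between B r l x" using assms unfolding conn_def by blast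
  then show "\<exists>l. walk_between (A \<union> B) r l x" using walk_between_mono by (metis sup_ge1 sup_ge2)
qed

lemma conn_Un_adj:
  assumes "conn A" "conn B" "a \<in> A" "b \<in> B" "adj a b"
  shows "conn (A \<union> B)"
proof -
  have "conn {a, b}" using conn_walk[of "[a, b]"] assms(5) by simp
  then have "conn (A \<union> {a, b})" using conn_Un_common[of A "{a, b}" a] assms by simp
  then have "conn ((A \<union> {a, b}) \<union> B)" using conn_Un_common[of "A \<union> {a, b}" B b] assms by simp
  moreover have "(A \<union> {a, b}) \<union> B = A \<union> B" using assms by auto
  ultimately show ?thesis by simp
qed

lemma conn_insert: "conn A \<Longrightarrow> a \<in> A \<Longrightarrow> adj a b \<Longrightarrow> conn (insert b A)"
  using conn_Un_adj[of A "{b}" a b] by simp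

lemma conn_cross:
  assumes "conn X" "B \<subseteq> X" "B \<noteq> {}" "B \<noteq> X"
  obtains b z where "b \<in> B" "z \<in> X - B" "adj b z"
proof -
  obtain x y where xy: "x \<in> B" "y \<in> X" "y \<notin> B" using assms by blast
  then obtain l where l: "walk_between X x l y" using assms unfolding conn_def by blast
  then obtain l1 b z l2 where "l = l1 @ b # z # l2" "b \<in> B" "z \<notin> B" "adj b z"
    using walk_cross[of l B] xy unfolding walk_between_def by metis
  then show thesis using that l by (auto simp: walk_between_def)
qed

text \<open>A maximal connected proper subset containing \<open>A\<close> can be enlarged by one
  adjacent vertex, and by maximality that vertex is the only one missing.\<close>

lemma conn_noncut:
  assumes "conn X" "finite X" "A \<subseteq> X" "A \<noteq> {}" "conn A" "A \<noteq> X"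
  obtains z where "z \<in> X - A" "conn (X - {z})"
proof -
  let ?S = "{B. A \<subseteq> B \<and> B \<subset> X \<and> conn B}"
  have "finite ?S" by (rule finite_subset[of _ "Pow X"]) (use assms in auto)
  moreover have "A \<in> ?S" using assms by auto
  ultimately obtain B where B: "B \<in> ?S" "\<And>C. C \<in> ?S \<Longrightarrow> B \<subseteq> C \<Longrightarrow> B = C"
    using finite_has_maximal[of ?S] by (metis (no_types, lifting) emptyE)
  obtain b z where z: "b \<in> B" "z \<in> X - B" "adj b z"
    by (rule conn_cross[of X B]) (use B(1) assms in auto)
  have "conn (insert z B)" using conn_insert z B(1) by blast
  then have "insert z B \<in> ?S" if "insert z B \<noteq> X" using that B(1) z by auto
  then have "insert z B = X" using B(2)[of "insert z B"] z by blast
  then have "X - {z} = B" using z by auto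
  then show thesis using that[of z] B(1) z by auto
qed

lemma hole_conn: "hole D \<Longrightarrow> conn D"
proof -
  assume "hole D"
  then obtain x p where "ring x p" "D = insert x (set p)" by (auto simp: hole_def)
  then show ?thesis using conn_walk[OF ring_walk[of x p]] by simp
qed

text \<open>Walk sums depend only on the ends of the walk
  (\<open>walk_sum_walk_between_unique\<close>), so the sum from a fixed root serves as
  \<open>p\<close>.\<close>

lemma potential_exists:
  assumes "conn W" "zero_on W \<mu>"
  obtains p where "\<And>x y. x \<in> W \<Longrightarrow> y \<in> W \<Longrightarrow> adj x y \<Longrightarrow> \<mu> {x, y} = p x + p y"
proof (cases "W = {}")
  case False
  then obtain r where r: "r \<in> W" by blast
  define P where "P x = (SOME l. walk_between W r l x)" for x
  have P: "walk_between W r (P x) x" if "x \<in> W" for x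
  proof -
    have "\<exists>l. walk_between W r l x" using assms(1) r that by (simp add: conn_def)
    then show ?thesis unfolding P_def by (rule someI_ex)
  qed
  have "\<mu> {x, y} = walk_sum \<mu> (P x) + walk_sum \<mu> (P y)" if xy: "x \<in> W" "y \<in> W" "adj x y" for x y
  proof -
    have e: "walk_between W x [x, y] y" using xy by (rule walk_between_edge)
    have "walk_sum \<mu> (P y) = walk_sum \<mu> (P x @ tl [x, y])"
      by (rule walk_sum_walk_between_unique[OF assms(2) P[OF xy(2)] walk_between_join[OF P[OF xy(1)] e]])
    also have "\<dots> = walk_sum \<mu> (P x) + \<mu> {x, y}" using walk_sum_walk_between_join[OF P[OF xy(1)] e] by simp
    finally show ?thesis by simp
  qed
  then show thesis by (rule that)
next
  case True
  show thesis by (rule that[of "\<lambda>_. 0"]) (use True in auto)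
qed

end

section \<open>Induced cycles of the solid graphs\<close>

lemma others_in_three:
  assumes "k \<in> {1..3::nat}"
  obtains i j where "i \<in> {1..3}" "j \<in> {1..3}" "i \<noteq> j" "i \<noteq> k" "j \<noteq> k" "{1..3} = {i, j, k}"
proof -
  have eq: "{1..3::nat} = {1, 2, 3}" by auto
  have "k = 1 \<or> k = 2 \<or> k = 3" using assms unfolding atLeastAtMost_iff by arith
  then consider "k = 1" | "k = 2" | "k = 3" by blast
  then show thesis
  proof cases
    case 1
    show thesis by (rule that[of 2 3]) (use 1 eq in auto)
  next
    case 2
    show thesis by (rule that[of 1 3]) (use 2 eq in auto)
  next
    case 3
    show thesis by (rule that[of 1 2]) (use 3 eq in auto)
  qed
qed

lemma third_of_three:
  assumes "i \<in> {1..3::nat}" "j \<in> {1..3}" "i \<noteq> j"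
  obtains k where "k \<in> {1..3}" "k \<noteq> i" "k \<noteq> j" "{1..3} = {k, i, j}"
proof -
  obtain a b where ab: "a \<in> {1..3}" "b \<in> {1..3}" "a \<noteq> b" "a \<noteq> i" "b \<noteq> i" "{1..3} = {a, b, i}"
    by (rule others_in_three[OF assms(1)])
  have "j = a \<or> j = b" using assms(2,3) unfolding ab(6) by blast
  then show thesis
  proof
    assume "j = a"
    show thesis by (rule that[of b]) (use ab \<open>j = a\<close> in blast)+
  next
    assume "j = b"
    show thesis by (rule that[of a]) (use ab \<open>j = b\<close> in blast)+
  qed
qed

context edge_set
begin

text \<open>The two paths run in parallel, head joined to head and last to last. If \<open>q\<close>
  is a single vertex, it plays both roles and becomes the root of the ring.\<close>

lemma hole_two_paths:
  assumes "ipath p" "ipath q" "p \<noteq> []" "q \<noteq> []" "set p \<inter> set q = {}" "3 \<le> length p + length q"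
    "\<And>a b. a \<in> set p \<Longrightarrow> b \<in> set q \<Longrightarrow>
      adj a b \<longleftrightarrow> (a = hd p \<and> b = hd q) \<or> (a = last p \<and> b = last q)"
  shows "hole (set p \<union> set q)"
proof -
  obtain b q' where q: "q = b # q'" using assms(4) by (cases q) auto
  show ?thesis
  proof (cases "q' = []")
    case True
    then have "adj b z \<longleftrightarrow> z = hd p \<or> z = last p" if "z \<in> set p" for z
      using assms(7)[OF that, of b] q by (simp add: adj_sym)
    then have "ring b p" using assms q True by (auto simp: ring_def)
    then show ?thesis using q True unfolding hole_def by (intro exI[of _ b] exI[of _ p]) auto
  next
    case False
    have b: "b \<noteq> last q'" "b \<notin> set p" "b \<notin> set q'" "ipath q'"
      using assms(2,5) q False by auto
    have *: "adj a c \<longleftrightarrow> a = last p \<and> c = last q'" if "a \<in> set p" "c \<in> set q'" for a c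
      using assms(7)[OF that(1), of c] that q False b by auto
    have ip: "ipath (p @ rev q')"
      unfolding ipath_append using assms(1,5) q b * False by (auto simp: hd_rev)
    have "adj b z \<longleftrightarrow> z = hd p \<or> z = hd q'" if "z \<in> set p \<union> set q'" for z
    proof (cases "z \<in> set p")
      case True
      then have "z \<noteq> hd q'" using assms(5) q False by (metis IntI emptyE hd_in_set list.set_intros(2))
      then show ?thesis using assms(7)[OF True, of b] q b False by (auto simp: adj_sym)
    next
      case nz: False
      then have "z \<noteq> hd p" using assms(3) by auto
      then show ?thesis using assms(2) q that nz by auto
    qed
    moreover have "2 \<le> length p + length q'" using assms(3) False by (cases p; cases q') auto
    ultimately have "ring b (p @ rev q')"
      using ip b False assms(3) by (auto simp: ring_def last_rev)
    then show ?thesis using q unfolding hole_def by (intro exI[of _ b] exI[of _ "p @ rev q'"]) auto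
  qed
qed

text \<open>Equivalently, the holes in \<open>W\<close> sum to zero in the edge space modulo 2. For
  the four kinds of solids the count turns out to be two for every edge, as for the faces of a
  polyhedron.\<close>

definition even_holes :: "'a set \<Rightarrow> bool" where
  "even_holes W \<longleftrightarrow> (\<forall>e\<in>induced_edges W. even (card {D. hole D \<and> D \<subseteq> W \<and> e \<subseteq> D}))"

lemma of_nat_even_bit: "even n \<Longrightarrow> of_nat n = (0::bit)"
  by (auto elim!: evenE)

lemma finite_holes: "finite W \<Longrightarrow> finite {D. hole D \<and> D \<subseteq> W}"
  by (rule finite_subset[of _ "Pow W"]) auto

text \<open>After exchanging the sums, each label is counted as often as there are holes through its
  edge.\<close>

lemma even_holes_sum:
  assumes "finite W" "even_holes W"
  shows "(\<Sum>D\<in>{D. hole D \<and> D \<subseteq> W}. label_sum \<mu> D) = 0"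
proof -
  let ?H = "{D. hole D \<and> D \<subseteq> W}"
  have "(\<Sum>D\<in>?H. label_sum \<mu> D) = (\<Sum>D\<in>?H. \<Sum>e\<in>{e\<in>induced_edges W. e \<subseteq> D}. \<mu> e)"
    unfolding label_sum_def by (intro sum.cong) (auto simp: induced_edges_def)
  also have "\<dots> = (\<Sum>e\<in>induced_edges W. \<Sum>D\<in>{D\<in>?H. e \<subseteq> D}. \<mu> e)"
    by (rule sum.swap_restrict) (use assms finite_holes finite_induced_edges in auto)
  also have "\<dots> = (\<Sum>e\<in>induced_edges W. of_nat (card {D. hole D \<and> D \<subseteq> W \<and> e \<subseteq> D}) * \<mu> e)"
    by (simp add: conj_assoc)
  also have "\<dots> = 0"
    using assms(2) by (intro sum.neutral) (simp add: even_holes_def of_nat_even_bit)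
  finally show ?thesis .
qed

text \<open>The four kinds of solids as vertex sets, in terms of induced paths: \<open>theta\<close>
  is the trihedron, \<open>wheel\<close> is what \<open>is_pyramid\<close> describes, and
  \<open>stamp\<close> and \<open>prism\<close> keep their names. The lists omit the vertices shared
  by all three paths.\<close>

definition theta :: "'a set \<Rightarrow> bool" where
  "theta W \<longleftrightarrow> (\<exists>x y p. (\<forall>i\<in>{1..3::nat}. p i \<noteq> [] \<and> ipath (x # p i @ [y])) \<and>
     (\<forall>i\<in>{1..3}. \<forall>j\<in>{1..3}. i \<noteq> j \<longrightarrow> set (p i) \<inter> set (p j) = {} \<and>
        (\<forall>a\<in>set (p i). \<forall>b\<in>set (p j). \<not> adj a b)) \<and>
     W = {x, y} \<union> (\<Union>i\<in>{1..3}. set (p i)))"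

definition stamp :: "'a set \<Rightarrow> bool" where
  "stamp W \<longleftrightarrow> (\<exists>x l. (\<forall>i\<in>{1..3::nat}. l i \<noteq> [] \<and> ipath (l i @ [x])) \<and>
     (\<forall>i\<in>{1..3}. \<forall>j\<in>{1..3}. i \<noteq> j \<longrightarrow> set (l i) \<inter> set (l j) = {} \<and>
        (\<forall>a\<in>set (l i). \<forall>b\<in>set (l j). adj a b \<longleftrightarrow> a = hd (l i) \<and> b = hd (l j))) \<and>
     W = {x} \<union> (\<Union>i\<in>{1..3}. set (l i)))"

definition prism :: "'a set \<Rightarrow> bool" where
  "prism W \<longleftrightarrow> (\<exists>l. (\<forall>i\<in>{1..3::nat}. 2 \<le> length (l i) \<and> ipath (l i)) \<and>
     (\<forall>i\<in>{1..3}. \<forall>j\<in>{1..3}. i \<noteq> j \<longrightarrow> set (l i) \<inter> set (l j) = {} \<and>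
        (\<forall>a\<in>set (l i). \<forall>b\<in>set (l j). adj a b \<longleftrightarrow>
           (a = hd (l i) \<and> b = hd (l j)) \<or> (a = last (l i) \<and> b = last (l j)))) \<and>
     W = (\<Union>i\<in>{1..3}. set (l i)))"

definition wheel :: "'a set \<Rightarrow> bool" where
  "wheel W \<longleftrightarrow> (\<exists>C w. hole C \<and> w \<notin> C \<and> 3 \<le> card {z \<in> C. adj w z} \<and> W = insert w C)"

text \<open>Common count for the three path configurations. \<open>S i\<close> is a path without
  shared ends, the face \<open>W - S i\<close> is the hole formed by the other two paths, and
  \<open>\<T>\<close> contains the triangles. An edge that meets only one path lies in the two faces
  containing this path; an edge between two paths lies in one face and one triangle.\<close>

lemma three_faces_even:
  assumes "finite W" "\<And>i. i \<in> {1..3::nat} \<Longrightarrow> S i \<noteq> {} \<and> S i \<subseteq> W"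
    "\<And>i j. i \<in> {1..3} \<Longrightarrow> j \<in> {1..3} \<Longrightarrow> i \<noteq> j \<Longrightarrow> S i \<inter> S j = {}"
    and faces: "\<And>D. hole D \<and> D \<subseteq> W \<longleftrightarrow> (\<exists>i\<in>{1..3}. D = W - S i) \<or> D \<in> \<T>"
    and T: "\<And>T i. T \<in> \<T> \<Longrightarrow> i \<in> {1..3} \<Longrightarrow> T \<inter> S i \<noteq> {}"
    and e: "\<And>e. e \<in> induced_edges W \<Longrightarrow>
      (\<exists>k\<in>{1..3}. e \<inter> S k \<noteq> {} \<and> (\<forall>j\<in>{1..3}. j \<noteq> k \<longrightarrow> e \<inter> S j = {}) \<and> (\<forall>T\<in>\<T>. \<not> e \<subseteq> T)) \<or>
      (\<exists>k\<in>{1..3}. e \<inter> S k = {} \<and> (\<forall>j\<in>{1..3}. j \<noteq> k \<longrightarrow> e \<inter> S j \<noteq> {}) \<and> (\<exists>!T. T \<in> \<T> \<and> e \<subseteq> T))"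
  shows "even_holes W"
  unfolding even_holes_def
proof
  fix e assume eW: "e \<in> induced_edges W"
  then have sub: "e \<subseteq> W" by (simp add: induced_edges_def)
  have F: "e \<subseteq> W - S i \<longleftrightarrow> e \<inter> S i = {}" for i using sub by auto
  have inj: "W - S i \<noteq> W - S j" if "i \<in> {1..3}" "j \<in> {1..3}" "i \<noteq> j" for i j
    using assms(2)[of i] assms(2)[of j] assms(3)[of i j] that by blast
  have set: "{D. hole D \<and> D \<subseteq> W \<and> e \<subseteq> D} =
      {W - S i | i. i \<in> {1..3} \<and> e \<inter> S i = {}} \<union> {T \<in> \<T>. e \<subseteq> T}"
    using faces F by (auto simp flip: conj_assoc)
  from e[OF eW] show "even (card {D. hole D \<and> D \<subseteq> W \<and> e \<subseteq> D})"
  proof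
    assume "\<exists>k\<in>{1..3}. e \<inter> S k \<noteq> {} \<and> (\<forall>j\<in>{1..3}. j \<noteq> k \<longrightarrow> e \<inter> S j = {}) \<and> (\<forall>T\<in>\<T>. \<not> e \<subseteq> T)"
    then obtain k where k: "k \<in> {1..3}" "e \<inter> S k \<noteq> {}" "\<forall>j\<in>{1..3}. j \<noteq> k \<longrightarrow> e \<inter> S j = {}"
      "\<forall>T\<in>\<T>. \<not> e \<subseteq> T" by blast
    then have k4: "{T \<in> \<T>. e \<subseteq> T} = {}" by blast
    obtain i j where ij: "i \<in> {1..3}" "j \<in> {1..3}" "i \<noteq> j" "i \<noteq> k" "j \<noteq> k" "{1..3} = {i, j, k}"
      by (rule others_in_three[OF k(1)])
    have "{W - S i | i. i \<in> {1..3} \<and> e \<inter> S i = {}} = {W - S i, W - S j}"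
      using k ij(1-5) unfolding ij(6) by blast
    moreover have "card {W - S i, W - S j} = 2" using inj[OF ij(1-3)] by simp
    ultimately show ?thesis unfolding set k4 by simp
  next
    assume "\<exists>k\<in>{1..3}. e \<inter> S k = {} \<and> (\<forall>j\<in>{1..3}. j \<noteq> k \<longrightarrow> e \<inter> S j \<noteq> {}) \<and> (\<exists>!T. T \<in> \<T> \<and> e \<subseteq> T)"
    then obtain k where k: "k \<in> {1..3}" "e \<inter> S k = {}" "\<forall>j\<in>{1..3}. j \<noteq> k \<longrightarrow> e \<inter> S j \<noteq> {}"
      "\<exists>!T. T \<in> \<T> \<and> e \<subseteq> T" by blast
    obtain T where "T \<in> \<T> \<and> e \<subseteq> T" "\<forall>T'. T' \<in> \<T> \<and> e \<subseteq> T' \<longrightarrow> T' = T"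
      using k(4) by (elim ex1E)
    then have T': "{T \<in> \<T>. e \<subseteq> T} = {T}" by blast
    have "i \<in> {1..3} \<and> e \<inter> S i = {} \<longleftrightarrow> i = k" for i using k(1-3) by blast
    then have "{W - S i | i. i \<in> {1..3} \<and> e \<inter> S i = {}} = {W - S k}"
      by simp
    moreover have "W - S k \<noteq> T" using T[of T k] k T' by blast
    ultimately show ?thesis unfolding set T' by simp
  qed
qed

section \<open>Parity of holes in the three path configurations\<close>

lemma theta_even:
  assumes "theta W"
  shows "even_holes W"
proof -
  let ?I = "{1..3::nat}"
  obtain x y p where p: "\<And>i. i \<in> ?I \<Longrightarrow> p i \<noteq> [] \<and> ipath (x # p i @ [y])"
    and cr: "\<And>i j. i \<in> ?I \<Longrightarrow> j \<in> ?I \<Longrightarrow> i \<noteq> j \<Longrightarrow> set (p i) \<inter> set (p j) = {}"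
    and na: "\<And>i j a b. i \<in> ?I \<Longrightarrow> j \<in> ?I \<Longrightarrow> i \<noteq> j \<Longrightarrow> a \<in> set (p i) \<Longrightarrow> b \<in> set (p j) \<Longrightarrow> \<not> adj a b"
    and W: "W = {x, y} \<union> (\<Union>i\<in>?I. set (p i))"
    using assms unfolding theta_def by blast
  have pi: "p i \<noteq> []" "ipath (p i)" "x \<notin> set (p i)" "y \<notin> set (p i)" "x \<noteq> y" "\<not> adj x y"
     "\<And>z. z \<in> set (p i) \<Longrightarrow> adj x z \<longleftrightarrow> z = hd (p i)" "\<And>z. z \<in> set (p i) \<Longrightarrow> adj y z \<longleftrightarrow> z = last (p i)"
    if "i \<in> ?I" for i
    using p[OF that] by (auto simp: ipath_append adj_sym)
  have face: "hole (W - set (p k))" if k: "k \<in> ?I" for k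
  proof -
    obtain i j where ij: "i \<in> ?I" "j \<in> ?I" "i \<noteq> j" "i \<noteq> k" "j \<noteq> k" "?I = {i, j, k}"
      by (rule others_in_three[OF k])
    have "W - set (p k) = set (x # p i @ [y]) \<union> set (p j)"
      unfolding W ij(6) using pi[OF k] cr[OF ij(1) k ij(4)] cr[OF ij(2) k ij(5)] by auto
    moreover have "hole \<dots>"
    proof (rule hole_two_paths)
      fix a b assume "a \<in> set (x # p i @ [y])" "b \<in> set (p j)"
      then consider "a = x" | "a = y" | "a \<in> set (p i)" by auto
      then show "adj a b \<longleftrightarrow> a = hd (x # p i @ [y]) \<and> b = hd (p j) \<or> a = last (x # p i @ [y]) \<and> b = last (p j)"
        using pi[OF ij(1)] pi[OF ij(2)] na[OF ij(1-3)] \<open>b \<in> set (p j)\<close> by cases auto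
    qed (use p[OF ij(1)] pi[OF ij(2)] cr[OF ij(1-3)] in \<open>auto simp: Suc_le_eq\<close>)
    ultimately show ?thesis by simp
  qed
  have thr: "thread W (x # p i @ [y])" if i: "i \<in> ?I" for i
  proof (rule thread_ipath)
    fix u z assume u: "u \<in> W" "u \<notin> set (x # p i @ [y])" and z: "z \<in> set (butlast (tl (x # p i @ [y])))"
    then obtain j where "j \<in> ?I" "u \<in> set (p j)" unfolding W by force
    moreover have "z \<in> set (p i)" "j \<noteq> i" using z u calculation by auto
    ultimately show "\<not> adj z u" using na i by blast
  qed (use p i in blast)
  have classify: "\<exists>i\<in>?I. D = W - set (p i)" if D: "hole D" "D \<subseteq> W" for D
  proof -
    \<comment> \<open>Otherwise \<open>D\<close> would absorb all three paths, and \<open>x\<close>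
      would have three neighbours in it.\<close>
    have "\<exists>k\<in>?I. D \<inter> set (p k) = {}"
    proof (rule ccontr)
      assume *: "\<not> ?thesis"
      have all: "set (x # p i @ [y]) \<subseteq> D" if i: "i \<in> ?I" for i
      proof -
        obtain b where b: "b \<in> D" "b \<in> set (p i)" using * i by blast
        then obtain l r where "p i = l @ b # r" using split_list by metis
        then show ?thesis using absorb[OF D, of "x # l" b "r @ [y]"] thr[OF i] b by simp
      qed
      have h: "hd (p i) \<in> D \<and> adj x (hd (p i)) \<and> hd (p i) \<in> set (p i)" if "i \<in> ?I" for i
        using all[OF that] pi[OF that] by auto
      have "x \<in> D" using all[of 1] by simp
      then have "hd (p 1) = hd (p 2) \<or> hd (p 1) = hd (p 3) \<or> hd (p 2) = hd (p 3)"
        using hole_three[OF D(1)] h[of 1] h[of 2] h[of 3] by simp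
      then show False using cr[of 1 2] cr[of 1 3] cr[of 2 3] h[of 1] h[of 2] h[of 3] by auto
    qed
    then obtain k where k: "k \<in> ?I" "D \<subseteq> W - set (p k)" using D by blast
    then show ?thesis using hole_subset_hole[OF D(1) face[OF k(1)]] by blast
  qed
  show ?thesis
  proof (rule three_faces_even[where S = "\<lambda>i. set (p i)" and \<T> = "{}"])
    fix e assume e: "e \<in> induced_edges W"
    then have "e \<in> E" by (simp add: induced_edges_def)
    then obtain a b where ab: "e = {a, b}" "a \<noteq> b" "adj a b" by (rule edgeE)
    then have abW: "a \<in> W" "b \<in> W" using e by (auto simp: in_induced_edges)
    have "\<not> (a \<in> {x, y} \<and> b \<in> {x, y})" using ab pi(6)[of 1] adj_sym by auto
    then obtain k where k: "k \<in> ?I" "e \<inter> set (p k) \<noteq> {}" using ab abW unfolding W by auto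
    have "e \<inter> set (p j) = {}" if j: "j \<in> ?I" "j \<noteq> k" for j
    proof (rule ccontr)
      assume "\<not> ?thesis"
      then show False
        using k ab j cr[OF k(1) j(1)] na[OF k(1) j(1)] adj_sym by fastforce
    qed
    then show "(\<exists>k\<in>?I. e \<inter> set (p k) \<noteq> {} \<and> (\<forall>j\<in>?I. j \<noteq> k \<longrightarrow> e \<inter> set (p j) = {}) \<and> (\<forall>T\<in>{}. \<not> e \<subseteq> T)) \<or>
      (\<exists>k\<in>?I. e \<inter> set (p k) = {} \<and> (\<forall>j\<in>?I. j \<noteq> k \<longrightarrow> e \<inter> set (p j) \<noteq> {}) \<and> (\<exists>!T. T \<in> {} \<and> e \<subseteq> T))"
      using k by (intro disjI1 bexI[OF _ k(1)]) auto
  next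
    fix D show "hole D \<and> D \<subseteq> W \<longleftrightarrow> (\<exists>i\<in>?I. D = W - set (p i)) \<or> D \<in> {}"
      using face classify by blast
  qed (use pi cr in \<open>auto simp: W\<close>)
qed

lemma stamp_even:
  assumes "stamp W"
  shows "even_holes W"
proof -
  let ?I = "{1..3::nat}"
  obtain x l where p: "\<And>i. i \<in> ?I \<Longrightarrow> l i \<noteq> [] \<and> ipath (l i @ [x])"
    and cr: "\<And>i j. i \<in> ?I \<Longrightarrow> j \<in> ?I \<Longrightarrow> i \<noteq> j \<Longrightarrow> set (l i) \<inter> set (l j) = {}"
    and ad: "\<And>i j a b. i \<in> ?I \<Longrightarrow> j \<in> ?I \<Longrightarrow> i \<noteq> j \<Longrightarrow> a \<in> set (l i) \<Longrightarrow> b \<in> set (l j) \<Longrightarrow>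
      adj a b \<longleftrightarrow> a = hd (l i) \<and> b = hd (l j)"
    and W: "W = {x} \<union> (\<Union>i\<in>?I. set (l i))"
    using assms unfolding stamp_def by blast
  define t where "t i = hd (l i)" for i
  have pi: "l i \<noteq> []" "ipath (l i)" "x \<notin> set (l i)" "t i \<in> set (l i)"
     "\<And>z. z \<in> set (l i) \<Longrightarrow> adj x z \<longleftrightarrow> z = last (l i)"
    if "i \<in> ?I" for i
    using p[OF that] by (auto simp: ipath_append adj_sym t_def)
  have tri: "hole (t ` ?I)"
  proof -
    have "hole {t 1, t 2, t 3}"
      by (rule hole_triangle; subst ad; use pi in \<open>auto simp: t_def\<close>)
    moreover have "{1..3::nat} = {1, 2, 3}" by auto
    ultimately show ?thesis by simp
  qed
  have face: "hole (W - set (l k))" if k: "k \<in> ?I" for k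
  proof -
    obtain i j where ij: "i \<in> ?I" "j \<in> ?I" "i \<noteq> j" "i \<noteq> k" "j \<noteq> k" "?I = {i, j, k}"
      by (rule others_in_three[OF k])
    have "W - set (l k) = set (l i @ [x]) \<union> set (l j)"
      unfolding W ij(6) using pi[OF k] cr[OF ij(1) k ij(4)] cr[OF ij(2) k ij(5)] by auto
    moreover have "hole \<dots>"
    proof (rule hole_two_paths)
      fix a b assume "a \<in> set (l i @ [x])" "b \<in> set (l j)"
      then consider "a = x" | "a \<in> set (l i)" by auto
      then show "adj a b \<longleftrightarrow> a = hd (l i @ [x]) \<and> b = hd (l j) \<or> a = last (l i @ [x]) \<and> b = last (l j)"
        using pi[OF ij(1)] pi[OF ij(2)] ad[OF ij(1-3)] \<open>b \<in> set (l j)\<close> by cases auto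
    qed (use p[OF ij(1)] pi[OF ij(1)] pi[OF ij(2)] cr[OF ij(1-3)] in \<open>auto simp: Suc_le_eq numeral_eq_Suc neq_Nil_conv\<close>)
    ultimately show ?thesis by simp
  qed
  have thr: "thread W (l i @ [x])" if i: "i \<in> ?I" for i
  proof (rule thread_ipath)
    fix u z assume u: "u \<in> W" "u \<notin> set (l i @ [x])" and z: "z \<in> set (butlast (tl (l i @ [x])))"
    then obtain j where j: "j \<in> ?I" "u \<in> set (l j)" unfolding W by force
    have "z \<in> set (tl (l i))" using z pi[OF i] by (cases "l i") auto
    moreover have "hd (l i) \<notin> set (tl (l i))" using ipath_distinct[OF pi(2)[OF i]] by (cases "l i") auto
    ultimately have "z \<in> set (l i)" "z \<noteq> hd (l i)" by (auto intro: list.set_sel(2) simp: pi[OF i])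
    moreover have "j \<noteq> i" using u j by auto
    ultimately show "\<not> adj z u" using ad[OF i j(1)] j(2) by auto
  qed (use p i in blast)
  have classify: "(\<exists>i\<in>?I. D = W - set (l i)) \<or> D = t ` ?I" if D: "hole D" "D \<subseteq> W" for D
  proof (cases "t ` ?I \<subseteq> D")
    case True
    then show ?thesis using hole_subset_hole[OF tri D(1)] by auto
  next
    case False
    then obtain k where k: "k \<in> ?I" "t k \<notin> D" by blast
    \<comment> \<open>The path starting at \<open>t k\<close> is a thread, so a hole that meets it
      beyond \<open>t k\<close> would have to run back to \<open>t k\<close>.\<close>
    have "b \<notin> D" if b: "b \<in> set (l k)" for b
    proof
      assume bD: "b \<in> D"
      obtain m r where m: "l k = m @ b # r" using b split_list by metis
      have "m \<noteq> []" using k bD m by (auto simp: t_def)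
      then have "set (m @ b # r @ [x]) \<subseteq> D"
        using absorb[OF D, of m b "r @ [x]"] thr[OF k(1)] bD m by simp
      then show False using k(2) m \<open>m \<noteq> []\<close> by (simp add: t_def subset_iff)
    qed
    then have "D \<subseteq> W - set (l k)" using D by blast
    then show ?thesis using hole_subset_hole[OF D(1) face[OF k(1)]] k(1) by blast
  qed
  show ?thesis
  proof (rule three_faces_even[where S = "\<lambda>i. set (l i)" and \<T> = "{t ` ?I}"])
    fix e assume e: "e \<in> induced_edges W"
    then have "e \<in> E" by (simp add: induced_edges_def)
    then obtain a b where ab: "e = {a, b}" "a \<noteq> b" "adj a b" by (rule edgeE)
    then have abW: "a \<in> W" "b \<in> W" using e by (auto simp: in_induced_edges)
    show "(\<exists>k\<in>?I. e \<inter> set (l k) \<noteq> {} \<and> (\<forall>j\<in>?I. j \<noteq> k \<longrightarrow> e \<inter> set (l j) = {}) \<and> (\<forall>T\<in>{t ` ?I}. \<not> e \<subseteq> T)) \<or>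
      (\<exists>k\<in>?I. e \<inter> set (l k) = {} \<and> (\<forall>j\<in>?I. j \<noteq> k \<longrightarrow> e \<inter> set (l j) \<noteq> {}) \<and> (\<exists>!T. T \<in> {t ` ?I} \<and> e \<subseteq> T))"
    proof (cases "\<exists>i\<in>?I. \<exists>j\<in>?I. i \<noteq> j \<and> a \<in> set (l i) \<and> b \<in> set (l j)")
      case True
      then obtain i j where ij: "i \<in> ?I" "j \<in> ?I" "i \<noteq> j" "a \<in> set (l i)" "b \<in> set (l j)" by blast
      then have "a = t i" "b = t j" using ad ab by (auto simp: t_def)
      then have T: "e \<subseteq> t ` ?I" using ij ab by auto
      obtain k where k: "k \<in> ?I" "k \<noteq> i" "k \<noteq> j" "?I = {k, i, j}"
        by (rule third_of_three[OF ij(1-3)])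
      have "e \<inter> set (l k) = {}" using cr[OF k(1) ij(1)] cr[OF k(1) ij(2)] ij k ab by blast
      moreover have "e \<inter> set (l i) \<noteq> {}" "e \<inter> set (l j) \<noteq> {}" using ij ab by auto
      ultimately show ?thesis using T k(1,4) by (intro disjI2 bexI[OF _ k(1)]) (simp, blast)
    next
      case False
      obtain k where k: "k \<in> ?I" "e \<subseteq> insert x (set (l k))" "e \<inter> set (l k) \<noteq> {}"
      proof (cases "a = x")
        case True
        then obtain k where "k \<in> ?I" "b \<in> set (l k)" using abW ab(2) unfolding W by blast
        then show thesis using that[of k] ab(1) True by blast
      next
        case ax: False
        then obtain k where k: "k \<in> ?I" "a \<in> set (l k)" using abW unfolding W by blast
        have "b \<in> insert x (set (l k))"
        proof (cases "b = x")
          case bx: False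
          then obtain j where j: "j \<in> ?I" "b \<in> set (l j)" using abW unfolding W by blast
          then have "j = k" using False k by metis
          then show ?thesis using j by simp
        qed simp
        then show thesis using that[of k] ab(1) k by blast
      qed
      have "e \<inter> set (l j) = {}" if "j \<in> ?I" "j \<noteq> k" for j
        using k cr[OF that(1) k(1) that(2)] pi(3)[OF that(1)] by blast
      moreover have "\<not> e \<subseteq> t ` ?I"
      proof
        assume s: "e \<subseteq> t ` ?I"
        have "t j = t k" if j: "j \<in> ?I" "t j \<in> insert x (set (l k))" for j
        proof (rule ccontr)
          assume ne: "t j \<noteq> t k"
          then have "j \<noteq> k" by auto
          then show False using cr[OF j(1) k(1)] pi[OF j(1)] j(2) by auto
        qed
        then have "e \<subseteq> {t k}" using s k(2) by blast
        then show False using ab by auto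
      qed
      ultimately show ?thesis using k by (intro disjI1 bexI[OF _ k(1)]) auto
    qed
  next
    have sub: "t ` ?I \<subseteq> W" using pi(4) unfolding W by blast
    fix D show "hole D \<and> D \<subseteq> W \<longleftrightarrow> (\<exists>i\<in>?I. D = W - set (l i)) \<or> D \<in> {t ` ?I}"
    proof
      assume "(\<exists>i\<in>?I. D = W - set (l i)) \<or> D \<in> {t ` ?I}"
      then show "hole D \<and> D \<subseteq> W" using face tri sub by (elim disjE bexE) auto
    next
      assume "hole D \<and> D \<subseteq> W"
      then show "(\<exists>i\<in>?I. D = W - set (l i)) \<or> D \<in> {t ` ?I}" using classify[of D] by simp
    qed
  next
    fix T i assume "T \<in> {t ` ?I}" "i \<in> ?I"
    then show "T \<inter> set (l i) \<noteq> {}" using pi(4)[of i] by blast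
  qed (use pi cr in \<open>auto simp: W\<close>)
qed

lemma prism_even:
  assumes "prism W"
  shows "even_holes W"
proof -
  let ?I = "{1..3::nat}"
  obtain l where p: "\<And>i. i \<in> ?I \<Longrightarrow> 2 \<le> length (l i) \<and> ipath (l i)"
    and cr: "\<And>i j. i \<in> ?I \<Longrightarrow> j \<in> ?I \<Longrightarrow> i \<noteq> j \<Longrightarrow> set (l i) \<inter> set (l j) = {}"
    and ad: "\<And>i j a b. i \<in> ?I \<Longrightarrow> j \<in> ?I \<Longrightarrow> i \<noteq> j \<Longrightarrow> a \<in> set (l i) \<Longrightarrow> b \<in> set (l j) \<Longrightarrow>
      adj a b \<longleftrightarrow> a = hd (l i) \<and> b = hd (l j) \<or> a = last (l i) \<and> b = last (l j)"
    and W: "W = (\<Union>i\<in>?I. set (l i))"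
    using assms unfolding prism_def by blast
  define t where "t i = hd (l i)" for i
  define s where "s i = last (l i)" for i
  have pi: "l i \<noteq> []" "ipath (l i)" "t i \<in> set (l i)" "s i \<in> set (l i)" "t i \<noteq> s i"
    if "i \<in> ?I" for i
  proof -
    show n: "l i \<noteq> []" "ipath (l i)" using p[OF that] by auto
    then show "t i \<in> set (l i)" "s i \<in> set (l i)" by (auto simp: t_def s_def)
    show "t i \<noteq> s i" using p[OF that] ipath_distinct[OF n(2)]
      by (cases "l i") (auto simp: t_def s_def)
  qed
  have I3: "{1..3::nat} = {1, 2, 3}" by auto
  have tri: "hole (t ` ?I)" "hole (s ` ?I)"
  proof -
    have "hole {t 1, t 2, t 3}" "hole {s 1, s 2, s 3}"
      by (rule hole_triangle; subst ad; use pi in \<open>auto simp: t_def s_def\<close>)+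
    then show "hole (t ` ?I)" "hole (s ` ?I)" unfolding I3 by simp_all
  qed
  have face: "hole (W - set (l k))" if k: "k \<in> ?I" for k
  proof -
    obtain i j where ij: "i \<in> ?I" "j \<in> ?I" "i \<noteq> j" "i \<noteq> k" "j \<noteq> k" "?I = {i, j, k}"
      by (rule others_in_three[OF k])
    have "W - set (l k) = set (l i) \<union> set (l j)"
      unfolding W ij(6) using cr[OF ij(1) k ij(4)] cr[OF ij(2) k ij(5)] by auto
    moreover have "hole \<dots>"
      by (rule hole_two_paths) (use p[OF ij(1)] p[OF ij(2)] pi[OF ij(1)] pi[OF ij(2)]
          cr[OF ij(1-3)] ad[OF ij(1-3)] in auto)
    ultimately show ?thesis by simp
  qed
  have thr: "thread W (l i)" if i: "i \<in> ?I" for i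
  proof (rule thread_ipath)
    fix u z assume u: "u \<in> W" "u \<notin> set (l i)" and z: "z \<in> set (butlast (tl (l i)))"
    then obtain j where j: "j \<in> ?I" "u \<in> set (l j)" unfolding W by force
    have d: "distinct (l i)" using ipath_distinct[OF pi(2)[OF i]] .
    then have "z \<noteq> hd (l i)" using z by (cases "l i") (auto dest: in_set_butlastD)
    moreover have "z \<in> set (butlast (l i))"
      using z unfolding butlast_tl by (cases "butlast (l i)") auto
    then have "z \<noteq> last (l i)" using d by (cases "l i" rule: rev_cases) auto
    moreover have "z \<in> set (l i)" using z by (metis in_set_butlastD list.set_sel(2) tl_Nil)
    moreover have "j \<noteq> i" using u j by auto
    ultimately show "\<not> adj z u" using ad[OF i j(1)] j(2) by auto
  qed (use pi i in blast)
  have classify: "(\<exists>i\<in>?I. D = W - set (l i)) \<or> D \<in> {t ` ?I, s ` ?I}" if D: "hole D" "D \<subseteq> W" for D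
  proof (cases "t ` ?I \<subseteq> D \<or> s ` ?I \<subseteq> D")
    case True
    then show ?thesis using hole_subset_hole[OF tri(1) D(1)] hole_subset_hole[OF tri(2) D(1)] by auto
  next
    case False
    then obtain k where k: "k \<in> ?I" "t k \<notin> D" by blast
    have notin: "b \<notin> D" if b: "b \<in> set (l k)" "b \<noteq> s k" for b
    proof
      assume bD: "b \<in> D"
      obtain m r where m: "l k = m @ b # r" using b split_list by metis
      have "m \<noteq> []" using k bD m by (auto simp: t_def)
      moreover have "r \<noteq> []" using b(2) m by (auto simp: s_def)
      ultimately have "set (m @ b # r) \<subseteq> D"
        using absorb[OF D, of m b r] thr[OF k(1)] bD m by simp
      then show False using k(2) m \<open>m \<noteq> []\<close> by (simp add: t_def subset_iff)
    qed
    \<comment> \<open>With the rest of path \<open>k\<close> excluded, the only neighbours left for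
      \<open>s k\<close> are those in its triangle, and \<open>D\<close> would contain this whole
      triangle.\<close>
    have "s k \<notin> D"
    proof
      assume sD: "s k \<in> D"
      obtain i j where ij: "i \<in> ?I" "j \<in> ?I" "i \<noteq> j" "i \<noteq> k" "j \<noteq> k" "?I = {i, j, k}"
        by (rule others_in_three[OF k(1)])
      have nb: "w = s i \<or> w = s j" if w: "w \<in> D" "adj (s k) w" for w
      proof -
        have "w \<in> W" using w D by blast
        then consider "w \<in> set (l i)" | "w \<in> set (l j)" | "w \<in> set (l k)" unfolding W ij(6) by blast
        then show ?thesis
        proof cases
          case 1
          then show ?thesis using ad[OF k(1) ij(1) ij(4)[symmetric] pi(4)[OF k(1)] 1] w pi(5)[OF k(1)]
            by (auto simp: s_def t_def)
        next
          case 2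
          then show ?thesis using ad[OF k(1) ij(2) ij(5)[symmetric] pi(4)[OF k(1)] 2] w pi(5)[OF k(1)]
            by (auto simp: s_def t_def)
        next
          case 3
          then show ?thesis using notin[OF 3] w by (cases "w = s k") auto
        qed
      qed
      have "s i \<in> D" "s j \<in> D" using hole_two(1,2)[OF D(1) sD nb] by auto
      then show False using False sD unfolding ij(6) by auto
    qed
    then have "D \<subseteq> W - set (l k)" using D notin by blast
    then show ?thesis using hole_subset_hole[OF D(1) face[OF k(1)]] k(1) by blast
  qed
  have ts: "t i \<noteq> s j" if "i \<in> ?I" "j \<in> ?I" for i j
    using cr[OF that] pi[OF that(1)] pi[OF that(2)] by (cases "i = j") auto
  show ?thesis
  proof (rule three_faces_even[where S = "\<lambda>i. set (l i)" and \<T> = "{t ` ?I, s ` ?I}"])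
    fix e assume e: "e \<in> induced_edges W"
    then have "e \<in> E" by (simp add: induced_edges_def)
    then obtain a b where ab: "e = {a, b}" "a \<noteq> b" "adj a b" by (rule edgeE)
    then have abW: "a \<in> W" "b \<in> W" using e by (auto simp: in_induced_edges)
    show "(\<exists>k\<in>?I. e \<inter> set (l k) \<noteq> {} \<and> (\<forall>j\<in>?I. j \<noteq> k \<longrightarrow> e \<inter> set (l j) = {}) \<and> (\<forall>T\<in>{t ` ?I, s ` ?I}. \<not> e \<subseteq> T)) \<or>
      (\<exists>k\<in>?I. e \<inter> set (l k) = {} \<and> (\<forall>j\<in>?I. j \<noteq> k \<longrightarrow> e \<inter> set (l j) \<noteq> {}) \<and> (\<exists>!T. T \<in> {t ` ?I, s ` ?I} \<and> e \<subseteq> T))"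
    proof (cases "\<exists>i\<in>?I. \<exists>j\<in>?I. i \<noteq> j \<and> a \<in> set (l i) \<and> b \<in> set (l j)")
      case True
      then obtain i j where ij: "i \<in> ?I" "j \<in> ?I" "i \<noteq> j" "a \<in> set (l i)" "b \<in> set (l j)" by blast
      then have "a = t i \<and> b = t j \<or> a = s i \<and> b = s j" using ad ab by (auto simp: t_def s_def)
      then have T: "e \<subseteq> t ` ?I \<and> \<not> e \<subseteq> s ` ?I \<or> e \<subseteq> s ` ?I \<and> \<not> e \<subseteq> t ` ?I"
      proof
        assume *: "a = t i \<and> b = t j"
        then have "a \<notin> s ` ?I" using ts[OF ij(1)] by (metis imageE)
        moreover have "e \<subseteq> t ` ?I" using * ij(1,2) ab(1) by simp
        ultimately show ?thesis using ab(1) by simp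
      next
        assume *: "a = s i \<and> b = s j"
        then have "a \<notin> t ` ?I" using ts[OF _ ij(1)] by (metis imageE)
        moreover have "e \<subseteq> s ` ?I" using * ij(1,2) ab(1) by simp
        ultimately show ?thesis using ab(1) by simp
      qed
      obtain k where k: "k \<in> ?I" "k \<noteq> i" "k \<noteq> j" "?I = {k, i, j}"
        by (rule third_of_three[OF ij(1-3)])
      have "e \<inter> set (l k) = {}" using cr[OF k(1) ij(1)] cr[OF k(1) ij(2)] ij k ab by blast
      moreover have "e \<inter> set (l m) \<noteq> {}" if m: "m \<in> ?I" "m \<noteq> k" for m
      proof -
        have "m = i \<or> m = j" using m unfolding k(4) by simp
        then show ?thesis using ij ab by auto
      qed
      moreover have "\<exists>!T. T \<in> {t ` ?I, s ` ?I} \<and> e \<subseteq> T"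
        using T by (elim disjE) (rule ex1I[of _ "t ` ?I"], simp, blast, rule ex1I[of _ "s ` ?I"], simp, blast)
      ultimately show ?thesis by (intro disjI2 bexI[OF _ k(1)] conjI ballI impI)
    next
      case False
      obtain i j where i: "i \<in> ?I" "a \<in> set (l i)" and j: "j \<in> ?I" "b \<in> set (l j)"
        using abW unfolding W by blast
      then have "i = j" using False by blast
      then obtain k where k: "k \<in> ?I" "e \<subseteq> set (l k)" "e \<inter> set (l k) \<noteq> {}"
        using i j ab(1) by blast
      have other: "e \<inter> set (l j) = {}" if "j \<in> ?I" "j \<noteq> k" for j
        using k cr[OF that(1) k(1) that(2)] by blast
      have "\<not> e \<subseteq> f ` ?I" if f: "\<And>i. i \<in> ?I \<Longrightarrow> f i \<in> set (l i)" for f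
      proof
        assume s: "e \<subseteq> f ` ?I"
        have "f j = f k" if j: "j \<in> ?I" "f j \<in> e" for j
          using other[OF j(1)] f[OF j(1)] j by blast
        then have "e \<subseteq> {f k}" using s by blast
        then show False using ab by auto
      qed
      then show ?thesis using k other pi(3,4) by (intro disjI1 bexI[OF _ k(1)]) blast
    qed
  next
    have sub: "t ` ?I \<subseteq> W" "s ` ?I \<subseteq> W" using pi(3,4) unfolding W by blast+
    fix D show "hole D \<and> D \<subseteq> W \<longleftrightarrow> (\<exists>i\<in>?I. D = W - set (l i)) \<or> D \<in> {t ` ?I, s ` ?I}"
    proof
      assume "(\<exists>i\<in>?I. D = W - set (l i)) \<or> D \<in> {t ` ?I, s ` ?I}"
      then show "hole D \<and> D \<subseteq> W" using face tri sub by (elim disjE bexE) auto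
    next
      assume "hole D \<and> D \<subseteq> W"
      then show "(\<exists>i\<in>?I. D = W - set (l i)) \<or> D \<in> {t ` ?I, s ` ?I}" using classify[of D] by simp
    qed
  next
    fix T i assume "T \<in> {t ` ?I, s ` ?I}" "i \<in> ?I"
    then show "T \<inter> set (l i) \<noteq> {}" using pi(3,4)[of i] by blast
  qed (use pi cr in \<open>auto simp: W\<close>)
qed

text \<open>Follow the rim from the spoke end \<open>a\<close> to the next spoke end
  \<open>b\<close>: this arc and the hub form a hole. A third spoke end guarantees that
  \<open>b\<close> is not the last vertex of \<open>p\<close>, so the arc is an induced
  path.\<close>

lemma sector:
  assumes r: "ring a p" and C: "C = insert a (set p)" and w: "w \<notin> C" and N: "N = {z \<in> C. adj w z}"
    and aN: "a \<in> N" and card: "3 \<le> card N"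
  obtains s b q where "p = s @ b # q" "q \<noteq> []" "b \<in> N" "set s \<inter> N = {}"
    "hole ({w, a, b} \<union> set s)"
    "thread (insert w C) (a # s @ [b])"
proof -
  have a: "a \<notin> set p" "ipath p" "2 \<le> length p" using r by (auto simp: ring_def)
  have "\<exists>z\<in>set p. z \<in> N"
  proof (rule ccontr)
    assume "\<not> ?thesis"
    then have "N \<subseteq> {a}" using N C by auto
    then have "card N \<le> 1" using card_mono[of "{a}" N] by simp
    then show False using card by simp
  qed
  then obtain s b q where p: "p = s @ b # q" "b \<in> N" "\<forall>z\<in>set s. z \<notin> N"
    using split_list_first_prop[of p "\<lambda>z. z \<in> N"] by blast
  have "q \<noteq> []"
  proof
    assume "q = []"
    then have "N \<subseteq> {a, b}" using N C p by auto
    then have "card N \<le> card {a, b}" by (intro card_mono) auto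
    also have "\<dots> \<le> 2" by (simp add: card_insert_if)
    finally show False using card by simp
  qed
  have ip: "ipath (a # s @ [b])"
  proof -
    have "butlast p = (s @ [b]) @ butlast q" using p \<open>q \<noteq> []\<close> by (simp add: butlast_append)
    then have "ipath ((a # s @ [b]) @ butlast q)" using ring_ipath_butlast[OF r] by simp
    then show ?thesis unfolding ipath_append by blast
  qed
  have wn: "adj w z \<longleftrightarrow> z = a \<or> z = b" if "z \<in> {a, b} \<union> set s" for z
    using that p aN C unfolding N by auto
  have "hole (set (a # s @ [b]) \<union> set [w])"
    by (rule hole_two_paths) (use ip wn w C p in \<open>auto simp: adj_sym\<close>)
  moreover have "set (a # s @ [b]) \<union> set [w] = {w, a, b} \<union> set s" by auto
  moreover have "thread (insert w C) (a # s @ [b])"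
    unfolding thread_def
  proof (intro allI impI ballI)
    fix l a' b' c' r' y
    assume eq: "a # s @ [b] = l @ a' # b' # c' # r'" and y: "y \<in> insert w C" "adj b' y"
    have "b' \<in> set (butlast (tl (l @ a' # b' # c' # r')))" by (cases l) (auto simp: butlast_append)
    then have b': "b' \<in> set s" unfolding eq[symmetric] by simp
    then have "y \<noteq> w" using y(2) p N C adj_sym by auto
    then have "y \<in> C" using y by auto
    moreover have "a # p = l @ a' # b' # c' # (r' @ q)" using eq p by (metis append.assoc append_Cons append_Nil)
    ultimately show "y = a' \<or> y = c'"
      using thread_ring[OF r] y(2) C unfolding thread_def by blast
  qed
  ultimately show thesis using that[of s b q] p \<open>q \<noteq> []\<close> by auto
qed

text \<open>A hole through the hub, \<open>a\<close> and the next rim vertex is carried along the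
  thread to \<open>b\<close>. So it contains the sector and, holes being incomparable, equals
  it.\<close>

lemma sector_unique:
  assumes C: "hole C" and r: "ring a p" "C = insert a (set p)" and w: "w \<notin> C"
    and N: "N = {z \<in> C. adj w z}" and aN: "a \<in> N" and card: "3 \<le> card N"
  obtains s b q where "p = s @ b # q" "q \<noteq> []" "b \<in> N" "set s \<inter> N = {}"
    "\<And>D. hole D \<and> D \<subseteq> insert w C \<and> {w, a, hd p} \<subseteq> D \<longleftrightarrow> D = {w, a, b} \<union> set s"
    "thread (insert w C) (a # s @ [b])"
proof -
  obtain s b q where s: "p = s @ b # q" "q \<noteq> []" "b \<in> N" "set s \<inter> N = {}"
    "hole ({w, a, b} \<union> set s)" "thread (insert w C) (a # s @ [b])"
    by (rule sector[OF r w N aN card])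
  have hd: "hd (s @ [b]) = hd p" using s(1) by (cases s) auto
  have "D = {w, a, b} \<union> set s" if D: "hole D" "D \<subseteq> insert w C" "{w, a, hd p} \<subseteq> D" for D
  proof -
    obtain h m where hm: "s @ [b] = h # m" by (cases s) auto
    have "h \<in> D" using hd hm D(3) by simp
    then have "set m \<subseteq> D"
      using absorb_forward[OF D(1,2), of "[]" a h m] s(6) hm by simp
    with \<open>h \<in> D\<close> have "set (s @ [b]) \<subseteq> D" unfolding hm by simp
    then have "{w, a, b} \<union> set s \<subseteq> D" using D(3) by auto
    then show ?thesis using hole_subset_hole[OF s(5) D(1)] by simp
  qed
  moreover have "{w, a, b} \<union> set s \<subseteq> insert w C" using r(2) s(1) by auto
  moreover have "{w, a, hd p} \<subseteq> {w, a, b} \<union> set s" using s(1) by (cases s) auto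
  ultimately have "hole D \<and> D \<subseteq> insert w C \<and> {w, a, hd p} \<subseteq> D \<longleftrightarrow> D = {w, a, b} \<union> set s" for D
    using s(5) by metis
  then show thesis using that[of s b q] s by metis
qed

lemma wheel_even:
  assumes "wheel W"
  shows "even_holes W"
proof -
  obtain C w where C: "hole C" and w: "w \<notin> C" and card3: "3 \<le> card {z \<in> C. adj w z}"
    and W: "W = insert w C" using assms unfolding wheel_def by blast
  define N where "N = {z \<in> C. adj w z}"
  have card: "3 \<le> card N" using card3 by (simp add: N_def)
  show ?thesis
    unfolding even_holes_def
  proof
    fix e assume e: "e \<in> induced_edges W"
    then have "e \<in> E" by (simp add: induced_edges_def)
    then obtain z z' where zz: "e = {z, z'}" "z \<noteq> z'" "adj z z'" by (rule edgeE)
    have "z \<in> W" "z' \<in> W" using e zz by (auto simp: in_induced_edges)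
    then consider (spoke) a where "e = {w, a}" "a \<in> N" | (rim) "z \<in> C" "z' \<in> C"
      using zz unfolding W N_def by (auto simp: insert_commute adj_sym)
    then show "even (card {D. hole D \<and> D \<subseteq> W \<and> e \<subseteq> D})"
    proof cases
      case spoke
      then obtain p where r: "ring a p" "C = insert a (set p)"
        using hole_rooted[OF C, of a] by (auto simp: N_def)
      have r': "ring a (rev p)" "C = insert a (set (rev p))" using r ring_rev by auto
      obtain s b q F1 where s: "p = s @ b # q" "q \<noteq> []" and F1: "F1 = {w, a, b} \<union> set s"
        and u: "\<And>D. hole D \<and> D \<subseteq> W \<and> {w, a, hd p} \<subseteq> D \<longleftrightarrow> D = F1"
        by (rule sector_unique[OF C r w N_def spoke(2) card]) (unfold W, blast)
      obtain F2 where
        u': "\<And>D. hole D \<and> D \<subseteq> W \<and> {w, a, last p} \<subseteq> D \<longleftrightarrow> D = F2"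
        by (rule sector_unique[OF C r' w N_def spoke(2) card]) (unfold W hd_rev, blast)
      have nb: "y = w \<or> y = hd p \<or> y = last p" if "y \<in> W" "adj a y" for y
        using that r W by (auto simp: ring_def)
      \<comment> \<open>In \<open>D\<close> the vertex \<open>a\<close> has a neighbour besides the
        hub, so a hole through the spoke belongs to one of the two sectors beside it.\<close>
      have either: "hd p \<in> D \<or> last p \<in> D" if "hole D" "D \<subseteq> W" "{w, a} \<subseteq> D" for D
      proof (rule ccontr)
        assume "\<not> ?thesis"
        then have "\<And>y. y \<in> D \<Longrightarrow> adj a y \<Longrightarrow> y = w \<or> y = w" using nb that by blast
        then show False using hole_two(5)[OF that(1), of a w w] that(3) by blast
      qed
      have "hole D \<and> D \<subseteq> W \<and> e \<subseteq> D \<longleftrightarrow> D = F1 \<or> D = F2" for D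
        using u[of D] u'[of D] either[of D] unfolding spoke(1) insert_subset by blast
      then have "{D. hole D \<and> D \<subseteq> W \<and> e \<subseteq> D} = {F1, F2}"
        by blast
      moreover have "last p \<notin> F1"
      proof -
        have "last p \<in> set q" "last p \<in> C" using s r(2) by auto
        moreover have "distinct (s @ b # q)" "a \<notin> set q"
          using r(1) s(1) ipath_distinct[of p] unfolding ring_def by auto
        ultimately show ?thesis unfolding F1 using w by auto
      qed
      moreover have "last p \<in> F2" using u'[of F2] by blast
      ultimately show ?thesis by (metis card_2_iff even_numeral)
    next
      case rim
      obtain p where r: "ring z p" "C = insert z (set p)" "hd p = z'"
      proof -
        obtain p where r: "ring z p" "C = insert z (set p)" by (rule hole_rooted[OF C rim(1)])
        then have "z' = hd p \<or> z' = last p" using zz rim by (auto simp: ring_def)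
        then show thesis using that[of p] that[of "rev p"] r ring_rev[OF r(1)] by (auto simp: hd_rev)
      qed
      have "\<exists>F. \<forall>D. hole D \<and> D \<subseteq> W \<and> {w, z, z'} \<subseteq> D \<longleftrightarrow> D = F"
      proof (cases "z \<in> N")
        case True
        obtain s b q where
          "\<And>D. hole D \<and> D \<subseteq> W \<and> {w, z, hd p} \<subseteq> D \<longleftrightarrow> D = {w, z, b} \<union> set s"
          by (rule sector_unique[OF C r(1,2) w N_def True card]) (unfold W, blast)
        then show ?thesis using r(3) by blast
      next
        case False
        have fin: "finite N" using hole_finite[OF C] by (simp add: N_def)
        have "N \<noteq> {}" using card by auto
        then have "\<exists>y\<in>set p. y \<in> N" using False r(2) by (auto simp: N_def)
        \<comment> \<open>\<open>a\<close> is the spoke end nearest to \<open>z\<close> on the side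
          away from \<open>z'\<close>, so the sector starting at \<open>a\<close> runs through the
          edge from \<open>z\<close> to \<open>z'\<close>.\<close>
        then obtain m a s0 where p: "p = m @ a # s0" "a \<in> N" "\<forall>y\<in>set s0. y \<notin> N"
          using split_list_last_prop[of p "\<lambda>z. z \<in> N"] by blast
        then have r0: "ring a (s0 @ z # m)" "C = insert a (set (s0 @ z # m))"
          using ring_rotate r by auto
        obtain s b q where s: "s0 @ z # m = s @ b # q" "q \<noteq> []" "b \<in> N" "set s \<inter> N = {}"
          and u: "\<And>D. hole D \<and> D \<subseteq> W \<and> {w, a, hd (s0 @ z # m)} \<subseteq> D \<longleftrightarrow> D = {w, a, b} \<union> set s"
          and thr: "thread W (a # s @ [b])"
          by (rule sector_unique[OF C r0 w N_def p(2) card]) (unfold W, blast)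
        have "b \<notin> set s0" "b \<noteq> z" using s(3) p(3) False by auto
        obtain m1 where m1: "s = s0 @ z # m1" "m = m1 @ b # q"
        proof -
          from s(1) consider us where "s0 @ us = s" "z # m = us @ b # q" | us where "s0 = s @ us" "us @ z # m = b # q"
            by (auto simp: append_eq_append_conv2)
          then show thesis
          proof cases
            case 1
            then show thesis using that \<open>b \<noteq> z\<close> by (cases us) auto
          next
            case 2
            then show thesis using \<open>b \<notin> set s0\<close> \<open>b \<noteq> z\<close> by (cases us) auto
          qed
        qed
        have z': "z' = hd (m1 @ [b])" using r(3) p(1) m1 by (cases m1) auto
        have 1: "{w, a, hd (s0 @ z # m)} \<subseteq> D" if D: "hole D" "D \<subseteq> W" "{w, z, z'} \<subseteq> D" for D
        proof -
          have "set ((a # s0) @ z # (m1 @ [b])) \<subseteq> D"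
            by (rule absorb[OF D(1,2)]) (use thr m1 D(3) in auto)
          then show ?thesis using D(3) by (cases s0) auto
        qed
        have 2: "{w, z, z'} \<subseteq> {w, a, b} \<union> set s" using z' m1 by (cases m1) auto
        have "hole D \<and> D \<subseteq> W \<and> {w, z, z'} \<subseteq> D \<longleftrightarrow> D = {w, a, b} \<union> set s" for D
        proof
          assume "hole D \<and> D \<subseteq> W \<and> {w, z, z'} \<subseteq> D"
          then show "D = {w, a, b} \<union> set s" using 1[of D] u[of D] by metis
        next
          assume "D = {w, a, b} \<union> set s"
          then show "hole D \<and> D \<subseteq> W \<and> {w, z, z'} \<subseteq> D" using 2 u[of D] by metis
        qed
        then show ?thesis by blast
      qed
      then obtain F where F: "\<And>D. hole D \<and> D \<subseteq> W \<and> {w, z, z'} \<subseteq> D \<longleftrightarrow> D = F" by blast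
      have "{D. hole D \<and> D \<subseteq> W \<and> e \<subseteq> D} = {C, F}"
      proof -
        have *: "D = C" if "hole D" "D \<subseteq> W" "w \<notin> D" for D
          using hole_subset_hole[OF that(1) C] that W by auto
        have "hole D \<and> D \<subseteq> W \<and> e \<subseteq> D \<longleftrightarrow> D = C \<or> D = F" for D
        proof
          assume D: "hole D \<and> D \<subseteq> W \<and> e \<subseteq> D"
          show "D = C \<or> D = F"
          proof (cases "w \<in> D")
            case True
            then show ?thesis using F[of D] D zz(1) by simp
          qed (use * D in simp)
        next
          assume "D = C \<or> D = F"
          then show "hole D \<and> D \<subseteq> W \<and> e \<subseteq> D"
            using F[of F] C rim zz(1) W by (elim disjE) auto
        qed
        then show ?thesis by blast
      qed
      moreover have "C \<noteq> F" using F w by blast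
      ultimately show ?thesis by simp
    qed
  qed
qed

end

section \<open>Solid graphs as configurations of induced paths\<close>

lemma verts_path_graph [simp]: "verts (path_graph p) = set p"
  by (simp add: path_graph_def)

lemma path_split:
  assumes "is_path x P y" "2 \<le> length P"
  shows "P = x # butlast (tl P) @ [y]"
  using assms by (cases P; cases "tl P" rule: rev_cases) (auto simp: is_path_def)

lemma path_edges_inner:
  assumes "distinct (x # m @ [y])" "m \<noteq> []" "e \<in> path_edges (x # m @ [y])"
  shows "e \<inter> set m \<noteq> {}"
proof -
  have "path_edges (x # m @ [y]) = insert {x, hd m} (path_edges (m @ [y]))"
    using assms(2) by (simp add: path_edges_Cons)
  moreover have "path_edges (m @ [y]) = insert {last m, y} (path_edges m)"
    using path_edges_append[of "butlast m" "last m" "[y]"] assms(2)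
    by (metis Un_insert_right append.right_neutral append_butlast_last_id append_eq_append_conv2
        path_edges_Cons_Cons path_edges_single same_append_eq Un_empty_right append.assoc append_Cons append_Nil)
  ultimately have "e = {x, hd m} \<or> e = {last m, y} \<or> e \<in> path_edges m" using assms(3) by auto
  then show ?thesis
  proof (elim disjE)
    assume e: "e \<in> path_edges m"
    then have "card e = 2" using path_edges_card assms(1) by auto
    then show ?thesis using path_edges_subset[OF e] by (auto simp: Int_absorb2)
  qed (use assms(2) in auto)
qed

lemma edges_complete_on [simp]: "edges (complete_on X) = {e. e \<subseteq> X \<and> card e = 2}"
  and verts_complete_on [simp]: "verts (complete_on X) = X"
  by (simp_all add: complete_on_def)

lemma graph_Union_eq:
  "(W, F) = graph_Union \<G> \<longleftrightarrow> W = (\<Union>(verts ` \<G>)) \<and> F = (\<Union>(edges ` \<G>))"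
  by (simp add: graph_Union_def)

context edge_set
begin

lemma induced_edges_two:
  assumes "e \<in> induced_edges W"
  obtains a b where "e = {a, b}" "a \<noteq> b" "adj a b" "a \<in> W" "b \<in> W"
proof -
  have "e \<in> E" using assms by (simp add: induced_edges_def)
  then obtain a b where ab: "e = {a, b}" "a \<noteq> b" "adj a b" by (rule edgeE)
  then show thesis using that[of a b] assms by (simp add: in_induced_edges)
qed

section \<open>Translation between solid graphs and configurations of induced paths\<close>

lemma theta_is_trihedron:
  assumes "theta W"
  shows "is_trihedron (W, induced_edges W)"
proof -
  let ?I = "{1..3::nat}"
  obtain x y p where p: "\<And>i. i \<in> ?I \<Longrightarrow> p i \<noteq> [] \<and> ipath (x # p i @ [y])"
    and cr: "\<And>i j. i \<in> ?I \<Longrightarrow> j \<in> ?I \<Longrightarrow> i \<noteq> j \<Longrightarrow> set (p i) \<inter> set (p j) = {}"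
    and na: "\<And>i j a b. i \<in> ?I \<Longrightarrow> j \<in> ?I \<Longrightarrow> i \<noteq> j \<Longrightarrow> a \<in> set (p i) \<Longrightarrow> b \<in> set (p j) \<Longrightarrow> \<not> adj a b"
    and W: "W = {x, y} \<union> (\<Union>i\<in>?I. set (p i))"
    using assms unfolding theta_def by blast
  define P where "P i = x # p i @ [y]" for i
  have P: "distinct (P i)" "induced_edges (set (P i)) = path_edges (P i)" if "i \<in> ?I" for i
    using p[OF that] unfolding ipath_iff P_def by auto
  have xy: "x \<noteq> y" "\<not> adj x y" using p[of 1] by (auto simp: ipath_append)
  have WP: "W = (\<Union>i\<in>?I. set (P i))" unfolding W P_def by auto
  have "induced_edges W \<subseteq> (\<Union>i\<in>?I. induced_edges (set (P i)))"
  proof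
    fix e assume "e \<in> induced_edges W"
    then obtain a b where ab: "e = {a, b}" "a \<noteq> b" "adj a b" "a \<in> W" "b \<in> W" by (rule induced_edges_two)
    have "\<exists>i\<in>?I. a \<in> set (P i) \<and> b \<in> set (P i)"
    proof (cases "a \<in> {x, y} \<or> b \<in> {x, y}")
      case True
      obtain i j where ij: "i \<in> ?I" "a \<in> set (P i)" "j \<in> ?I" "b \<in> set (P j)"
        using ab(4,5) unfolding WP by blast
      have "c \<in> set (P k)" if "c \<in> {x, y}" for c k using that by (auto simp: P_def)
      then show ?thesis using True ij by blast
    next
      case False
      then obtain i j where ij: "i \<in> ?I" "a \<in> set (p i)" "j \<in> ?I" "b \<in> set (p j)"
        using ab(4,5) unfolding W by blast
      then have "i = j" using na ab(3) by blast
      then show ?thesis using ij by (auto simp: P_def)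
    qed
    then show "e \<in> (\<Union>i\<in>?I. induced_edges (set (P i)))" using ab by (auto simp: in_induced_edges)
  qed
  moreover have "(\<Union>i\<in>?I. induced_edges (set (P i))) \<subseteq> induced_edges W" using WP by (auto simp: induced_edges_def)
  ultimately have eW: "induced_edges W = (\<Union>i\<in>?I. path_edges (P i))" using P(2) by auto
  have "is_path x (P i) y \<and> 2 \<le> path_length (P i)" if i: "i \<in> ?I" for i
    using P(1)[OF i] p[OF i] by (cases "p i") (auto simp: is_path_def path_length_def P_def)
  moreover have "(set (P i) - {x, y}) \<inter> set (P j) = {}" if "i \<in> ?I" "j \<in> ?I" "i \<noteq> j" for i j
    using cr[OF that] by (auto simp: P_def)
  moreover have "(W, induced_edges W) = graph_Union ((\<lambda>i. path_graph (P i)) ` ?I)"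
    unfolding graph_Union_eq image_image verts_path_graph using WP eW by simp
  ultimately show ?thesis unfolding is_trihedron_def using xy by blast
qed

text \<open>The union has no edges besides those of its paths. Each edge of a path of length at
  least 2 has an inner vertex as an end, and this vertex tells which path the edge belongs to; so
  the paths are induced and no edge joins the interiors of two of them.\<close>

lemma is_trihedron_theta:
  assumes "is_trihedron (W, induced_edges W)"
  shows "theta W"
proof -
  let ?I = "{1..3::nat}"
  obtain x y P where xy: "x \<noteq> y"
    and P: "\<And>i. i \<in> ?I \<Longrightarrow> is_path x (P i) y \<and> 2 \<le> path_length (P i)"
    and dis: "\<And>i j. i \<in> ?I \<Longrightarrow> j \<in> ?I \<Longrightarrow> i \<noteq> j \<Longrightarrow> (set (P i) - {x, y}) \<inter> set (P j) = {}"
    and eq: "(W, induced_edges W) = graph_Union ((\<lambda>i. path_graph (P i)) ` ?I)"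
    using assms unfolding is_trihedron_def by (elim exE conjE) (rule that; (assumption | blast))
  define p where "p i = butlast (tl (P i))" for i
  have Pp: "P i = x # p i @ [y]" "p i \<noteq> []" "distinct (x # p i @ [y])" if i: "i \<in> ?I" for i
  proof -
    have "2 \<le> length (P i)" "is_path x (P i) y" using P[OF i] by (auto simp: path_length_def)
    then show *: "P i = x # p i @ [y]" unfolding p_def by (intro path_split)
    show "p i \<noteq> []" using P[OF i] * by (auto simp: path_length_def)
    show "distinct (x # p i @ [y])" using P[OF i] * by (auto simp: is_path_def)
  qed
  have W: "W = (\<Union>i\<in>?I. set (P i))" and eW: "induced_edges W = (\<Union>i\<in>?I. path_edges (P i))"
    using eq unfolding graph_Union_eq image_image verts_path_graph by auto
  have cr: "set (p i) \<inter> set (P j) = {}" if "i \<in> ?I" "j \<in> ?I" "i \<noteq> j" for i j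
    using dis[OF that] Pp[OF that(1)] by auto
  have "ipath (P i)" if i: "i \<in> ?I" for i
    unfolding ipath_iff
  proof (intro conjI equalityI subsetI)
    show "distinct (P i)" using Pp[OF i] by simp
    fix e assume e: "e \<in> induced_edges (set (P i))"
    then have "e \<in> induced_edges W" using W i by (auto simp: induced_edges_def)
    then obtain j where j: "j \<in> ?I" "e \<in> path_edges (P j)" using eW by blast
    then have "e \<inter> set (p j) \<noteq> {}" using path_edges_inner[of x "p j" y e] Pp[OF j(1)] by simp
    moreover have "e \<subseteq> set (P i)" using e by (simp add: induced_edges_def)
    ultimately have "i = j" using cr[OF j(1) i] by blast
    then show "e \<in> path_edges (P i)" using j by simp
  next
    fix e assume e: "e \<in> path_edges (P i)"
    then have "e \<in> induced_edges W" using eW i by blast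
    then show "e \<in> induced_edges (set (P i))" using path_edges_subset[OF e] by (simp add: induced_edges_def)
  qed
  moreover have "\<not> adj a b" if ij: "i \<in> ?I" "j \<in> ?I" "i \<noteq> j" and ab: "a \<in> set (p i)" "b \<in> set (p j)" for i j a b
  proof
    assume "adj a b"
    moreover have "a \<in> W" "b \<in> W" using W ij ab Pp by auto
    ultimately have "{a, b} \<in> induced_edges W" by (simp add: in_induced_edges)
    then obtain k where k: "k \<in> ?I" "{a, b} \<in> path_edges (P k)" using eW by blast
    then have "a \<in> set (P k)" "b \<in> set (P k)" using path_edges_subset by fastforce+
    then show False using cr[OF ij(1) k(1)] cr[OF ij(2) k(1)] ab ij(3) by blast
  qed
  moreover have "W = {x, y} \<union> (\<Union>i\<in>?I. set (p i))" using W Pp(1) by auto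
  moreover have "set (p i) \<inter> set (p j) = {}" if "i \<in> ?I" "j \<in> ?I" "i \<noteq> j" for i j
    using cr[OF that] Pp(1)[OF that(2)] by auto
  ultimately show ?thesis
    unfolding theta_def using Pp by (intro exI[of _ x] exI[of _ y] exI[of _ p]) auto
qed

lemma stamp_is_stamp:
  assumes "stamp W"
  shows "is_stamp (W, induced_edges W)"
proof -
  let ?I = "{1..3::nat}"
  obtain x l where p: "\<And>i. i \<in> ?I \<Longrightarrow> l i \<noteq> [] \<and> ipath (l i @ [x])"
    and cr: "\<And>i j. i \<in> ?I \<Longrightarrow> j \<in> ?I \<Longrightarrow> i \<noteq> j \<Longrightarrow> set (l i) \<inter> set (l j) = {}"
    and ad: "\<And>i j a b. i \<in> ?I \<Longrightarrow> j \<in> ?I \<Longrightarrow> i \<noteq> j \<Longrightarrow> a \<in> set (l i) \<Longrightarrow> b \<in> set (l j) \<Longrightarrow>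
      adj a b \<longleftrightarrow> a = hd (l i) \<and> b = hd (l j)"
    and W: "W = {x} \<union> (\<Union>i\<in>?I. set (l i))"
    using assms unfolding stamp_def by blast
  define t where "t i = hd (l i)" for i
  define P where "P i = l i @ [x]" for i
  have P: "distinct (P i)" "induced_edges (set (P i)) = path_edges (P i)" if "i \<in> ?I" for i
    using p[OF that] unfolding ipath_iff P_def by auto
  have tl: "t i \<in> set (l i)" if "i \<in> ?I" for i using p[OF that] by (simp add: t_def)
  have xl: "x \<notin> set (l i)" if "i \<in> ?I" for i using P(1)[OF that] by (simp add: P_def)
  have tij: "t i \<in> set (l j) \<longleftrightarrow> i = j" if "i \<in> ?I" "j \<in> ?I" for i j
    using tl[OF that(1)] cr[OF that] by (cases "i = j") auto
  have WP: "W = t ` ?I \<union> (\<Union>i\<in>?I. set (P i))" unfolding W P_def using tl by auto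
  have "induced_edges W \<subseteq> {e. e \<subseteq> t ` ?I \<and> card e = 2} \<union> (\<Union>i\<in>?I. induced_edges (set (P i)))"
  proof
    fix e assume "e \<in> induced_edges W"
    then obtain a b where ab: "e = {a, b}" "a \<noteq> b" "adj a b" "a \<in> W" "b \<in> W" by (rule induced_edges_two)
    show "e \<in> {e. e \<subseteq> t ` ?I \<and> card e = 2} \<union> (\<Union>i\<in>?I. induced_edges (set (P i)))"
    proof (cases "\<exists>i\<in>?I. a \<in> set (P i) \<and> b \<in> set (P i)")
      case True
      then show ?thesis using ab by (auto simp: in_induced_edges)
    next
      case False
      then have "a \<noteq> x" "b \<noteq> x" using ab(2,4,5) unfolding W P_def by auto
      then obtain i j where ij: "i \<in> ?I" "a \<in> set (l i)" "j \<in> ?I" "b \<in> set (l j)"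
        using ab(4,5) unfolding W by blast
      then have "i \<noteq> j" using False by (auto simp: P_def)
      then have "a = t i" "b = t j" using ad[OF ij(1,3) _ ij(2,4)] ab(3) by (auto simp: t_def)
      then show ?thesis using ij ab by simp
    qed
  qed
  moreover have "(\<Union>i\<in>?I. induced_edges (set (P i))) \<subseteq> induced_edges W" using WP by (auto simp: induced_edges_def)
  moreover have "{e. e \<subseteq> t ` ?I \<and> card e = 2} \<subseteq> induced_edges W"
  proof
    fix e assume e: "e \<in> {e. e \<subseteq> t ` ?I \<and> card e = 2}"
    then obtain a b where ab: "e = {a, b}" "a \<noteq> b" by (auto simp: card_2_iff)
    then obtain i j where ij: "i \<in> ?I" "j \<in> ?I" "a = t i" "b = t j" using e by auto
    then have "adj a b" using ad[OF ij(1,2) _ tl[OF ij(1)] tl[OF ij(2)]] ab(2) by (auto simp: t_def)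
    then show "e \<in> induced_edges W" using ab ij WP by (auto simp: in_induced_edges)
  qed
  ultimately have eW: "induced_edges W = {e. e \<subseteq> t ` ?I \<and> card e = 2} \<union> (\<Union>i\<in>?I. path_edges (P i))"
    using P(2) by auto
  have "inj_on t ?I" using tij tl by (metis inj_onI)
  moreover have "x \<notin> t ` ?I" using xl tl by blast
  moreover have "is_path (t i) (P i) x \<and> path_length (P i) \<ge> 1 \<and> set (P i) \<inter> t ` ?I = {t i}"
    if i: "i \<in> ?I" for i
  proof (intro conjI)
    show "is_path (t i) (P i) x" "path_length (P i) \<ge> 1"
      using P(1)[OF i] p[OF i] by (auto simp: is_path_def path_length_def P_def t_def Suc_le_eq)
    show "set (P i) \<inter> t ` ?I = {t i}"
      using tij[OF _ i] \<open>x \<notin> t ` ?I\<close> i by (auto simp: P_def)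
  qed
  moreover have "(set (P i) - {x}) \<inter> (set (P j) - {x}) = {}" if "i \<in> ?I" "j \<in> ?I" "i \<noteq> j" for i j
    using cr[OF that] by (auto simp: P_def)
  moreover have "(W, induced_edges W) = graph_Union (insert (complete_on (t ` ?I)) ((\<lambda>i. path_graph (P i)) ` ?I))"
    unfolding graph_Union_eq image_insert image_image verts_path_graph Union_insert
      verts_complete_on edges_complete_on using WP eW by simp
  ultimately show ?thesis unfolding is_stamp_def by blast
qed

lemma is_stamp_stamp:
  assumes "is_stamp (W, induced_edges W)"
  shows "stamp W"
proof -
  let ?I = "{1..3::nat}"
  obtain t x P where inj: "inj_on t ?I" and xt: "x \<notin> t ` ?I"
    and P: "\<And>i. i \<in> ?I \<Longrightarrow> is_path (t i) (P i) x \<and> 1 \<le> path_length (P i) \<and> set (P i) \<inter> t ` ?I = {t i}"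
    and dis: "\<And>i j. i \<in> ?I \<Longrightarrow> j \<in> ?I \<Longrightarrow> i \<noteq> j \<Longrightarrow> (set (P i) - {x}) \<inter> (set (P j) - {x}) = {}"
    and eq: "(W, induced_edges W) = graph_Union (insert (complete_on (t ` ?I)) ((\<lambda>i. path_graph (P i)) ` ?I))"
    using assms unfolding is_stamp_def by (elim exE conjE) (rule that; (assumption | blast))
  define l where "l i = butlast (P i)" for i
  have Pl: "P i = l i @ [x]" "l i \<noteq> []" "distinct (l i @ [x])" "hd (l i) = t i" if i: "i \<in> ?I" for i
  proof -
    have *: "2 \<le> length (P i)" "is_path (t i) (P i) x" using P[OF i] by (auto simp: path_length_def)
    then show e: "P i = l i @ [x]" unfolding l_def is_path_def by (metis append_butlast_last_id)
    show "l i \<noteq> []" using *(1) e by auto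
    then show "distinct (l i @ [x])" "hd (l i) = t i" using * e by (auto simp: is_path_def)
  qed
  have W: "W = t ` ?I \<union> (\<Union>i\<in>?I. set (P i))"
    and eW: "induced_edges W = {e. e \<subseteq> t ` ?I \<and> card e = 2} \<union> (\<Union>i\<in>?I. path_edges (P i))"
    using eq unfolding graph_Union_eq image_insert image_image verts_path_graph Union_insert
      verts_complete_on edges_complete_on by auto
  have cr: "set (P i) \<inter> set (P j) \<subseteq> {x}" if "i \<in> ?I" "j \<in> ?I" "i \<noteq> j" for i j
    using dis[OF that] by auto
  have tP: "t i \<in> set (P i)" if "i \<in> ?I" for i using P[OF that] by auto
  have card1: "\<not> e \<subseteq> {z}" if "card e = 2" for e and z :: 'a
    using that card_mono[of "{z}" e] by auto
  have "ipath (P i)" if i: "i \<in> ?I" for i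
    unfolding ipath_iff
  proof (intro conjI equalityI subsetI)
    show "distinct (P i)" using Pl[OF i] by simp
    fix e assume e: "e \<in> induced_edges (set (P i))"
    then have "e \<in> induced_edges W" using W i by (auto simp: induced_edges_def)
    moreover have s: "e \<subseteq> set (P i)" "card e = 2" using e card_edge by (auto simp: induced_edges_def)
    \<comment> \<open>The path meets the triangle in \<open>t i\<close> only, so no edge of the
      triangle is a chord of it.\<close>
    moreover have "\<not> e \<subseteq> t ` ?I"
      using P[OF i] s card1 by (metis le_inf_iff)
    ultimately obtain j where j: "j \<in> ?I" "e \<in> path_edges (P j)" using eW by blast
    have "i = j"
    proof (rule ccontr)
      assume "i \<noteq> j"
      then have "e \<subseteq> {x}" using cr[OF i j(1)] s(1) path_edges_subset[OF j(2)] by blast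
      then show False using card1 s(2) by blast
    qed
    then show "e \<in> path_edges (P i)" using j by simp
  next
    fix e assume e: "e \<in> path_edges (P i)"
    then have "e \<in> induced_edges W" using eW i by blast
    then show "e \<in> induced_edges (set (P i))" using path_edges_subset[OF e] by (simp add: induced_edges_def)
  qed
  moreover have "adj a b \<longleftrightarrow> a = hd (l i) \<and> b = hd (l j)"
    if ij: "i \<in> ?I" "j \<in> ?I" "i \<noteq> j" and ab: "a \<in> set (l i)" "b \<in> set (l j)" for i j a b
  proof
    have x: "a \<noteq> x" "b \<noteq> x" using Pl(3)[OF ij(1)] Pl(3)[OF ij(2)] ab by auto
    have aP: "a \<in> set (P i)" "b \<in> set (P j)" using ab Pl(1) ij by auto
    assume "adj a b"
    moreover have "a \<in> W" "b \<in> W" using W ij aP by auto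
    ultimately have "{a, b} \<in> induced_edges W" by (simp add: in_induced_edges)
    moreover have "{a, b} \<notin> path_edges (P k)" if k: "k \<in> ?I" for k
    proof
      assume "{a, b} \<in> path_edges (P k)"
      then have "a \<in> set (P k)" "b \<in> set (P k)" using path_edges_subset by fastforce+
      then show False using cr[OF ij(1) k] cr[OF ij(2) k] aP x ij(3) by blast
    qed
    ultimately have "a \<in> t ` ?I" "b \<in> t ` ?I" using eW by auto
    then have "a = t i" "b = t j" using P[OF ij(1)] P[OF ij(2)] aP by blast+
    then show "a = hd (l i) \<and> b = hd (l j)" using Pl ij by simp
  next
    assume "a = hd (l i) \<and> b = hd (l j)"
    then have e: "a = t i" "b = t j" using Pl ij by auto
    then have "a \<noteq> b" using inj ij by (auto simp: inj_on_def)
    then have "{a, b} \<in> induced_edges W" using e ij eW by auto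
    then show "adj a b" by (simp add: in_induced_edges)
  qed
  moreover have "W = {x} \<union> (\<Union>i\<in>?I. set (l i))"
  proof -
    have "t ` ?I \<subseteq> (\<Union>i\<in>?I. set (P i))" using tP by blast
    then have "W = (\<Union>i\<in>?I. set (P i))" using W by blast
    then show ?thesis using Pl(1) by auto
  qed
  moreover have "set (l i) \<inter> set (l j) = {}" if "i \<in> ?I" "j \<in> ?I" "i \<noteq> j" for i j
    using cr[OF that] Pl(1,3)[OF that(1)] Pl(1,3)[OF that(2)] by auto
  ultimately show ?thesis
    unfolding stamp_def using Pl by (intro exI[of _ x] exI[of _ l]) auto
qed

lemma prism_is_prism:
  assumes "prism W"
  shows "is_prism (W, induced_edges W)"
proof -
  let ?I = "{1..3::nat}"
  obtain l where p: "\<And>i. i \<in> ?I \<Longrightarrow> 2 \<le> length (l i) \<and> ipath (l i)"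
    and cr: "\<And>i j. i \<in> ?I \<Longrightarrow> j \<in> ?I \<Longrightarrow> i \<noteq> j \<Longrightarrow> set (l i) \<inter> set (l j) = {}"
    and ad: "\<And>i j a b. i \<in> ?I \<Longrightarrow> j \<in> ?I \<Longrightarrow> i \<noteq> j \<Longrightarrow> a \<in> set (l i) \<Longrightarrow> b \<in> set (l j) \<Longrightarrow>
      adj a b \<longleftrightarrow> a = hd (l i) \<and> b = hd (l j) \<or> a = last (l i) \<and> b = last (l j)"
    and W: "W = (\<Union>i\<in>?I. set (l i))"
    using assms unfolding prism_def by blast
  define t where "t i = hd (l i)" for i
  define s where "s i = last (l i)" for i
  have P: "distinct (l i)" "induced_edges (set (l i)) = path_edges (l i)" if "i \<in> ?I" for i
    using p[OF that] unfolding ipath_iff by auto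
  have tl: "l i \<noteq> []" "t i \<in> set (l i)" "s i \<in> set (l i)" "t i \<noteq> s i" if "i \<in> ?I" for i
    using p[OF that] P(1)[OF that] by (cases "l i"; auto simp: t_def s_def)+
  have uniq: "i = j" if "z \<in> set (l i)" "z \<in> set (l j)" "i \<in> ?I" "j \<in> ?I" for i j z
    using cr that by blast
  have "induced_edges W \<subseteq> {e. e \<subseteq> t ` ?I \<and> card e = 2} \<union> {e. e \<subseteq> s ` ?I \<and> card e = 2} \<union> (\<Union>i\<in>?I. induced_edges (set (l i)))"
  proof
    fix e assume "e \<in> induced_edges W"
    then obtain a b where ab: "e = {a, b}" "a \<noteq> b" "adj a b" "a \<in> W" "b \<in> W" by (rule induced_edges_two)
    then obtain i j where ij: "i \<in> ?I" "a \<in> set (l i)" "j \<in> ?I" "b \<in> set (l j)"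
      unfolding W by blast
    show "e \<in> {e. e \<subseteq> t ` ?I \<and> card e = 2} \<union> {e. e \<subseteq> s ` ?I \<and> card e = 2} \<union> (\<Union>i\<in>?I. induced_edges (set (l i)))"
    proof (cases "i = j")
      case True
      then show ?thesis using ij ab by (auto simp: in_induced_edges)
    next
      case False
      then have "a = t i \<and> b = t j \<or> a = s i \<and> b = s j"
        using ad[OF ij(1,3) _ ij(2,4)] ab(3) by (auto simp: t_def s_def)
      then show ?thesis using ij ab by auto
    qed
  qed
  moreover have "(\<Union>i\<in>?I. induced_edges (set (l i))) \<subseteq> induced_edges W" using W by (auto simp: induced_edges_def)
  moreover have "{e. e \<subseteq> f ` ?I \<and> card e = 2} \<subseteq> induced_edges W"
    if f: "\<And>i j. i \<in> ?I \<Longrightarrow> j \<in> ?I \<Longrightarrow> i \<noteq> j \<Longrightarrow> adj (f i) (f j)" "\<And>i. i \<in> ?I \<Longrightarrow> f i \<in> set (l i)" for f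
  proof
    fix e assume e: "e \<in> {e. e \<subseteq> f ` ?I \<and> card e = 2}"
    then obtain a b where ab: "e = {a, b}" "a \<noteq> b" by (auto simp: card_2_iff)
    then obtain i j where ij: "i \<in> ?I" "j \<in> ?I" "a = f i" "b = f j" using e by auto
    then have "adj a b" using f(1)[OF ij(1,2)] ab(2) by auto
    moreover have "a \<in> W" "b \<in> W" unfolding W ij(3,4) using f(2) ij(1,2) by blast+
    ultimately show "e \<in> induced_edges W" using ab by (auto simp: in_induced_edges)
  qed
  then have "{e. e \<subseteq> t ` ?I \<and> card e = 2} \<subseteq> induced_edges W" "{e. e \<subseteq> s ` ?I \<and> card e = 2} \<subseteq> induced_edges W"
    using ad tl by (simp_all add: t_def s_def)
  ultimately have eW: "induced_edges W = {e. e \<subseteq> t ` ?I \<and> card e = 2} \<union> {e. e \<subseteq> s ` ?I \<and> card e = 2} \<union> (\<Union>i\<in>?I. path_edges (l i))"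
    using P(2) by auto
  have tsW: "t ` ?I \<subseteq> W" "s ` ?I \<subseteq> W" unfolding W using tl by blast+
  have inj: "inj_on t ?I" "inj_on s ?I" using tl uniq by (metis inj_onI)+
  have "t i \<noteq> s j" if "i \<in> ?I" "j \<in> ?I" for i j
    using tl(4)[OF that(1)] uniq[OF tl(2)[OF that(1)], of j] tl(3)[OF that(2)] that by metis
  then have ts: "t ` ?I \<inter> s ` ?I = {}" by blast
  have path: "\<forall>i\<in>?I. is_path (t i) (l i) (s i) \<and> set (l i) \<inter> (t ` ?I \<union> s ` ?I) = {t i, s i}"
  proof (intro ballI conjI)
    fix i assume i: "i \<in> ?I"
    show "is_path (t i) (l i) (s i)" using P(1)[OF i] tl(1)[OF i] by (simp add: is_path_def t_def s_def)
    show "set (l i) \<inter> (t ` ?I \<union> s ` ?I) = {t i, s i}"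
      using tl(2,3) uniq i by blast
  qed
  have eq: "(W, induced_edges W) = graph_Union ({complete_on (t ` ?I), complete_on (s ` ?I)} \<union> (\<lambda>i. path_graph (l i)) ` ?I)"
    unfolding graph_Union_eq image_insert image_Un image_image verts_path_graph Union_insert Union_Un_distrib
      verts_complete_on edges_complete_on using W tsW eW by auto
  have "\<forall>i\<in>?I. \<forall>j\<in>?I. i \<noteq> j \<longrightarrow> set (l i) \<inter> set (l j) = {}" using cr by blast
  then show ?thesis unfolding is_prism_def using inj ts path eq
    by (intro exI[of _ t] exI[of _ s] exI[of _ l] conjI)
qed

lemma is_prism_prism:
  assumes "is_prism (W, induced_edges W)"
  shows "prism W"
proof -
  let ?I = "{1..3::nat}"
  obtain t s P where inj: "inj_on t ?I" "inj_on s ?I" and ts: "t ` ?I \<inter> s ` ?I = {}"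
    and P': "\<forall>i\<in>?I. is_path (t i) (P i) (s i) \<and> set (P i) \<inter> (t ` ?I \<union> s ` ?I) = {t i, s i}"
    and cr': "\<forall>i\<in>?I. \<forall>j\<in>?I. i \<noteq> j \<longrightarrow> set (P i) \<inter> set (P j) = {}"
    and eq: "(W, induced_edges W) = graph_Union ({complete_on (t ` ?I), complete_on (s ` ?I)} \<union> (\<lambda>i. path_graph (P i)) ` ?I)"
    using assms unfolding is_prism_def by (elim exE conjE) (rule that)
  have P: "is_path (t i) (P i) (s i) \<and> set (P i) \<inter> (t ` ?I \<union> s ` ?I) = {t i, s i}" if "i \<in> ?I" for i
    using P' that by (rule bspec)
  have cr: "set (P i) \<inter> set (P j) = {}" if "i \<in> ?I" "j \<in> ?I" "i \<noteq> j" for i j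
    using cr' that by blast
  have Pl: "hd (P i) = t i" "last (P i) = s i" "distinct (P i)" "P i \<noteq> []" "2 \<le> length (P i)" if i: "i \<in> ?I" for i
  proof -
    show *: "hd (P i) = t i" "last (P i) = s i" "distinct (P i)" "P i \<noteq> []"
      using P[OF i] by (auto simp: is_path_def)
    have "t i \<noteq> s i" using ts i by blast
    then show "2 \<le> length (P i)" using * by (cases "P i"; cases "tl (P i)") auto
  qed
  have W: "W = t ` ?I \<union> s ` ?I \<union> (\<Union>i\<in>?I. set (P i))"
    and eW: "induced_edges W = {e. e \<subseteq> t ` ?I \<and> card e = 2} \<union> {e. e \<subseteq> s ` ?I \<and> card e = 2} \<union> (\<Union>i\<in>?I. path_edges (P i))"
    using eq unfolding graph_Union_eq image_insert image_Un image_image verts_path_graph Union_insert Union_Un_distrib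
      verts_complete_on edges_complete_on by auto
  have tP: "t i \<in> set (P i)" "s i \<in> set (P i)" if "i \<in> ?I" for i using P[OF that] by auto
  have tU: "z = t i" if "i \<in> ?I" "z \<in> set (P i)" "z \<in> t ` ?I" for i z
    using P[OF that(1)] that ts by blast
  have sU: "z = s i" if "i \<in> ?I" "z \<in> set (P i)" "z \<in> s ` ?I" for i z
    using P[OF that(1)] that ts by blast
  have card1: "\<not> e \<subseteq> {z}" if "card e = 2" for e and z :: 'a
    using that card_mono[of "{z}" e] by auto
  have "ipath (P i)" if i: "i \<in> ?I" for i
    unfolding ipath_iff
  proof (intro conjI equalityI subsetI)
    show "distinct (P i)" using Pl[OF i] by simp
    fix e assume e: "e \<in> induced_edges (set (P i))"
    then have "e \<in> induced_edges W" using W i by (auto simp: induced_edges_def)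
    moreover have s: "e \<subseteq> set (P i)" "card e = 2" using e card_edge by (auto simp: induced_edges_def)
    moreover have "\<not> e \<subseteq> t ` ?I" using tU[OF i] s card1[of e "t i"] by blast
    moreover have "\<not> e \<subseteq> s ` ?I" using sU[OF i] s card1[of e "s i"] by blast
    ultimately obtain j where j: "j \<in> ?I" "e \<in> path_edges (P j)" using eW by blast
    have "i = j"
    proof (rule ccontr)
      assume "i \<noteq> j"
      then have "e \<subseteq> {}" using cr[OF i j(1)] s(1) path_edges_subset[OF j(2)] by blast
      then show False using s(2) by simp
    qed
    then show "e \<in> path_edges (P i)" using j by simp
  next
    fix e assume e: "e \<in> path_edges (P i)"
    then have "e \<in> induced_edges W" using eW i by blast
    then show "e \<in> induced_edges (set (P i))" using path_edges_subset[OF e] by (simp add: induced_edges_def)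
  qed
  moreover have "adj a b \<longleftrightarrow> a = hd (P i) \<and> b = hd (P j) \<or> a = last (P i) \<and> b = last (P j)"
    if ij: "i \<in> ?I" "j \<in> ?I" "i \<noteq> j" and ab: "a \<in> set (P i)" "b \<in> set (P j)" for i j a b
  proof
    assume "adj a b"
    moreover have "a \<in> W" "b \<in> W" using W ij ab by auto
    ultimately have "{a, b} \<in> induced_edges W" by (simp add: in_induced_edges)
    moreover have "{a, b} \<notin> path_edges (P k)" if k: "k \<in> ?I" for k
    proof
      assume "{a, b} \<in> path_edges (P k)"
      then have "a \<in> set (P k)" "b \<in> set (P k)" using path_edges_subset by fastforce+
      then show False using cr[OF ij(1) k] cr[OF ij(2) k] ab ij(3) by blast
    qed
    ultimately have "a \<in> t ` ?I \<and> b \<in> t ` ?I \<or> a \<in> s ` ?I \<and> b \<in> s ` ?I" using eW by auto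
    then have "a = t i \<and> b = t j \<or> a = s i \<and> b = s j"
      using tU[OF ij(1) ab(1)] tU[OF ij(2) ab(2)] sU[OF ij(1) ab(1)] sU[OF ij(2) ab(2)] by blast
    then show "a = hd (P i) \<and> b = hd (P j) \<or> a = last (P i) \<and> b = last (P j)"
      using Pl ij by simp
  next
    assume "a = hd (P i) \<and> b = hd (P j) \<or> a = last (P i) \<and> b = last (P j)"
    then have e: "a = t i \<and> b = t j \<or> a = s i \<and> b = s j" using Pl ij by auto
    then have "a \<noteq> b" using inj ij by (auto simp: inj_on_def)
    then have "{a, b} \<in> induced_edges W" using e ij eW by auto
    then show "adj a b" by (simp add: in_induced_edges)
  qed
  moreover have "W = (\<Union>i\<in>?I. set (P i))"
  proof -
    have "t ` ?I \<subseteq> (\<Union>i\<in>?I. set (P i))" "s ` ?I \<subseteq> (\<Union>i\<in>?I. set (P i))" using tP by blast+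
    then show ?thesis using W by blast
  qed
  ultimately show ?thesis
    unfolding prism_def using Pl(5) cr by (intro exI[of _ P]) blast
qed

lemma wheel_iff: "is_pyramid (W, induced_edges W) \<longleftrightarrow> wheel W"
proof
  assume "wheel W"
  then obtain C w where C: "hole C" "w \<notin> C" "3 \<le> card {z \<in> C. adj w z}" "W = insert w C"
    unfolding wheel_def by blast
  define N where "N = {z \<in> C. adj w z}"
  have "induced_edges W = induced_edges C \<union> {{w, v} | v. v \<in> N}" by (simp add: C(4) induced_edges_insert N_def)
  then have "(W, induced_edges W) = (insert w (verts (C, induced_edges C)), edges (C, induced_edges C) \<union> {{w, v} | v. v \<in> N})"
    using C(4) by simp
  moreover have "is_cycle (C, induced_edges C)" using C(1) by (simp add: is_cycle_iff_hole)
  moreover have "N \<subseteq> C" "3 \<le> card N" using C(3) by (auto simp: N_def)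
  ultimately show "is_pyramid (W, induced_edges W)" unfolding is_pyramid_def using C(2)
    by (intro exI[of _ "(C, induced_edges C)"] exI[of _ w] exI[of _ N]) auto
next
  assume "is_pyramid (W, induced_edges W)"
  then obtain C w N where C: "is_cycle C" "w \<notin> verts C" "N \<subseteq> verts C" "3 \<le> card N"
    "W = insert w (verts C)" and eW: "induced_edges W = edges C \<union> {{w, v} | v. v \<in> N}"
    unfolding is_pyramid_def by auto
  have CV: "e \<subseteq> verts C" if e: "e \<in> edges C" for e
  proof -
    obtain c where c: "3 \<le> length c" "C = (set c, insert {last c, hd c} (path_edges c))"
      using C(1) unfolding is_cycle_def by blast
    then have "c \<noteq> []" by auto
    then show ?thesis using e c(2) path_edges_subset[of e c] by auto
  qed
  \<comment> \<open>All edges added to \<open>C\<close> contain \<open>w\<close>, so deleting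
    \<open>w\<close> from the induced graph gives back \<open>C\<close>, which is therefore
    chordless.\<close>
  have "induced_edges (verts C) = {e \<in> induced_edges W. w \<notin> e}" using C(2,5) by (auto simp: induced_edges_def)
  also have "\<dots> = edges C" unfolding eW using CV C(2) by auto
  finally have "C = (verts C, induced_edges (verts C))" by simp
  then have h: "hole (verts C)" using C(1) is_cycle_iff_hole by metis
  have "adj w z \<longleftrightarrow> z \<in> N" if "z \<in> verts C" for z
  proof -
    have "adj w z \<longleftrightarrow> {w, z} \<in> induced_edges W" using that C(5) by (simp add: in_induced_edges)
    also have "\<dots> \<longleftrightarrow> z \<in> N" unfolding eW using CV[of "{w, z}"] C(2) by (auto simp: doubleton_eq_iff)
    finally show ?thesis .
  qed
  then have "{z \<in> verts C. adj w z} = N" using C(3) by auto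
  then show "wheel W" unfolding wheel_def using h C by metis
qed

lemma solid_graph_iff:
  "solid_graph (W, induced_edges W) \<longleftrightarrow> theta W \<or> stamp W \<or> prism W \<or> wheel W"
  unfolding solid_graph_def wheel_iff
  using theta_is_trihedron is_trihedron_theta stamp_is_stamp is_stamp_stamp
    prism_is_prism is_prism_prism by blast

lemma solid_graph_even: "solid_graph (W, induced_edges W) \<Longrightarrow> even_holes W"
  unfolding solid_graph_iff using theta_even stamp_even prism_even wheel_even by blast

text \<open>A trihedron and a prism contain nonadjacent vertices, while in a stamp or a wheel
  completeness shrinks the paths to single vertices and the rim to a triangle. This bounds the
  number of solids of a complete graph.\<close>

lemma solid_graph_complete_card:
  assumes "solid_graph (W, induced_edges W)" "\<And>a b. a \<in> W \<Longrightarrow> b \<in> W \<Longrightarrow> a \<noteq> b \<Longrightarrow> adj a b"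
  shows "card W = 4"
proof -
  let ?I = "{1..3::nat}"
  have I: "?I = {1, 2, 3}" by auto
  consider "theta W" | "stamp W" | "prism W" | "wheel W" using assms(1) unfolding solid_graph_iff by blast
  then show ?thesis
  proof cases
    case 1
    then obtain x y p where p: "\<And>i. i \<in> ?I \<Longrightarrow> p i \<noteq> [] \<and> ipath (x # p i @ [y])"
      and W: "W = {x, y} \<union> (\<Union>i\<in>?I. set (p i))" unfolding theta_def by blast
    have "x \<noteq> y" "\<not> adj x y" using p[of 1] by (auto simp: ipath_append)
    then show ?thesis using assms(2)[of x y] W by auto
  next
    case 2
    then obtain x l where l: "\<And>i. i \<in> ?I \<Longrightarrow> l i \<noteq> [] \<and> ipath (l i @ [x])"
      and cr: "\<And>i j. i \<in> ?I \<Longrightarrow> j \<in> ?I \<Longrightarrow> i \<noteq> j \<Longrightarrow> set (l i) \<inter> set (l j) = {}"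
      and W: "W = {x} \<union> (\<Union>i\<in>?I. set (l i))" unfolding stamp_def by blast
    have one: "set (l i) = {last (l i)}" "x \<notin> set (l i)" if i: "i \<in> ?I" for i
    proof -
      show x: "x \<notin> set (l i)" using l[OF i] by (auto simp: ipath_append)
      have "z = last (l i)" if z: "z \<in> set (l i)" for z
      proof -
        have "z \<in> W" "x \<in> W" "z \<noteq> x" using z x W i by auto
        then have "adj z x" using assms(2) by blast
        then show ?thesis using l[OF i] z by (auto simp: ipath_append)
      qed
      then show "set (l i) = {last (l i)}" using l[OF i] by auto
    qed
    have "W = {x, last (l 1), last (l 2), last (l 3)}"
      unfolding W I using one[of 1] one[of 2] one[of 3] by auto
    moreover have "last (l 1) \<noteq> last (l 2)" "last (l 1) \<noteq> last (l 3)" "last (l 2) \<noteq> last (l 3)"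
      using cr[of 1 2] cr[of 1 3] cr[of 2 3] one[of 1] one[of 2] one[of 3] by auto
    moreover have "x \<noteq> last (l 1)" "x \<noteq> last (l 2)" "x \<noteq> last (l 3)"
      using one[of 1] one[of 2] one[of 3] by auto
    ultimately show ?thesis by simp
  next
    case 3
    then obtain l where l: "\<And>i. i \<in> ?I \<Longrightarrow> 2 \<le> length (l i) \<and> ipath (l i)"
      and cr: "\<And>i j. i \<in> ?I \<Longrightarrow> j \<in> ?I \<Longrightarrow> i \<noteq> j \<Longrightarrow> set (l i) \<inter> set (l j) = {}"
      and ad: "\<And>i j a b. i \<in> ?I \<Longrightarrow> j \<in> ?I \<Longrightarrow> i \<noteq> j \<Longrightarrow> a \<in> set (l i) \<Longrightarrow> b \<in> set (l j) \<Longrightarrow>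
        adj a b \<longleftrightarrow> a = hd (l i) \<and> b = hd (l j) \<or> a = last (l i) \<and> b = last (l j)"
      and W: "W = (\<Union>i\<in>?I. set (l i))" unfolding prism_def by blast
    have n: "l i \<noteq> []" "hd (l i) \<noteq> last (l i)" if "i \<in> ?I" for i
      using l[OF that] ipath_distinct[of "l i"] by (cases "l i"; auto)+
    have h: "hd (l 1) \<in> set (l 1)" "last (l 2) \<in> set (l 2)" "set (l 1) \<inter> set (l 2) = {}"
      using n[of 1] n[of 2] cr[of 1 2] by auto
    then have "hd (l 1) \<in> W" "last (l 2) \<in> W" "hd (l 1) \<noteq> last (l 2)" unfolding W I by auto
    then have "adj (hd (l 1)) (last (l 2))" using assms(2) by blast
    then show ?thesis using ad[of 1 2 "hd (l 1)" "last (l 2)"] n[of 1] n[of 2] by auto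
  next
    case 4
    then obtain C w where C: "hole C" "w \<notin> C" "W = insert w C" unfolding wheel_def by blast
    obtain x p where r: "ring x p" "C = insert x (set p)" using C(1) by (auto simp: hole_def)
    have "z = hd p \<or> z = last p" if z: "z \<in> set p" for z
    proof -
      have "adj x z" using assms(2)[of x z] r z C by (auto simp: ring_def)
      then show ?thesis using r z by (auto simp: ring_def)
    qed
    moreover have "p \<noteq> []" using r by (auto simp: ring_def)
    ultimately have "set p = {hd p, last p}" by auto
    then have "card (set p) = 2" using ring_hd_neq_last[OF r(1)] by (metis card_2_iff)
    then show ?thesis using r C by (auto simp: ring_def)
  qed
qed

end

section \<open>Invariance under isomorphism\<close>

lemma hole_image:
  assumes "edge_set E" "edge_set F" "inj_on f D"
    "\<And>a b. a \<in> D \<Longrightarrow> b \<in> D \<Longrightarrow> edge_set.adj F (f a) (f b) \<longleftrightarrow> edge_set.adj E a b"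
    "edge_set.hole E D"
  shows "edge_set.hole F (f ` D)"
proof -
  interpret A: edge_set E by fact
  interpret B: edge_set F by fact
  obtain x p where r: "A.ring x p" "D = insert x (set p)" using assms(5) by (auto simp: A.hole_def)
  have ip: "B.ipath (map f q)" if "A.ipath q" "set q \<subseteq> D" for q
    using that
  proof (induction q)
    case (Cons a q)
    have "f a \<notin> set (map f q)" using Cons.prems assms(3) by (auto simp: inj_on_def)
    moreover have "B.adj (f a) (f z) \<longleftrightarrow> f z = hd (map f q)" if z: "z \<in> set q" for z
    proof -
      have "hd (map f q) = f (hd q)" "hd q \<in> set q" using z by (cases q; simp)+
      then have "f z = hd (map f q) \<longleftrightarrow> z = hd q"
        using assms(3) z Cons.prems(2) by (auto simp: inj_on_def)
      then show ?thesis using assms(4)[of a z] Cons.prems z by auto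
    qed
    ultimately show ?case using Cons by auto
  qed simp
  have p: "p \<noteq> []" using r by (auto simp: A.ring_def)
  have "B.adj (f x) (f z) \<longleftrightarrow> f z = hd (map f p) \<or> f z = last (map f p)" if z: "z \<in> set p" for z
  proof -
    have "hd (map f p) = f (hd p)" "last (map f p) = f (last p)" "hd p \<in> set p" "last p \<in> set p"
      using p by (auto simp: hd_map last_map)
    then have "f z = hd (map f p) \<longleftrightarrow> z = hd p" "f z = last (map f p) \<longleftrightarrow> z = last p"
      using assms(3) z r(2) by (auto simp: inj_on_def)
    then show ?thesis using assms(4)[of x z] r z by (auto simp: A.ring_def)
  qed
  moreover have "f x \<notin> f ` set p" using assms(3) r by (auto simp: inj_on_def A.ring_def)
  ultimately have "B.ring (f x) (map f p)"
    using r ip[of p] by (auto simp: A.ring_def B.ring_def)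
  then show ?thesis unfolding B.hole_def using r(2) by (intro exI[of _ "f x"] exI[of _ "map f p"]) auto
qed

context edge_set
begin

text \<open>This matches \<open>solids\<close>, which asks for an isomorphic solid graph. The two
  properties used of such a set, evenness and the size inside a complete graph, are transported
  along the isomorphism, so the configuration need not be exhibited in \<open>W\<close>
  itself.\<close>

definition solid_set :: "'a set \<Rightarrow> bool" where
  "solid_set W \<longleftrightarrow> (\<exists>K :: 'a graph. solid_graph K \<and> isomorphic (W, induced_edges W) K)"

lemma solid_graph_solid_set: "solid_graph (W, induced_edges W) \<Longrightarrow> solid_set W"
  unfolding solid_set_def isomorphic_def by (intro exI[of _ "(W, induced_edges W)"]) (auto intro!: exI[of _ id])

lemma solid_set_transfer:
  assumes "solid_set W"
  obtains K :: "'a graph" and f where "bij_betw f W (verts K)" "edge_set (edges K)"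
    "\<And>a b. a \<in> W \<Longrightarrow> b \<in> W \<Longrightarrow> edge_set.adj (edges K) (f a) (f b) \<longleftrightarrow> adj a b"
    "edges K = image f ` induced_edges W" "edge_set.induced_edges (edges K) (verts K) = edges K"
    "solid_graph (verts K, edge_set.induced_edges (edges K) (verts K))"
proof -
  obtain K :: "'a graph" and f where K: "solid_graph K" "bij_betw f W (verts K)" "edges K = image f ` induced_edges W"
    using assms unfolding solid_set_def isomorphic_def by auto
  have inj: "inj_on f W" using K(2) by (rule bij_betw_imp_inj_on)
  interpret B: edge_set "edges K"
  proof
    fix e assume "e \<in> edges K"
    then obtain d where d: "d \<in> induced_edges W" "e = f ` d" using K(3) by auto
    then have "card d = 2" "d \<subseteq> W" using card_edge by (auto simp: induced_edges_def)
    then show "card e = 2" using d card_image[of f d] inj_on_subset[OF inj] by auto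
  qed
  have "B.adj (f a) (f b) \<longleftrightarrow> adj a b" if ab: "a \<in> W" "b \<in> W" for a b
  proof
    assume "B.adj (f a) (f b)"
    then have "f ` {a, b} \<in> edges K" by (simp add: B.adj_def)
    then have "f ` {a, b} \<in> image f ` induced_edges W" unfolding K(3) .
    then obtain d where d: "f ` {a, b} = f ` d" "d \<in> induced_edges W" by (rule imageE)
    moreover from this have "d \<subseteq> W" by (simp add: induced_edges_def)
    ultimately have "{a, b} = d" using inj_on_image_eq_iff[OF inj, of "{a, b}" d] ab by simp
    then show "adj a b" using d by (auto simp: in_induced_edges)
  next
    assume "adj a b"
    then have "{a, b} \<in> induced_edges W" using ab by (simp add: in_induced_edges)
    then have "f ` {a, b} \<in> edges K" unfolding K(3) by (rule imageI)
    then show "B.adj (f a) (f b)" by (simp add: B.adj_def)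
  qed
  moreover have "B.induced_edges (verts K) = edges K"
  proof -
    have "e \<subseteq> verts K" if e: "e \<in> edges K" for e
    proof -
      obtain d where "e = f ` d" "d \<in> induced_edges W" using e unfolding K(3) by (rule imageE)
      then show ?thesis using K(2) by (auto simp: induced_edges_def bij_betw_def)
    qed
    then show ?thesis by (auto simp: B.induced_edges_def)
  qed
  moreover have "K = (verts K, edges K)" by simp
  ultimately show thesis using that[of f K] K B.edge_set_axioms by metis
qed

lemma solid_set_even:
  assumes "solid_set W"
  shows "even_holes W"
proof -
  obtain K :: "'a graph" and f where K: "bij_betw f W (verts K)" "edge_set (edges K)"
    "\<And>a b. a \<in> W \<Longrightarrow> b \<in> W \<Longrightarrow> edge_set.adj (edges K) (f a) (f b) \<longleftrightarrow> adj a b"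
    "edges K = image f ` induced_edges W" "edge_set.induced_edges (edges K) (verts K) = edges K"
    "solid_graph (verts K, edge_set.induced_edges (edges K) (verts K))"
    using solid_set_transfer[OF assms] by metis
  interpret B: edge_set "edges K" by (rule K(2))
  have inj: "inj_on f W" and im: "f ` W = verts K" using K(1) by (auto simp: bij_betw_def)
  have hole: "B.hole (f ` D) \<longleftrightarrow> hole D" if D: "D \<subseteq> W" for D
  proof
    assume "hole D"
    then show "B.hole (f ` D)"
      using hole_image[OF edge_set_axioms B.edge_set_axioms inj_on_subset[OF inj D]] K(3) D by blast
  next
    assume h: "B.hole (f ` D)"
    let ?g = "inv_into W f"
    have g: "?g (f a) = a" if "a \<in> D" for a using inj D that by (simp add: subset_iff)
    have "hole (?g ` f ` D)"
      by (rule hole_image[OF B.edge_set_axioms edge_set_axioms _ _ h])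
        (use g K(3) D in \<open>auto simp: inj_on_def subset_iff\<close>)
    moreover have "?g ` f ` D = D" using g by (force simp: image_image)
    ultimately show "hole D" by simp
  qed
  show ?thesis
    unfolding even_holes_def
  proof
    fix e assume e: "e \<in> induced_edges W"
    then have eW: "e \<subseteq> W" by (simp add: induced_edges_def)
    have "f ` e \<in> B.induced_edges (verts K)" using e K(4,5) by simp
    then have "even (card {D. B.hole D \<and> D \<subseteq> verts K \<and> f ` e \<subseteq> D})"
      using B.solid_graph_even[OF K(6)] unfolding B.even_holes_def by blast
    moreover have "{D. B.hole D \<and> D \<subseteq> verts K \<and> f ` e \<subseteq> D} = image f ` {D. hole D \<and> D \<subseteq> W \<and> e \<subseteq> D}"
    proof (intro equalityI subsetI)
      fix D assume D: "D \<in> {D. B.hole D \<and> D \<subseteq> verts K \<and> f ` e \<subseteq> D}"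
      then obtain D' where D': "D' \<subseteq> W" "D = f ` D'" unfolding im[symmetric] by (auto simp: subset_image_iff)
      have "e \<subseteq> D'"
      proof
        fix z assume z: "z \<in> e"
        then have "f z \<in> f ` D'" using D D'(2) by blast
        then show "z \<in> D'" using inj_on_image_mem_iff[OF inj _ D'(1)] z eW by blast
      qed
      then show "D \<in> image f ` {D. hole D \<and> D \<subseteq> W \<and> e \<subseteq> D}" using D D' hole by auto
    next
      fix D assume "D \<in> image f ` {D. hole D \<and> D \<subseteq> W \<and> e \<subseteq> D}"
      then obtain D' where "hole D'" "D' \<subseteq> W" "e \<subseteq> D'" "D = f ` D'" by auto
      moreover from this have "f ` D' \<subseteq> verts K" "f ` e \<subseteq> f ` D'" unfolding im[symmetric] by blast+
      ultimately show "D \<in> {D. B.hole D \<and> D \<subseteq> verts K \<and> f ` e \<subseteq> D}" using hole by simp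
    qed
    moreover have "inj_on (image f) {D. hole D \<and> D \<subseteq> W \<and> e \<subseteq> D}"
      using inj_on_image_Pow[OF inj] by (rule inj_on_subset) auto
    ultimately show "even (card {D. hole D \<and> D \<subseteq> W \<and> e \<subseteq> D})" by (simp add: card_image)
  qed
qed

lemma solid_set_complete_card:
  assumes "solid_set W" "\<And>a b. a \<in> W \<Longrightarrow> b \<in> W \<Longrightarrow> a \<noteq> b \<Longrightarrow> adj a b"
  shows "card W = 4"
proof -
  obtain K :: "'a graph" and f where K: "bij_betw f W (verts K)" "edge_set (edges K)"
    "\<And>a b. a \<in> W \<Longrightarrow> b \<in> W \<Longrightarrow> edge_set.adj (edges K) (f a) (f b) \<longleftrightarrow> adj a b"
    "solid_graph (verts K, edge_set.induced_edges (edges K) (verts K))"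
    using solid_set_transfer[OF assms(1)] by metis
  interpret B: edge_set "edges K" by (rule K(2))
  have "B.adj a b" if "a \<in> verts K" "b \<in> verts K" "a \<noteq> b" for a b
  proof -
    obtain a' b' where "a' \<in> W" "b' \<in> W" "a = f a'" "b = f b'"
      using K(1) \<open>a \<in> verts K\<close> \<open>b \<in> verts K\<close> unfolding bij_betw_def by (metis imageE)
    then show ?thesis using K(3) assms(2) \<open>a \<noteq> b\<close> by blast
  qed
  then have "card (verts K) = 4" by (rule B.solid_graph_complete_card[OF K(4)])
  then show ?thesis using bij_betw_same_card[OF K(1)] by simp
qed

end

section \<open>Solids around an induced cycle\<close>

context edge_set
begin

lemma ipath_adj_split:
  assumes "ipath p" "x \<in> set p" "y \<in> set p" "adj x y"
  obtains l r where "p = l @ x # y # r" | l r where "p = l @ y # x # r"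
proof -
  have "{x, y} \<in> path_edges p" using assms in_induced_edges[of x y "set p"] by (simp add: ipath_iff)
  then obtain i where i: "{x, y} = {p ! i, p ! Suc i}" "Suc i < length p" by (auto simp: path_graph_def)
  then have "p = take i p @ p ! i # p ! Suc i # drop (Suc (Suc i)) p"
    by (simp add: Cons_nth_drop_Suc)
  moreover have "x = p ! i \<and> y = p ! Suc i \<or> y = p ! i \<and> x = p ! Suc i"
    using i(1) by (auto simp: doubleton_eq_iff)
  ultimately show thesis using that by metis
qed

lemma ring_split:
  assumes "ring a (u @ v)" "u \<noteq> []" "v \<noteq> []"
  shows "ipath (a # u)" "ipath (v @ [a])" "ipath u" "ipath v" "a \<notin> set u" "a \<notin> set v" "set u \<inter> set v = {}"
    "\<And>x y. x \<in> set u \<Longrightarrow> y \<in> set v \<Longrightarrow> adj x y \<longleftrightarrow> x = last u \<and> y = hd v"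
    "\<And>x. x \<in> set u \<Longrightarrow> adj a x \<longleftrightarrow> x = hd u" "\<And>y. y \<in> set v \<Longrightarrow> adj a y \<longleftrightarrow> y = last v"
proof -
  have ip: "ipath (u @ v)" and a: "a \<notin> set (u @ v)"
    and ad: "\<And>z. z \<in> set (u @ v) \<Longrightarrow> adj a z \<longleftrightarrow> z = hd (u @ v) \<or> z = last (u @ v)"
    using assms(1) by (auto simp: ring_def)
  show uv: "ipath u" "ipath v" "set u \<inter> set v = {}"
    "\<And>x y. x \<in> set u \<Longrightarrow> y \<in> set v \<Longrightarrow> adj x y \<longleftrightarrow> x = last u \<and> y = hd v"
    using ip by (auto simp: ipath_append)
  show au: "a \<notin> set u" "a \<notin> set v" using a by auto
  have e: "hd (u @ v) = hd u" "last (u @ v) = last v" "hd u \<in> set u" "last v \<in> set v" using assms by auto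
  show x: "adj a x \<longleftrightarrow> x = hd u" if "x \<in> set u" for x
    using ad[of x] that e uv(3) by auto
  show y: "adj a y \<longleftrightarrow> y = last v" if "y \<in> set v" for y
    using ad[of y] that e uv(3) by auto
  show "ipath (a # u)" using uv au x by simp
  show "ipath (v @ [a])" using uv au y by (auto simp: ipath_append adj_sym)
qed

text \<open>An induced path \<open>Q\<close> outside a hole is attached to it by its ends, each
  seeing one vertex or one edge of the hole. Here both see a vertex, \<open>a\<close> and
  \<open>b\<close>, which are nonadjacent as \<open>p1\<close> and \<open>p2\<close> are
  nonempty.\<close>

lemma theta_of_ring:
  assumes r: "ring a (p1 @ b # p2)" "p1 \<noteq> []" "p2 \<noteq> []"
    and C: "C = insert a (set (p1 @ b # p2))"
    and Q: "ipath Q" "Q \<noteq> []" "set Q \<inter> C = {}"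
    and ad: "\<And>c z. c \<in> C \<Longrightarrow> z \<in> set Q \<Longrightarrow> adj c z \<longleftrightarrow> c = a \<and> z = hd Q \<or> c = b \<and> z = last Q"
  shows "theta (C \<union> set Q)"
proof -
  let ?I = "{1..3::nat}"
  have I: "?I = {1, 2, 3}" by auto
  define p where "p i = (if i = (1::nat) then p1 else if i = 2 then rev p2 else Q)" for i
  have s1: "ipath (a # p1 @ [b])" using ring_split(1)[of a "p1 @ [b]" p2] r by simp
  have "ipath ((b # p2) @ [a])" using ring_split(2)[of a p1 "b # p2"] r by simp
  then have s2: "ipath (a # rev p2 @ [b])" using ipath_rev[of "b # p2 @ [a]"] by simp
  have ab: "a \<noteq> b" "\<not> adj a b" "a \<in> C" "b \<in> C" using s1 r(2) C by (auto simp: ipath_append)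
  have Qab: "a \<notin> set Q" "b \<notin> set Q" using Q(3) ab by auto
  have s3: "ipath (a # Q @ [b])"
    using Q ab Qab ad[OF ab(3)] ad[OF ab(4)] by (auto simp: ipath_append adj_sym hd_append)
  have 12: "set p1 \<inter> set p2 = {}" "\<And>x y. x \<in> set p1 \<Longrightarrow> y \<in> set p2 \<Longrightarrow> \<not> adj x y" "b \<notin> set p1" "b \<notin> set p2"
    "a \<notin> set p1" "a \<notin> set p2"
    using r(1) by (auto simp: ring_def ipath_append)
  have pQ: "set p1 \<inter> set Q = {}" "set p2 \<inter> set Q = {}" using Q(3) C by auto
  have nQ: "\<not> adj x z" if "x \<in> set p1 \<union> set p2" "z \<in> set Q" for x z
    using ad[of x z] that 12 C by auto
  have "\<forall>i\<in>?I. p i \<noteq> [] \<and> ipath (a # p i @ [b])"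
    unfolding I using s1 s2 s3 r Q(2) by (simp add: p_def)
  moreover have "\<forall>i\<in>?I. \<forall>j\<in>?I. i \<noteq> j \<longrightarrow> set (p i) \<inter> set (p j) = {} \<and>
        (\<forall>x\<in>set (p i). \<forall>y\<in>set (p j). \<not> adj x y)"
  proof -
    have "\<not> adj y x" if "x \<in> set p1" "y \<in> set p2" for x y using 12(2)[OF that] adj_sym by blast
    moreover have "\<not> adj z x" if "x \<in> set p1 \<union> set p2" "z \<in> set Q" for x z using nQ[OF that] adj_sym by blast
    ultimately show ?thesis unfolding I using 12 pQ nQ by (auto simp: p_def)
  qed
  moreover have "C \<union> set Q = {a, b} \<union> (\<Union>i\<in>?I. set (p i))"
    unfolding I C by (auto simp: p_def)
  ultimately show ?thesis unfolding theta_def by blast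
qed

text \<open>One end of \<open>Q\<close> sees the vertex \<open>a\<close>, the apex; the other sees
  the edge between \<open>last u\<close> and \<open>hd v\<close> and completes it to the
  triangle.\<close>

lemma stamp_of_ring:
  assumes r: "ring a (u @ v)" "u \<noteq> []" "v \<noteq> []"
    and C: "C = insert a (set (u @ v))"
    and Q: "ipath Q" "Q \<noteq> []" "set Q \<inter> C = {}"
    and ad: "\<And>c z. c \<in> C \<Longrightarrow> z \<in> set Q \<Longrightarrow>
      adj c z \<longleftrightarrow> c = a \<and> z = hd Q \<or> (c = last u \<or> c = hd v) \<and> z = last Q"
  shows "stamp (C \<union> set Q)"
proof -
  let ?I = "{1..3::nat}"
  have I: "?I = {1, 2, 3}" by auto
  define l where "l i = (if i = (1::nat) then rev u else if i = 2 then v else rev Q)" for i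
  note rs = ring_split[OF r]
  have s1: "ipath (rev u @ [a])" using rs(1) ipath_rev[of "a # u"] by simp
  have aQ: "a \<notin> set Q" "a \<in> C" using Q(3) C by auto
  have "last u \<in> set u" "hd v \<in> set v" using r by auto
  then have a: "a \<noteq> last u" "a \<noteq> hd v" using rs(5,6) by auto
  have s3: "ipath (rev Q @ [a])"
    using Q aQ ad[OF aQ(2)] a by (auto simp: ipath_append last_rev adj_sym)
  have uQ: "adj x z \<longleftrightarrow> x = last u \<and> z = last Q" if "x \<in> set u" "z \<in> set Q" for x z
    using ad[of x z] that C rs(5,7) \<open>hd v \<in> set v\<close> by auto
  have vQ: "adj x z \<longleftrightarrow> x = hd v \<and> z = last Q" if "x \<in> set v" "z \<in> set Q" for x z
    using ad[of x z] that C rs(6,7) \<open>last u \<in> set u\<close> by auto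
  have dQ: "set u \<inter> set Q = {}" "set v \<inter> set Q = {}" using Q(3) C by auto
  have "\<forall>i\<in>?I. l i \<noteq> [] \<and> ipath (l i @ [a])"
    unfolding I using s1 s3 rs r Q(2) by (simp add: l_def)
  moreover have "\<forall>i\<in>?I. \<forall>j\<in>?I. i \<noteq> j \<longrightarrow> set (l i) \<inter> set (l j) = {} \<and>
        (\<forall>x\<in>set (l i). \<forall>y\<in>set (l j). adj x y \<longleftrightarrow> x = hd (l i) \<and> y = hd (l j))"
  proof -
    have "adj y x \<longleftrightarrow> y = hd v \<and> x = last u" if "x \<in> set u" "y \<in> set v" for x y
      using rs(8)[OF that] adj_sym by blast
    moreover have "adj z x \<longleftrightarrow> z = last Q \<and> x = last u" if "x \<in> set u" "z \<in> set Q" for x z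
      using uQ[OF that] adj_sym by blast
    moreover have "adj z x \<longleftrightarrow> z = last Q \<and> x = hd v" if "x \<in> set v" "z \<in> set Q" for x z
      using vQ[OF that] adj_sym by blast
    ultimately show ?thesis
      unfolding I using dQ rs(7,8) uQ vQ r Q(2) by (simp add: l_def hd_rev Int_commute)
  qed
  moreover have "C \<union> set Q = {a} \<union> (\<Union>i\<in>?I. set (l i))"
    unfolding I C by (auto simp: l_def)
  ultimately show ?thesis unfolding stamp_def by blast
qed

text \<open>Both ends of \<open>Q\<close> see an edge: \<open>hd Q\<close> the one from
  \<open>a\<close> to \<open>last v\<close>, and \<open>last Q\<close> the one from
  \<open>last u\<close> to \<open>hd v\<close>. The length conditions on \<open>u\<close> and
  \<open>v\<close> keep these edges disjoint.\<close>

lemma prism_of_ring: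
  assumes r: "ring a (u @ v)" "u \<noteq> []" "2 \<le> length v"
    and C: "C = insert a (set (u @ v))"
    and Q: "ipath Q" "2 \<le> length Q" "set Q \<inter> C = {}"
    and ad: "\<And>c z. c \<in> C \<Longrightarrow> z \<in> set Q \<Longrightarrow>
      adj c z \<longleftrightarrow> (c = a \<or> c = last v) \<and> z = hd Q \<or> (c = last u \<or> c = hd v) \<and> z = last Q"
  shows "prism (C \<union> set Q)"
proof -
  let ?I = "{1..3::nat}"
  have I: "?I = {1, 2, 3}" by auto
  have v: "v \<noteq> []" using r by auto
  define l where "l i = (if i = (1::nat) then a # u else if i = 2 then rev v else Q)" for i
  note rs = ring_split[OF r(1,2) v]
  have m: "last u \<in> set u" "hd v \<in> set v" "last v \<in> set v" using r(2) v by auto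
  have vn: "hd v \<noteq> last v" using r(3) ipath_distinct[OF rs(4)] by (cases v) auto
  have a: "a \<noteq> last u" "a \<noteq> hd v" "a \<noteq> last v" using rs(5,6) m by auto
  have "hd Q \<noteq> last Q" using Q(2) ipath_distinct[OF Q(1)] by (cases Q) auto
  then have uQ: "adj x z \<longleftrightarrow> x = a \<and> z = hd Q \<or> x = last u \<and> z = last Q" if "x \<in> insert a (set u)" "z \<in> set Q" for x z
    using ad[of x z] that C rs(5,7) m a by auto
  have vQ: "adj x z \<longleftrightarrow> x = last v \<and> z = hd Q \<or> x = hd v \<and> z = last Q" if "x \<in> set v" "z \<in> set Q" for x z
    using ad[of x z] that C rs(6,7) m by auto
  have uv: "adj x y \<longleftrightarrow> x = a \<and> y = last v \<or> x = last u \<and> y = hd v" if "x \<in> insert a (set u)" "y \<in> set v" for x y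
    using rs(5,8,10) that a by auto
  have dQ: "a \<notin> set Q" "set u \<inter> set Q = {}" "set v \<inter> set Q = {}" using Q(3) C by auto
  have "\<forall>i\<in>?I. 2 \<le> length (l i) \<and> ipath (l i)"
    unfolding I using rs r Q by (simp add: l_def Suc_le_eq)
  moreover have "\<forall>i\<in>?I. \<forall>j\<in>?I. i \<noteq> j \<longrightarrow> set (l i) \<inter> set (l j) = {} \<and>
        (\<forall>x\<in>set (l i). \<forall>y\<in>set (l j). adj x y \<longleftrightarrow>
          x = hd (l i) \<and> y = hd (l j) \<or> x = last (l i) \<and> y = last (l j))"
  proof -
    have l: "l 1 = a # u" "l 2 = rev v" "l 3 = Q" by (simp_all add: l_def)
    have ends: "hd (l 1) = a" "last (l 1) = last u" "hd (l 2) = last v" "last (l 2) = hd v"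
      "set (l 1) = insert a (set u)" "set (l 2) = set v"
      using l r(2) v by (simp_all add: hd_rev last_rev)
    have 12: "set (l 1) \<inter> set (l 2) = {}" and 13: "set (l 1) \<inter> set (l 3) = {}" and 23: "set (l 2) \<inter> set (l 3) = {}"
      using dQ rs(6,7) unfolding ends l(3) by auto
    have a12: "\<forall>x\<in>set (l 1). \<forall>y\<in>set (l 2). adj x y \<longleftrightarrow> x = hd (l 1) \<and> y = hd (l 2) \<or> x = last (l 1) \<and> y = last (l 2)"
      using uv unfolding ends by blast
    have a13: "\<forall>x\<in>set (l 1). \<forall>y\<in>set (l 3). adj x y \<longleftrightarrow> x = hd (l 1) \<and> y = hd (l 3) \<or> x = last (l 1) \<and> y = last (l 3)"
      using uQ unfolding ends l(3) by blast
    have a23: "\<forall>x\<in>set (l 2). \<forall>y\<in>set (l 3). adj x y \<longleftrightarrow> x = hd (l 2) \<and> y = hd (l 3) \<or> x = last (l 2) \<and> y = last (l 3)"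
      using vQ unfolding ends l(3) by blast
    have sym: "\<forall>x\<in>Y. \<forall>y\<in>X. adj x y \<longleftrightarrow> x = c \<and> y = a \<or> x = d \<and> y = b"
      if "\<forall>x\<in>X. \<forall>y\<in>Y. adj x y \<longleftrightarrow> x = a \<and> y = c \<or> x = b \<and> y = d" for X Y a b c d
      using that by (metis adj_sym)
    show ?thesis
      unfolding I using 12 13 23 a12 a13 a23 sym[OF a12] sym[OF a13] sym[OF a23]
      by (simp add: Int_commute)
  qed
  moreover have "C \<union> set Q = (\<Union>i\<in>?I. set (l i))"
    unfolding I C by (auto simp: l_def)
  ultimately show ?thesis unfolding prism_def by blast
qed

text \<open>A triangle is a hole, so by incomparability it is all of \<open>C\<close>.\<close>

lemma hole_no_triangle:
  assumes "hole C" "a \<in> C" "b \<in> C" "c \<in> C" "adj a b" "adj b c" "adj a c"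
    "x \<in> C" "y \<in> C" "x \<noteq> y"
  shows "adj x y"
proof -
  have "{a, b, c} = C" using hole_subset_hole[OF hole_triangle[OF assms(5,6,7)] assms(1)] assms by auto
  then show ?thesis using assms adj_sym by auto
qed

text \<open>Take a shortest induced path \<open>Q\<close> in \<open>Z\<close> having two nonadjacent neighbours of its vertices on \<open>C\<close>. By
  minimality the neighbours on \<open>C\<close> of each end-deleted \<open>Q\<close> form a clique, that is a vertex or an edge; if
  these two cliques share a vertex, it is the hub of a wheel, otherwise their sizes decide between
  trihedron, stamp and prism.\<close>

lemma solid_around_hole:
  assumes C: "hole C" and Z: "conn Z" "Z \<inter> C = {}"
    and ab0: "a0 \<in> C" "b0 \<in> C" "a0 \<noteq> b0" "\<not> adj a0 b0"
    and z0: "z \<in> Z" "adj z a0" "z' \<in> Z" "adj z' b0"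
  obtains W where "solid_graph (W, induced_edges W)" "C \<subseteq> W" "W \<subseteq> C \<union> Z"
proof -
  note result = that
  define NC where "NC Q = {c \<in> C. \<exists>z\<in>set Q. adj c z}" for Q
  define spread where "spread X \<longleftrightarrow> (\<exists>a\<in>X. \<exists>b\<in>X. a \<noteq> b \<and> \<not> adj a b)" for X
  define good where "good Q \<longleftrightarrow> ipath Q \<and> Q \<noteq> [] \<and> set Q \<subseteq> Z \<and> spread (NC Q)" for Q
  have "\<exists>Q. good Q"
  proof -
    obtain l where "walk_between Z z l z'" using Z(1) z0 unfolding conn_def by blast
    then obtain Q where Q: "ipath Q" "Q \<noteq> []" "set Q \<subseteq> Z" "hd Q = z" "last Q = z'"
      by (rule walk_between_ipath)
    then have "z \<in> set Q" "z' \<in> set Q" by auto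
    then have "a0 \<in> NC Q" "b0 \<in> NC Q" using ab0 z0 by (auto simp: NC_def adj_sym)
    then have "spread (NC Q)" using ab0 unfolding spread_def by blast
    then show ?thesis using Q by (auto simp: good_def)
  qed
  then obtain Q where Q: "good Q" and min: "\<And>Q'. good Q' \<Longrightarrow> length Q \<le> length Q'"
    using ex_has_least_nat[of good _ length] by blast
  have Qip: "ipath Q" "Q \<noteq> []" "set Q \<subseteq> Z" and QC: "set Q \<inter> C = {}"
    using Q Z(2) by (auto simp: good_def)
  have fC: "finite C" using C by (rule hole_finite)
  have finish: thesis if "theta (C \<union> set Q) \<or> stamp (C \<union> set Q) \<or> prism (C \<union> set Q) \<or> wheel (C \<union> set Q)"
    using that Qip(3) result[of "C \<union> set Q"] unfolding solid_graph_iff by blast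
  have theta: thesis if ab: "a \<in> C" "b \<in> C" "a \<noteq> b" "\<not> adj a b"
    and ad: "\<And>c z. c \<in> C \<Longrightarrow> z \<in> set Q \<Longrightarrow> adj c z \<longleftrightarrow> c = a \<and> z = hd Q \<or> c = b \<and> z = last Q" for a b
  proof -
    obtain p where r: "ring a p" "C = insert a (set p)" by (rule hole_rooted[OF C ab(1)])
    then obtain p1 p2 where p: "p = p1 @ b # p2" using ab split_list[of b p] by auto
    have "b \<noteq> hd p" "b \<noteq> last p" using r ab by (auto simp: ring_def)
    then have "p1 \<noteq> []" "p2 \<noteq> []" using p by auto
    then show thesis using theta_of_ring[of a p1 b p2 C Q] r p Qip QC ad finish by simp
  qed
  show thesis
  proof (cases "length Q = 1")
    case True
    then obtain q where q: "Q = [q]" by (cases Q) auto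
    define N where "N = {c \<in> C. adj q c}"
    have qC: "q \<notin> C" using QC q by simp
    obtain a b where ab: "a \<in> N" "b \<in> N" "a \<noteq> b" "\<not> adj a b"
      using Q q unfolding good_def spread_def NC_def N_def by (auto simp: adj_sym)
    show thesis
    proof (cases "3 \<le> card N")
      case True
      then have "wheel (insert q C)" unfolding wheel_def using C qC N_def by blast
      then show thesis using finish q by simp
    next
      case False
      have "N = {a, b}"
      proof (rule ccontr)
        assume "N \<noteq> {a, b}"
        then obtain c where "c \<in> N" "c \<noteq> a" "c \<noteq> b" using ab by blast
        then have "card {a, b, c} \<le> card N" using ab fC by (intro card_mono) (auto simp: N_def)
        then show False using False ab(3) \<open>c \<noteq> a\<close> \<open>c \<noteq> b\<close> by (simp add: eval_nat_numeral)
      qed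
      then show thesis
        using theta[of a b] ab q by (auto simp: N_def adj_sym)
    qed
  next
    case False
    then have len: "2 \<le> length Q" using Qip(2) by (cases Q; cases "tl Q") auto
    define A where "A = NC (butlast Q)"
    define B where "B = NC (tl Q)"
    have ne: "tl Q \<noteq> []" "butlast Q \<noteq> []" using len by (cases Q; cases "tl Q"; simp)+
    have subl: "set (tl Q) \<subseteq> set Q" "set (butlast Q) \<subseteq> set Q" by (cases Q; auto dest: in_set_butlastD)+
    have ipt: "ipath (tl Q)" "ipath (butlast Q)"
    proof -
      show "ipath (tl Q)" using Qip(1) by (cases Q) auto
      have "ipath (butlast Q @ [last Q])" using Qip(1,2) by simp
      then show "ipath (butlast Q)" unfolding ipath_append by blast
    qed
    have sZ: "set (butlast Q) \<subseteq> Z" "set (tl Q) \<subseteq> Z" using subl Qip(3) by blast+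
    have nA: "\<not> spread A"
      using min[of "butlast Q"] ipt ne sZ len by (auto simp: good_def A_def)
    have nB: "\<not> spread B"
      using min[of "tl Q"] ipt ne sZ len by (auto simp: good_def B_def)
    have hl: "set (butlast Q) = set Q - {last Q}" "set (tl Q) = set Q - {hd Q}" "hd Q \<noteq> last Q" "hd Q \<in> set Q" "last Q \<in> set Q"
    proof -
      have d: "distinct Q" using Qip(1) by (rule ipath_distinct)
      show "set (tl Q) = set Q - {hd Q}" using d Qip(2) by (cases Q) auto
      show "set (butlast Q) = set Q - {last Q}" using d Qip(2) by (cases Q rule: rev_cases) auto
      show "hd Q \<noteq> last Q" using d len by (cases Q) auto
    qed (use Qip(2) in auto)
    have cliqA: "adj x y" if "x \<in> A" "y \<in> A" "x \<noteq> y" for x y using nA that unfolding spread_def by blast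
    have cliqB: "adj x y" if "x \<in> B" "y \<in> B" "x \<noteq> y" for x y using nB that unfolding spread_def by blast
    have AC: "A \<subseteq> C" "B \<subseteq> C" by (auto simp: A_def B_def NC_def)
    have "NC Q = A \<union> B" using hl unfolding A_def B_def NC_def by auto
    then obtain a b where "a \<in> A \<union> B" "b \<in> A \<union> B" "a \<noteq> b" "\<not> adj a b"
      using Q unfolding good_def spread_def by auto
    then obtain a b where ab: "a \<in> A" "b \<in> B" "a \<noteq> b" "\<not> adj a b"
      using cliqA cliqB adj_sym by (metis UnE)
    then have abn: "a \<notin> B" "b \<notin> A" using cliqA cliqB by blast+
    have abC: "a \<in> C" "b \<in> C" using ab AC by auto
    have memA: "c \<in> A \<longleftrightarrow> c \<in> C \<and> (\<exists>w\<in>set Q. w \<noteq> last Q \<and> adj c w)" for c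
      unfolding A_def NC_def hl(1) by blast
    have memB: "c \<in> B \<longleftrightarrow> c \<in> C \<and> (\<exists>w\<in>set Q. w \<noteq> hd Q \<and> adj c w)" for c
      unfolding B_def NC_def hl(2) by blast
    have noA: "adj c w \<longleftrightarrow> c \<in> B \<and> w = last Q" if "c \<in> C" "c \<notin> A" "w \<in> set Q" for c w
      using that memA[of c] memB[of c] hl(3,5) by metis
    have noB: "adj c w \<longleftrightarrow> c \<in> A \<and> w = hd Q" if "c \<in> C" "c \<notin> B" "w \<in> set Q" for c w
      using that memA[of c] memB[of c] hl(3,4) by metis
    \<comment> \<open>A triangle in \<open>C\<close> would make \<open>a\<close> and
      \<open>b\<close> adjacent. Hence the cliques \<open>A\<close> and \<open>B\<close> have at
      most two elements each.\<close>
    have tri: False if "{x, y, w} \<subseteq> A \<or> {x, y, w} \<subseteq> B" "x \<noteq> y" "y \<noteq> w" "x \<noteq> w" for x y w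
    proof -
      have "adj x y" "adj y w" "adj x w" using that cliqA cliqB by auto
      moreover have "x \<in> C" "y \<in> C" "w \<in> C" using that AC by auto
      ultimately show False using hole_no_triangle[OF C, of x y w a b] abC ab by blast
    qed
    show thesis
    proof (cases "A \<inter> B = {}")
      case False
      then obtain x where x: "x \<in> A" "x \<in> B" by blast
      then have xab: "x \<noteq> a" "x \<noteq> b" "adj x a" "adj x b" using abn cliqA cliqB ab by auto
      have xC: "x \<in> C" using x AC by auto
      obtain p where r: "ring x p" "C = insert x (set p)" "a = hd p" "b = last p"
      proof -
        obtain p where r: "ring x p" "C = insert x (set p)" by (rule hole_rooted[OF C xC])
        have "a \<in> set p" "b \<in> set p" using r abC xab by auto
        then have "a = hd p \<or> a = last p" "b = hd p \<or> b = last p" using r xab by (auto simp: ring_def)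
        then have "a = hd p \<and> b = last p \<or> a = last p \<and> b = hd p" using ab by auto
        then show thesis using that[of p] that[of "rev p"] r ring_rev[OF r(1)] by (auto simp: hd_rev last_rev)
      qed
      have p: "ipath p" "2 \<le> length p" "x \<notin> set p" using r by (auto simp: ring_def)
      \<comment> \<open>Without \<open>x\<close> the hole \<open>C\<close> becomes a path from
        \<open>a\<close> to \<open>b\<close>, which \<open>Q\<close> closes up. The hub
        \<open>x\<close> sees \<open>a\<close>, \<open>b\<close> and a vertex of
        \<open>Q\<close>.\<close>
      have "hole (set p \<union> set Q)"
      proof (rule hole_two_paths)
        fix c w assume c: "c \<in> set p" and w: "w \<in> set Q"
        have cC: "c \<in> C" "c \<noteq> x" using c r p by auto
        show "adj c w \<longleftrightarrow> c = hd p \<and> w = hd Q \<or> c = last p \<and> w = last Q"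
        proof (cases "c = a \<or> c = b")
          case True
          then show ?thesis using noA[OF cC(1) _ w] noB[OF cC(1) _ w] ab abn r by auto
        next
          case False
          then have "c \<notin> A" "c \<notin> B" using tri[of a c x] tri[of b c x] ab x cC xab by auto
          then show ?thesis using noA[OF cC(1) _ w] False r by auto
        qed
      qed (use p Qip QC r len in auto)
      moreover obtain w where w: "w \<in> set Q" "adj x w" using x hl unfolding A_def NC_def by auto
      have "3 \<le> card {y \<in> set p \<union> set Q. adj x y}"
      proof -
        have "card {a, b, w} \<le> card {y \<in> set p \<union> set Q. adj x y}"
          by (rule card_mono) (use w xab r abC in auto)
        moreover have "w \<noteq> a" "w \<noteq> b" using w QC abC by auto
        ultimately show ?thesis using ab(3) by simp
      qed
      moreover have "C \<union> set Q = insert x (set p \<union> set Q)" using r by auto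
      moreover have "x \<notin> set p \<union> set Q" using p QC xC by auto
      ultimately have "wheel (C \<union> set Q)" unfolding wheel_def by blast
      then show thesis using finish by blast
    next
      case disj: True
      have ad: "adj c w \<longleftrightarrow> c \<in> A \<and> w = hd Q \<or> c \<in> B \<and> w = last Q" if "c \<in> C" "w \<in> set Q" for c w
        using noA[OF that(1) _ that(2)] noB[OF that(1) _ that(2)] disj by blast
      have stamp: thesis
        if ab: "a \<in> C" "b \<in> C" "b2 \<in> C" "a \<noteq> b" "a \<noteq> b2" "adj b b2" and Q': "ipath Q'" "set Q' = set Q" "Q' \<noteq> []"
          and ad: "\<And>c w. c \<in> C \<Longrightarrow> w \<in> set Q \<Longrightarrow>
            adj c w \<longleftrightarrow> c = a \<and> w = hd Q' \<or> (c = b \<or> c = b2) \<and> w = last Q'" for a b b2 Q'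
      proof -
        obtain p where r: "ring a p" "C = insert a (set p)" by (rule hole_rooted[OF C ab(1)])
        then have bp: "b \<in> set p" "b2 \<in> set p" "ipath p" using ab by (auto simp: ring_def)
        have "stamp (C \<union> set Q')" if "p = u @ x # y # v" "{x, y} = {b, b2}" for u v x y
          by (rule stamp_of_ring[of a "u @ [x]" "y # v"])
            (use that r Q' QC ad in \<open>auto simp: doubleton_eq_iff\<close>)
        then have "stamp (C \<union> set Q')" using ipath_adj_split[OF bp(3,1,2) ab(6)] by (metis insert_commute)
        then show thesis using finish Q'(2) by simp
      qed
      show thesis
      proof (cases "A = {a}"; cases "B = {b}")
        assume "A = {a}" "B = {b}"
        then show thesis using theta[OF abC ab(3,4)] ad by auto
      next
        assume A: "A = {a}" and "B \<noteq> {b}"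
        then obtain b2 where b2: "b2 \<in> B" "b2 \<noteq> b" using ab by blast
        then have "B = {b, b2}" using tri[of b b2] ab by blast
        then show thesis
          using stamp[of a b b2 Q] A b2 ab abC abn AC cliqB ad Qip by auto
      next
        assume B: "B = {b}" and "A \<noteq> {a}"
        then obtain a2 where a2: "a2 \<in> A" "a2 \<noteq> a" using ab by blast
        then have "A = {a, a2}" using tri[of a a2] ab by blast
        then show thesis
          using stamp[of b a a2 "rev Q"] B a2 ab abC abn AC cliqA ad Qip by (auto simp: hd_rev last_rev)
      next
        assume "A \<noteq> {a}" and "B \<noteq> {b}"
        then obtain a2 b2 where a2: "a2 \<in> A" "a2 \<noteq> a" and b2: "b2 \<in> B" "b2 \<noteq> b" using ab by blast
        then have AB: "A = {a, a2}" "B = {b, b2}" using tri[of a a2] tri[of b b2] ab by blast+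
        have a2C: "a2 \<in> C" "b2 \<in> C" using a2 b2 AC by auto
        have adj2: "adj a a2" "adj b b2" using cliqA cliqB a2 b2 ab by auto
        have neq: "a \<noteq> b2" "a2 \<noteq> b" "a2 \<noteq> b2" using disj AB by auto
        obtain p where r: "ring a p" "C = insert a (set p)" "last p = a2"
        proof -
          obtain p where r: "ring a p" "C = insert a (set p)" by (rule hole_rooted[OF C abC(1)])
          have "a2 \<in> set p" using r a2C a2 by auto
          then have "a2 = hd p \<or> a2 = last p" using r adj2 by (auto simp: ring_def)
          then show thesis using that[of p] that[of "rev p"] r ring_rev[OF r(1)] by (auto simp: last_rev)
        qed
        have bp: "b \<in> set p" "b2 \<in> set p" "ipath p" using r abC a2C ab neq by (auto simp: ring_def)
        have "prism (C \<union> set Q)" if p: "p = u @ x # y # v" "{x, y} = {b, b2}" for u v x y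
        proof -
          have "y \<noteq> a2" using p(2) neq by (auto simp: doubleton_eq_iff)
          then have "v \<noteq> []" using r(3) p(1) by auto
          then have l: "2 \<le> length (y # v)" "last (y # v) = a2" using r(3) p(1) by (auto simp: Suc_le_eq)
          have "adj c w \<longleftrightarrow> (c = a \<or> c = last (y # v)) \<and> w = hd Q \<or> (c = last (u @ [x]) \<or> c = hd (y # v)) \<and> w = last Q"
            if "c \<in> C" "w \<in> set Q" for c w
            unfolding ad[OF that] AB l(2) using p(2) by (auto simp: doubleton_eq_iff)
          then show ?thesis
            using prism_of_ring[of a "u @ [x]" "y # v" C Q] r p l(1) Qip QC len by simp
        qed
        then have "prism (C \<union> set Q)" using ipath_adj_split[OF bp(3,1,2) adj2(2)] by (metis insert_commute)
        then show thesis using finish by blast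
      qed
    qed
  qed
qed

end

section \<open>Connectivity\<close>

context edge_set
begin

definition component :: "'a set \<Rightarrow> 'a \<Rightarrow> 'a set" where
  "component X y = {z. \<exists>l. walk_between X y l z}"

lemma component_subset: "component X y \<subseteq> X"
  by (auto simp: component_def walk_between_def)

lemma component_self: "y \<in> X \<Longrightarrow> y \<in> component X y"
  using walk_between_refl by (auto simp: component_def)

lemma component_closed: "a \<in> component X y \<Longrightarrow> b \<in> X \<Longrightarrow> adj a b \<Longrightarrow> b \<in> component X y"
proof -
  assume a: "a \<in> component X y" and b: "b \<in> X" "adj a b"
  then obtain l where "walk_between X y l a" by (auto simp: component_def)
  moreover have "a \<in> X" using a component_subset by (rule rev_subsetD)
  then have "walk_between X a [a, b] b" using b by (rule walk_between_edge)
  ultimately show ?thesis using walk_between_join unfolding component_def by blast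
qed

lemma component_conn: "conn (component X y)"
proof (rule connI_root[of _ y])
  fix x assume "x \<in> component X y"
  then obtain l where l: "walk_between X y l x" by (auto simp: component_def)
  have "z \<in> component X y" if z: "z \<in> set l" for z
  proof -
    obtain a b where ab: "l = a @ z # b" using z split_list by metis
    then have "walk_between X y (a @ [z]) z"
      using l by (auto simp: walk_between_def successively_append_iff hd_append)
    then show ?thesis by (auto simp: component_def)
  qed
  then have "walk_between (component X y) y l x" using l by (auto simp: walk_between_def)
  then show "\<exists>l. walk_between (component X y) y l x" by blast
qed

lemma not_conn_component:
  assumes "\<not> conn X"
  obtains y where "y \<in> X" "component X y \<noteq> X"
proof -
  obtain x y where "x \<in> X" "y \<in> X" "\<nexists>l. walk_between X x l y" using assms by (auto simp: conn_def)
  then have "y \<notin> component X x" by (simp add: component_def)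
  then show thesis using that[of x] \<open>x \<in> X\<close> \<open>y \<in> X\<close> by blast
qed

lemma component_attach:
  assumes "conn (insert x X)" "x \<notin> X" "y \<in> X"
  shows "conn (insert x (component X y))"
proof -
  obtain b z where bz: "b \<in> component X y" "z \<in> insert x X - component X y" "adj b z"
    by (rule conn_cross[OF assms(1), of "component X y"]) (use assms component_subset component_self in blast)+
  then have "z = x" using component_closed by blast
  then show ?thesis using conn_insert[OF component_conn bz(1)] bz(3) by blast
qed

text \<open>If the induced path from \<open>u\<close> to \<open>v\<close> missed a vertex,
  \<open>conn_noncut\<close> would provide one outside the path whose removal leaves
  \<open>X\<close> connected.\<close>

lemma conn_path_set:
  assumes "conn X" "finite X" "u \<in> X" "v \<in> X" "\<And>z. z \<in> X - {u, v} \<Longrightarrow> \<not> conn (X - {z})"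
  obtains p where "ipath p" "p \<noteq> []" "set p = X" "hd p = u" "last p = v"
proof -
  obtain l where "walk_between X u l v" using assms unfolding conn_def by blast
  then obtain p where p: "ipath p" "p \<noteq> []" "set p \<subseteq> X" "hd p = u" "last p = v"
    by (rule walk_between_ipath)
  have "set p = X"
  proof (rule ccontr)
    assume "set p \<noteq> X"
    then obtain z where z: "z \<in> X - set p" "conn (X - {z})"
      using conn_noncut[OF assms(1,2) p(3) _ conn_walk[OF ipath_walk[OF p(1)]]] p(2) by auto
    have "u \<in> set p" "v \<in> set p" using p by auto
    then show False using assms(5)[of z] z by auto
  qed
  then show thesis using that p by blast
qed

text \<open>Both sides are induced paths from \<open>u\<close> to \<open>v\<close>. For
  \<open>K\<close> this comes from \<open>cut\<close>. If the other side stayed connected after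
  losing a vertex \<open>b\<close> of \<open>R\<close>, any vertex \<open>z\<close> of
  \<open>K\<close> could be removed too, since the two remaining pieces of the path through
  \<open>K\<close> hang on \<open>u\<close> and \<open>v\<close>; this contradicts
  \<open>bad\<close>.\<close>

lemma hole_of_two_sides:
  assumes fin: "finite K" "finite R" and dis: "K \<inter> R = {}" "u \<notin> K \<union> R" "v \<notin> K \<union> R" "u \<noteq> v"
    and ne: "K \<noteq> {}" "R \<noteq> {}" and uv: "\<not> adj u v"
    and KR: "\<And>a b. a \<in> K \<Longrightarrow> b \<in> R \<Longrightarrow> \<not> adj a b"
    and conn: "conn ({u, v} \<union> K)" "conn ({u, v} \<union> R)"
    and bad: "\<And>a b. a \<in> K \<Longrightarrow> b \<in> R \<Longrightarrow> \<not> conn ({u, v} \<union> K \<union> R - {a, b})"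
    and cut: "\<And>z. z \<in> K \<Longrightarrow> \<not> conn ({u, v} \<union> K - {z})"
  shows "hole ({u, v} \<union> K \<union> R)"
proof -
  obtain p where p: "ipath p" "p \<noteq> []" "set p = {u, v} \<union> K" "hd p = u" "last p = v"
    by (rule conn_path_set[OF conn(1), of u v]) (use fin cut in auto)
  have "\<not> conn ({u, v} \<union> R - {b})" if b: "b \<in> R" for b
  proof
    assume c: "conn ({u, v} \<union> R - {b})"
    obtain z where z: "z \<in> K" using ne by blast
    then have "z \<in> set p" using p by blast
    then obtain l r where lr: "p = l @ z # r" using split_list by metis
    have "l \<noteq> []" "r \<noteq> []" using lr p(4,5) z dis by auto
    then have h: "u \<in> set l" "v \<in> set r" using lr p(4,5) by auto
    have "ipath l" "ipath r" "z \<notin> set l" "z \<notin> set r" using p(1) lr by (auto simp: ipath_append)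
    then have "conn (set l)" "conn (set r)" using conn_walk ipath_walk by auto
    then have "conn ((({u, v} \<union> R - {b}) \<union> set l) \<union> set r)"
      using conn_Un_common[OF conn_Un_common[OF c, of "set l" u], of "set r" v] h b dis by auto
    moreover have "((({u, v} \<union> R - {b}) \<union> set l) \<union> set r) = {u, v} \<union> K \<union> R - {z, b}"
    proof -
      have "set l \<union> set r = {u, v} \<union> K - {z}"
        using p(3) lr \<open>z \<notin> set l\<close> \<open>z \<notin> set r\<close> by auto
      then have "({u, v} \<union> R - {b}) \<union> set l \<union> set r = ({u, v} \<union> R - {b}) \<union> ({u, v} \<union> K - {z})"
        by (simp only: Un_assoc)
      moreover have "b \<notin> {u, v} \<union> K" "z \<notin> {u, v} \<union> R" using b z dis by blast+
      ultimately show ?thesis by blast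
    qed
    ultimately show False using bad[OF z b] by simp
  qed
  then obtain q where q: "ipath q" "q \<noteq> []" "set q = {u, v} \<union> R" "hd q = u" "last q = v"
    using conn_path_set[OF conn(2), of u v] fin by auto
  have "2 \<le> length q" using q dis(4) by (cases q; cases "tl q") auto
  then obtain m where m: "q = u # m @ [v]"
    using q(2,4,5) by (cases q; cases "tl q" rule: rev_cases) auto
  have "distinct q" using ipath_distinct[OF q(1)] .
  then have mR: "set m = R" using q(3) m dis by auto
  have mne: "m \<noteq> []" using mR ne by auto
  have mi: "ipath m" "\<And>b. b \<in> R \<Longrightarrow> adj u b \<longleftrightarrow> b = hd m" "\<And>b. b \<in> R \<Longrightarrow> adj v b \<longleftrightarrow> b = last m"
    using q(1) mne mR unfolding m by (auto simp: ipath_append adj_sym)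
  have "hole (set p \<union> set m)"
  proof (rule hole_two_paths)
    have "{u, v} \<subseteq> set p" using p(3) by blast
    then have "card {u, v} \<le> card (set p)" by (rule card_mono[OF finite_set])
    also have "\<dots> \<le> length p" by (rule card_length)
    finally have "2 \<le> length p" using dis(4) by simp
    moreover have "1 \<le> length m" using mne by (simp add: Suc_le_eq)
    ultimately show "3 \<le> length p + length m" by simp
    fix a b assume a: "a \<in> set p" and b: "b \<in> set m"
    then consider "a = u" | "a = v" | "a \<in> K" using p by blast
    then show "adj a b \<longleftrightarrow> a = hd p \<and> b = hd m \<or> a = last p \<and> b = last m"
    proof cases
      case 3
      then show ?thesis using KR b mR p(4,5) dis by auto
    qed (use mi b mR p dis in auto)
  qed (use p mi mne mR dis in auto)
  moreover have "set p \<union> set m = {u, v} \<union> K \<union> R" using p mR by auto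
  ultimately show ?thesis by simp
qed

text \<open>Adapted from Lovasz's lemma in the proof of Brooks' theorem; unlike there, the two vertices
  need not have a common neighbour, and cut vertices are allowed.\<close>

lemma nonadjacent_noncut_pair:
  assumes fin: "finite W" and conn: "conn W"
    and bad: "\<And>u v. u \<in> W \<Longrightarrow> v \<in> W \<Longrightarrow> u \<noteq> v \<Longrightarrow> \<not> adj u v \<Longrightarrow> \<not> conn (W - {u, v})"
    and uv: "u \<in> W" "v \<in> W" "u \<noteq> v" "\<not> adj u v"
  shows "hole W"
proof (cases "\<exists>x\<in>W. \<not> conn (W - {x})")
  case True
  then obtain x where x: "x \<in> W" "\<not> conn (W - {x})" by blast
  then obtain y where y: "y \<in> W - {x}" "component (W - {x}) y \<noteq> W - {x}" using not_conn_component by blast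
  let ?X = "W - {x}"
  define K where "K = component ?X y"
  have WX: "insert x ?X = W" using x by auto
  have K: "K \<subseteq> ?X" "y \<in> K" "K \<noteq> ?X" using y component_subset component_self by (auto simp: K_def)
  have c1: "conn (insert x K)" unfolding K_def by (rule component_attach) (use WX conn y in auto)
  have c2: "conn (W - K)"
  proof (rule connI_root[of _ x])
    fix w assume w: "w \<in> W - K"
    show "\<exists>l. walk_between (W - K) x l w"
    proof (cases "w = x")
      case True then show ?thesis using walk_between_refl w by blast
    next
      case False
      then have wX: "w \<in> ?X" using w by auto
      have "conn (insert x (component ?X w))" by (rule component_attach) (use WX conn wX in auto)
      then obtain l where l: "walk_between (insert x (component ?X w)) x l w"
        using component_self[OF wX] unfolding conn_def by blast
      have "component ?X w \<inter> K = {}"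
      proof (rule ccontr)
        assume "component ?X w \<inter> K \<noteq> {}"
        then obtain z l m where "walk_between ?X w l z" "walk_between ?X y m z" by (auto simp: K_def component_def)
        then have "w \<in> K" unfolding K_def component_def using walk_between_join walk_between_rev by blast
        then show False using w by simp
      qed
      then have "insert x (component ?X w) \<subseteq> W - K" using component_subset[of ?X w] x K by auto
      then show ?thesis using walk_between_mono[OF l] by blast
    qed
  qed
  have xK: "x \<notin> K" using K by auto
  \<comment> \<open>Take a removable vertex on each side of the cut vertex \<open>x\<close>: the two
    are nonadjacent, and removing both keeps \<open>W\<close> connected, against
    \<open>bad\<close>.\<close>
  obtain z1 where z1: "z1 \<in> insert x K - {x}" "conn (insert x K - {z1})"
    by (rule conn_noncut[OF c1, of "{x}"]) (use fin K finite_subset[of K W] xK in auto)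
  obtain z2 where z2: "z2 \<in> (W - K) - {x}" "conn ((W - K) - {z2})"
    by (rule conn_noncut[OF c2, of "{x}"]) (use fin K x in auto)
  have "conn ((insert x K - {z1}) \<union> ((W - K) - {z2}))"
    by (rule conn_Un_common[OF z1(2) z2(2), of x]) (use z1 z2 x xK in auto)
  moreover have "(insert x K - {z1}) \<union> ((W - K) - {z2}) = W - {z1, z2}" using z1 z2 K x by auto
  moreover have "\<not> adj z1 z2" using component_closed[of z1 ?X y z2] z1 z2 unfolding K_def by auto
  moreover have "z1 \<in> W" "z2 \<in> W" "z1 \<noteq> z2" using z1 z2 K by auto
  ultimately show ?thesis using bad by metis
next
  case False
  let ?X = "W - {u, v}"
  obtain y where y: "y \<in> ?X" "component ?X y \<noteq> ?X" using not_conn_component[OF bad[OF uv]] by blast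
  define K where "K = component ?X y"
  define R where "R = ?X - K"
  have K: "K \<subseteq> ?X" "y \<in> K" "K \<noteq> ?X" using y component_subset component_self by (auto simp: K_def)
  have att: "conn ({u, v} \<union> component ?X w)" if w: "w \<in> ?X" for w
  proof -
    have "insert u ?X = W - {v}" "insert v ?X = W - {u}" using uv by auto
    then have "conn (insert u (component ?X w))" "conn (insert v (component ?X w))"
      using component_attach[of u ?X w] component_attach[of v ?X w] False uv w by auto
    then have "conn (insert u (component ?X w) \<union> insert v (component ?X w))"
      by (rule conn_Un_common[of _ _ w]) (use component_self[OF w] in auto)
    moreover have "insert u (component ?X w) \<union> insert v (component ?X w) = {u, v} \<union> component ?X w" by auto
    ultimately show ?thesis by simp
  qed
  have cK: "conn ({u, v} \<union> K)" using att y unfolding K_def by blast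
  obtain w0 where w0: "w0 \<in> R" using K by (auto simp: R_def)
  have sub: "{u, v} \<union> component ?X w \<subseteq> {u, v} \<union> R" if w: "w \<in> R" for w
  proof -
    have "component ?X w \<inter> K = {}"
    proof (rule ccontr)
      assume "component ?X w \<inter> K \<noteq> {}"
      then obtain z l m where "walk_between ?X w l z" "walk_between ?X y m z" by (auto simp: K_def component_def)
      then have "w \<in> K" unfolding K_def component_def using walk_between_join walk_between_rev by blast
      then show False using w by (simp add: R_def)
    qed
    then show ?thesis using component_subset[of ?X w] by (auto simp: R_def)
  qed
  have cR: "conn ({u, v} \<union> R)"
  proof (rule connI_root[of _ u])
    fix w assume w: "w \<in> {u, v} \<union> R"
    then obtain w' where w': "w' \<in> R" "w \<in> {u, v} \<union> component ?X w'"
      using w0 component_self[of w ?X] by (auto simp: R_def)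
    then have "w' \<in> ?X" by (simp add: R_def)
    then obtain l where "walk_between ({u, v} \<union> component ?X w') u l w" using att[of w'] w'(2) unfolding conn_def by blast
    then show "\<exists>l. walk_between ({u, v} \<union> R) u l w" using walk_between_mono sub[OF w'(1)] by blast
  qed
  have KR: "\<not> adj a b" if "a \<in> K" "b \<in> R" for a b
    using component_closed[of a ?X y b] that by (auto simp: K_def R_def)
  have W: "W = {u, v} \<union> K \<union> R" using uv K by (auto simp: R_def)
  have bad': "\<not> conn ({u, v} \<union> K \<union> R - {a, b})" if "a \<in> K" "b \<in> R" for a b
  proof -
    have "a \<in> W" "b \<in> W" "a \<noteq> b" using that K by (auto simp: R_def)
    then show ?thesis unfolding W[symmetric] using KR[OF that] by (intro bad)
  qed
  have fin': "finite K" "finite R" using fin K finite_subset by (auto simp: R_def)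
  have dis: "K \<inter> R = {}" "u \<notin> K \<union> R" "v \<notin> K \<union> R" using K by (auto simp: R_def)
  \<comment> \<open>If some \<open>z\<close> in \<open>K\<close> is removable on its own side, then
    by \<open>bad'\<close> no vertex of \<open>R\<close> is, and the roles of \<open>K\<close> and
    \<open>R\<close> can be exchanged.\<close>
  show ?thesis
  proof (cases "\<forall>z\<in>K. \<not> conn ({u, v} \<union> K - {z})")
    case True
    then have "hole ({u, v} \<union> K \<union> R)"
      using hole_of_two_sides[OF fin' dis uv(3) _ _ uv(4) KR cK cR bad'] K w0 by blast
    then show ?thesis using W by simp
  next
    case False
    then obtain z where z: "z \<in> K" "conn ({u, v} \<union> K - {z})" by blast
    have "\<not> conn ({u, v} \<union> R - {b})" if b: "b \<in> R" for b
    proof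
      assume "conn ({u, v} \<union> R - {b})"
      then have "conn (({u, v} \<union> K - {z}) \<union> ({u, v} \<union> R - {b}))"
        by (rule conn_Un_common[OF z(2), of _ u]) (use z b dis in auto)
      moreover have "({u, v} \<union> K - {z}) \<union> ({u, v} \<union> R - {b}) = {u, v} \<union> K \<union> R - {z, b}"
        using z b dis by auto
      ultimately show False using bad'[OF z(1) b] by simp
    qed
    moreover have "R \<inter> K = {}" "u \<notin> R \<union> K" "v \<notin> R \<union> K" using dis by auto
    moreover have "\<not> conn ({u, v} \<union> R \<union> K - {a, b})" if "a \<in> R" "b \<in> K" for a b
      using bad'[OF that(2,1)] by (simp add: insert_commute Un_ac)
    moreover have "\<not> adj a b" if "a \<in> R" "b \<in> K" for a b using KR[OF that(2,1)] adj_sym by blast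
    ultimately have "hole ({u, v} \<union> R \<union> K)"
      using hole_of_two_sides[OF fin'(2,1) _ _ _ uv(3) _ _ uv(4) _ cR cK] K w0 by blast
    then show ?thesis using W by (simp add: Un_ac)
  qed
qed

end

section \<open>Truemper's theorem\<close>

context edge_set
begin

definition hole_sum :: "('a set \<Rightarrow> bit) \<Rightarrow> 'a set \<Rightarrow> bit" where
  "hole_sum \<beta> S = (\<Sum>D\<in>{D. hole D \<and> D \<subseteq> S}. \<beta> D)"

definition balanced :: "('a set \<Rightarrow> bit) \<Rightarrow> 'a set \<Rightarrow> bool" where
  "balanced \<beta> W \<longleftrightarrow> (\<forall>S. solid_set S \<longrightarrow> S \<subseteq> W \<longrightarrow> hole_sum \<beta> S = 0)"

definition labels :: "('a set \<Rightarrow> bit) \<Rightarrow> ('a set \<Rightarrow> bit) \<Rightarrow> 'a set \<Rightarrow> bool" where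
  "labels \<mu> \<beta> W \<longleftrightarrow> (\<forall>D. hole D \<longrightarrow> D \<subseteq> W \<longrightarrow> \<beta> D = label_sum \<mu> D)"

lemma solid_set_hole_sum_label_sum: "solid_set S \<Longrightarrow> finite S \<Longrightarrow> hole_sum (label_sum \<mu>) S = 0"
  unfolding hole_sum_def by (rule even_holes_sum[OF _ solid_set_even])

text \<open>Cuts \<open>X\<close> down to a connected piece that contains \<open>t\<close>, avoids
  \<open>S\<close> and still touches it: the component of \<open>t\<close> in \<open>X - S\<close>,
  which can be left within \<open>X\<close> only into \<open>S\<close>.\<close>

lemma subconn_adjacent:
  assumes "conn X" "S \<subseteq> X" "S \<noteq> {}" "t \<in> X - S"
  obtains Y where "Y \<subseteq> X - S" "conn Y" "t \<in> Y" "\<exists>y\<in>Y. \<exists>s\<in>S. adj y s"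
proof -
  let ?Y = "component (X - S) t"
  have Y: "?Y \<subseteq> X - S" "t \<in> ?Y" using component_subset component_self assms by blast+
  obtain b z where bz: "b \<in> ?Y" "z \<in> X - ?Y" "adj b z"
    by (rule conn_cross[OF assms(1), of ?Y]) (use Y assms in blast)+
  then have "z \<in> S" using component_closed by blast
  then show thesis using that[of ?Y] Y component_conn bz by blast
qed

text \<open>For a hole these are the two open arcs between its nonadjacent vertices \<open>u\<close>
  and \<open>v\<close>.\<close>

definition sides :: "'a \<Rightarrow> 'a \<Rightarrow> 'a set \<Rightarrow> 'a set \<Rightarrow> 'a set \<Rightarrow> bool" where
  "sides u v D A B \<longleftrightarrow> D = {u, v} \<union> A \<union> B \<and> A \<inter> B = {} \<and> u \<notin> A \<union> B \<and> v \<notin> A \<union> B \<and>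
     A \<noteq> {} \<and> B \<noteq> {} \<and> conn A \<and> conn B \<and> (\<forall>a\<in>A. \<forall>b\<in>B. \<not> adj a b)"

lemma sides_sym: "sides u v D A B \<Longrightarrow> sides u v D B A"
proof -
  assume s: "sides u v D A B"
  then have "\<forall>b\<in>B. \<forall>a\<in>A. \<not> adj b a" unfolding sides_def using adj_sym by blast
  then show ?thesis using s unfolding sides_def by (simp add: Un_ac Int_commute)
qed

lemma hole_sides:
  assumes "hole D" "u \<in> D" "v \<in> D" "u \<noteq> v" "\<not> adj u v"
  obtains A B where "sides u v D A B"
proof -
  obtain p where r: "ring u p" "D = insert u (set p)" by (rule hole_rooted[OF assms(1,2)])
  then obtain a b where ab: "p = a @ v # b" using assms split_list[of v p] by auto
  have "v \<noteq> hd p" "v \<noteq> last p" using r assms by (auto simp: ring_def)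
  then have ne: "a \<noteq> []" "b \<noteq> []" using ab by auto
  have i: "ipath a" "ipath b" using r ab by (auto simp: ring_def ipath_append)
  have "sides u v D (set a) (set b)"
    unfolding sides_def using r ab ne conn_walk[OF ipath_walk[OF i(1)]] conn_walk[OF ipath_walk[OF i(2)]]
    by (auto simp: ring_def ipath_append)
  then show thesis by (rule that)
qed

text \<open>If \<open>B'\<close> were a proper part, some \<open>b\<close> in \<open>B'\<close>
  would have a neighbour in \<open>B - B'\<close>. Its two neighbours in \<open>D\<close> lie in
  \<open>{u, v} \<union> B'\<close>, hence in \<open>C\<close>, so \<open>b\<close> would have three
  neighbours in the hole \<open>C\<close>.\<close>

lemma sides_eq:
  assumes C: "hole C" "sides u v C A B" and D: "hole D" "sides u v D A' B'" and sub: "B' \<subseteq> B"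
  shows "B' = B"
proof (rule ccontr)
  assume "B' \<noteq> B"
  then obtain b z where bz: "b \<in> B'" "z \<in> B - B'" "adj b z"
    using conn_cross[of B B'] C(2) D(2) sub unfolding sides_def by metis
  have bD: "b \<in> D" using bz D(2) by (auto simp: sides_def)
  obtain y1 y2 where y: "y1 \<noteq> y2" "y1 \<in> D" "y2 \<in> D" "adj b y1" "adj b y2"
    using hole_nbrs[OF D(1) bD] by metis
  have "y \<in> {u, v} \<union> B'" if "y \<in> D" "adj b y" for y
    using that D(2) bz(1) adj_sym unfolding sides_def by blast
  then have "y1 \<in> {u, v} \<union> B'" "y2 \<in> {u, v} \<union> B'" using y by blast+
  moreover have "{u, v} \<union> B \<subseteq> C" using C(2) by (auto simp: sides_def)
  moreover have "z \<notin> {u, v} \<union> B'" using bz(2) C(2) by (auto simp: sides_def)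
  ultimately have "y1 \<in> C" "y2 \<in> C" "z \<in> C" "b \<in> C" "y1 \<noteq> z" "y2 \<noteq> z" using sub bz by auto
  then show False using hole_three[OF C(1), of b y1 y2 z] y bz by auto
qed

text \<open>Among all wrongly labelled holes \<open>C\<close> and connected sets \<open>Z\<close> joining the two sides of \<open>C\<close>, choose \<open>Z\<close>
  minimal. A solid around \<open>C\<close> inside \<open>C \<union> Z\<close> contains a second wrong hole, whose sides are joined
  by a proper subset of \<open>Z\<close>.\<close>

lemma labels_all:
  assumes fin: "finite W" and uv: "u \<in> W" "v \<in> W" "u \<noteq> v" "\<not> adj u v"
    and conn: "conn (W - {u, v})" and bal: "balanced \<beta> W"
    and ok: "\<And>D. hole D \<Longrightarrow> D \<subseteq> W \<Longrightarrow> u \<notin> D \<or> v \<notin> D \<Longrightarrow> \<beta> D = label_sum \<mu> D"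
  shows "labels \<mu> \<beta> W"
  unfolding labels_def
proof (intro allI impI, rule ccontr)
  fix D0 assume D0: "hole D0" "D0 \<subseteq> W" "\<beta> D0 \<noteq> label_sum \<mu> D0"
  define wr where "wr D \<longleftrightarrow> hole D \<and> D \<subseteq> W \<and> \<beta> D \<noteq> label_sum \<mu> D" for D
  define touch where "touch Z A \<longleftrightarrow> (\<exists>z\<in>Z. \<exists>a\<in>A. adj z a)" for Z A
  define conf where "conf D A B Z \<longleftrightarrow> wr D \<and> sides u v D A B \<and> Z \<subseteq> W - {u, v} \<and> conn Z \<and>
    touch Z A \<and> touch Z B" for D A B Z
  have conf_sym: "conf D B A Z" if "conf D A B Z" for D A B Z
    using that sides_sym unfolding conf_def by blast
  have wr_sides: "\<exists>A B. sides u v D A B" if "wr D" for D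
  proof -
    have "u \<in> D" "v \<in> D" using ok that unfolding wr_def by blast+
    then show ?thesis using hole_sides[of D u v] that uv unfolding wr_def by metis
  qed
  have "\<exists>D A B Z. conf D A B Z"
  proof -
    have w: "wr D0" using D0 by (simp add: wr_def)
    then obtain A B where s: "sides u v D0 A B" using wr_sides by blast
    have AB: "A \<subseteq> W - {u, v}" "B \<subseteq> W - {u, v}" "A \<noteq> {}" "B \<noteq> {}" "A \<inter> B = {}"
      using s D0(2) by (auto simp: sides_def)
    have t: "touch (W - {u, v}) A'" if A': "A' \<subseteq> W - {u, v}" "A' \<noteq> {}" "A' \<noteq> W - {u, v}" for A'
    proof -
      obtain b z where "b \<in> A'" "z \<in> W - {u, v} - A'" "adj b z" by (rule conn_cross[OF conn A'])
      then show ?thesis unfolding touch_def using adj_sym by blast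
    qed
    have "touch (W - {u, v}) A" "touch (W - {u, v}) B" by (rule t; use AB in blast)+
    then have "conf D0 A B (W - {u, v})" using w s conn by (simp add: conf_def)
    then show ?thesis by blast
  qed
  then have "\<exists>n D A B Z. conf D A B Z \<and> card Z = n" by blast
  then obtain n where n: "\<exists>D A B Z. conf D A B Z \<and> card Z = n"
    and least: "\<And>m. m < n \<Longrightarrow> \<not> (\<exists>D A B Z. conf D A B Z \<and> card Z = m)"
    using exists_least_iff[of "\<lambda>n. \<exists>D A B Z. conf D A B Z \<and> card Z = n"] by blast
  then obtain C A B Z where cf: "conf C A B Z" "card Z = n" by blast
  have Z: "Z \<subseteq> W - {u, v}" "conn Z" "finite Z" using cf fin finite_subset unfolding conf_def by blast+
  have min: False if "conf D A' B' Y" "Y \<subset> Z" for D A' B' Y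
    using least[of "card Y"] that psubset_card_mono[OF Z(3) that(2)] cf(2) by blast
  \<comment> \<open>Otherwise a smaller part of \<open>Z\<close>, avoiding \<open>A\<close> but
    still touching it, would do. By \<open>conf_sym\<close> the same holds for
    \<open>B\<close>.\<close>
  have disj: "Z \<inter> A = {}" if c: "conf C A B Z" for A B
  proof (rule ccontr)
    assume ne: "Z \<inter> A \<noteq> {}"
    obtain t b where t: "t \<in> Z" "b \<in> B" "adj t b" using c by (auto simp: conf_def touch_def)
    then have "t \<notin> A" using c by (auto simp: conf_def sides_def)
    then obtain Y where Y: "Y \<subseteq> Z - (Z \<inter> A)" "conn Y" "t \<in> Y" "\<exists>y\<in>Y. \<exists>s\<in>Z \<inter> A. adj y s"
      using subconn_adjacent[OF Z(2) _ ne, of t] t(1) by blast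
    then have "conf C A B Y" using c t Z(1) unfolding conf_def touch_def by blast
    moreover have "Y \<subset> Z" using Y ne by blast
    ultimately show False by (rule min)
  qed
  have C: "hole C" "sides u v C A B" "C \<subseteq> W" "wr C" using cf(1) by (auto simp: conf_def wr_def)
  have ZC: "Z \<inter> C = {}"
    using disj[OF cf(1)] disj[OF conf_sym[OF cf(1)]] Z(1) C(2) unfolding sides_def by blast
  obtain z a z' b where zz: "z \<in> Z" "a \<in> A" "adj z a" "z' \<in> Z" "b \<in> B" "adj z' b"
    using cf(1) unfolding conf_def touch_def by blast
  have "a \<in> C" "b \<in> C" "a \<noteq> b" "\<not> adj a b" using C(2) zz by (auto simp: sides_def)
  then obtain S where S: "solid_graph (S, induced_edges S)" "C \<subseteq> S" "S \<subseteq> C \<union> Z"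
    using solid_around_hole[OF C(1) Z(2) ZC, of a b z z'] zz by metis
  have SW: "S \<subseteq> W" "finite S" using S C(3) Z(1) fin finite_subset[of S W] by blast+
  have sS: "solid_set S" by (rule solid_graph_solid_set[OF S(1)])
  \<comment> \<open>Both \<open>\<beta>\<close> and \<open>label_sum \<mu>\<close> sum to zero over
    the holes of \<open>S\<close>, so the error cannot be concentrated in \<open>C\<close>
    alone.\<close>
  have "\<exists>D. wr D \<and> D \<subseteq> S \<and> D \<noteq> C"
  proof (rule ccontr)
    assume "\<not> ?thesis"
    then have *: "\<beta> D = label_sum \<mu> D" if "hole D" "D \<subseteq> S" "D \<noteq> C" for D
      using that SW unfolding wr_def by blast
    let ?H = "{D. hole D \<and> D \<subseteq> S}"
    have f: "finite ?H" "C \<in> ?H" using finite_holes[OF SW(2)] C S by auto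
    have "hole_sum \<beta> S = 0" using bal sS SW by (simp add: balanced_def)
    moreover have "hole_sum (label_sum \<mu>) S = 0" by (rule solid_set_hole_sum_label_sum[OF sS SW(2)])
    moreover have "hole_sum \<beta> S = \<beta> C + sum \<beta> (?H - {C})" "hole_sum (label_sum \<mu>) S = label_sum \<mu> C + sum (label_sum \<mu>) (?H - {C})"
      unfolding hole_sum_def by (rule sum.remove[OF f])+
    moreover have "sum \<beta> (?H - {C}) = sum (label_sum \<mu>) (?H - {C})" using * by (intro sum.cong) auto
    ultimately have "\<beta> C = label_sum \<mu> C" by (metis add_right_cancel)
    then show False using C(4) by (simp add: wr_def)
  qed
  then obtain D where D: "wr D" "D \<subseteq> C \<union> Z" "D \<noteq> C" using S(3) by blast
  then have hD: "hole D" by (simp add: wr_def)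
  have DZ: "D \<inter> Z \<noteq> {}" using hole_subset_hole[OF hD C(1)] D by blast
  \<comment> \<open>A side of \<open>D\<close> inside a side of \<open>C\<close> is all of it. So
    \<open>D\<close> meets \<open>Z\<close> in its other side \<open>A'\<close> only, and the part
    of \<open>Z\<close> that avoids \<open>A'\<close> contains a smaller set joining the two sides
    of \<open>D\<close>.\<close>
  have key: False if s: "sides u v D A' B'" and cs: "conf C A B Z" and sub: "B' \<subseteq> B" for A' B' A B
  proof -
    have eq: "B' = B" by (rule sides_eq[OF C(1) _ hD s sub]) (use cs in \<open>auto simp: conf_def\<close>)
    have BZ: "B \<inter> Z = {}" using disj[OF conf_sym[OF cs]] by blast
    have ne: "Z \<inter> A' \<noteq> {}" using DZ s eq BZ Z(1) unfolding sides_def by blast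
    obtain t b where t: "t \<in> Z" "b \<in> B" "adj t b" using cs by (auto simp: conf_def touch_def)
    then have "t \<notin> A'" using s eq by (auto simp: sides_def)
    then obtain Y where Y: "Y \<subseteq> Z - (Z \<inter> A')" "conn Y" "t \<in> Y" "\<exists>y\<in>Y. \<exists>s\<in>Z \<inter> A'. adj y s"
      using subconn_adjacent[OF Z(2) _ ne, of t] t(1) by blast
    then have "conf D A' B' Y" using D(1) s t eq Z(1) unfolding conf_def touch_def by blast
    moreover have "Y \<subset> Z" using Y ne by blast
    ultimately show False by (rule min)
  qed
  obtain A' B' where s: "sides u v D A' B'" using wr_sides[OF D(1)] by blast
  \<comment> \<open>A side of \<open>D\<close> that avoids \<open>Z\<close> lies in
    \<open>A \<union> B\<close> and, being connected, within one of the two arcs.\<close>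
  have half: False if s: "sides u v D A' B'" and B'Z: "B' \<inter> Z = {}" for A' B'
  proof -
    have B': "B' \<subseteq> A \<union> B" "conn B'" "B' \<noteq> {}" using s B'Z D(2) C(2) unfolding sides_def by blast+
    have "B' \<subseteq> A \<or> B' \<subseteq> B"
    proof (rule ccontr)
      assume "\<not> ?thesis"
      then have "B' \<inter> A \<noteq> {}" "B' \<inter> A \<noteq> B'" using B' by blast+
      then obtain x y where "x \<in> B' \<inter> A" "y \<in> B' - B' \<inter> A" "adj x y"
        using conn_cross[OF B'(2), of "B' \<inter> A"] by blast
      then show False using B'(1) C(2) unfolding sides_def by blast
    qed
    then show False using key[OF s cf(1)] key[OF s conf_sym[OF cf(1)]] by blast
  qed
  have ne: "A' \<inter> Z \<noteq> {}" "B' \<inter> Z \<noteq> {}" using half[OF s] half[OF sides_sym[OF s]] by blast+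
  then obtain t where t: "t \<in> Z" "t \<in> B'" by blast
  have tA: "t \<in> Z - Z \<inter> A'" using t s unfolding sides_def by blast
  \<comment> \<open>Both sides of \<open>D\<close> now meet \<open>Z\<close>. Cutting
    \<open>Z\<close> back twice gives a connected set that avoids both sides and touches each of
    them.\<close>
  obtain Y1 where Y1: "Y1 \<subseteq> Z - Z \<inter> A'" "conn Y1" "t \<in> Y1" "\<exists>y\<in>Y1. \<exists>s\<in>Z \<inter> A'. adj y s"
  proof (rule subconn_adjacent[OF Z(2) _ _ tA])
    show "Z \<inter> A' \<subseteq> Z" by blast
    show "Z \<inter> A' \<noteq> {}" using ne by blast
  qed
  then obtain y x where y: "y \<in> Y1" "x \<in> A'" "adj y x" by blast
  have "y \<notin> B'" using s y adj_sym[of y x] unfolding sides_def by blast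
  then have yB: "y \<in> Y1 - Y1 \<inter> B'" using y by blast
  obtain Y where Y: "Y \<subseteq> Y1 - Y1 \<inter> B'" "conn Y" "y \<in> Y" "\<exists>y\<in>Y. \<exists>s\<in>Y1 \<inter> B'. adj y s"
  proof (rule subconn_adjacent[OF Y1(2) _ _ yB])
    show "Y1 \<inter> B' \<subseteq> Y1" by blast
    show "Y1 \<inter> B' \<noteq> {}" using t Y1(3) by blast
  qed
  have "conf D A' B' Y" using D(1) s Y Y1 y Z(1) unfolding conf_def touch_def by blast
  moreover have "Y \<subset> Z" using Y Y1 ne by blast
  ultimately show False by (rule min)
qed

section \<open>The special cases and the induction for Truemper's theorem\<close>

lemma label_sum_triangle:
  assumes "adj a b" "adj b c" "adj a c"
  shows "label_sum \<mu> {a, b, c} = \<mu> {a, b} + \<mu> {b, c} + \<mu> {a, c}"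
proof -
  have "ring a [b, c]" using assms by (auto simp: ring_def)
  then show ?thesis using label_sum_ring[of a "[b, c]" \<mu>] by (simp add: insert_commute add_ac)
qed

lemma labels_disconnected:
  assumes "B \<subseteq> W" "\<And>a b. a \<in> B \<Longrightarrow> b \<in> W - B \<Longrightarrow> \<not> adj a b"
    "labels \<mu> \<beta> B" "labels \<nu> \<beta> (W - B)"
  shows "\<exists>\<rho>. labels \<rho> \<beta> W"
proof -
  define \<rho> where "\<rho> e = (if e \<subseteq> B then \<mu> e else \<nu> e)" for e
  have "\<beta> D = label_sum \<rho> D" if D: "hole D" "D \<subseteq> W" for D
  proof -
    have "D \<subseteq> B \<or> D \<subseteq> W - B"
    proof (rule ccontr)
      assume "\<not> ?thesis"
      then have "D \<inter> B \<noteq> {}" "D \<inter> B \<noteq> D" using D by blast+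
      then obtain x y where "x \<in> D \<inter> B" "y \<in> D - D \<inter> B" "adj x y"
        using conn_cross[OF hole_conn[OF D(1)], of "D \<inter> B"] by blast
      then show False using assms(2)[of x y] D(2) by blast
    qed
    then show ?thesis
    proof
      assume "D \<subseteq> B"
      moreover from this have "label_sum \<rho> D = label_sum \<mu> D" by (intro label_sum_cong) (auto simp: \<rho>_def)
      ultimately show ?thesis using assms(3) D by (simp add: labels_def)
    next
      assume "D \<subseteq> W - B"
      moreover from this have "label_sum \<rho> D = label_sum \<nu> D" by (intro label_sum_cong) (auto simp: \<rho>_def)
      ultimately show ?thesis using assms(4) D by (simp add: labels_def)
    qed
  qed
  then show ?thesis unfolding labels_def by blast
qed

text \<open>Cone over \<open>r\<close>: edges at \<open>r\<close> get 0, and any other edge gets the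
  value of its triangle with \<open>r\<close>. Holes of a complete graph are triangles; for a
  triangle avoiding \<open>r\<close>, the required equation is the condition of the four-vertex
  wheel with hub \<open>r\<close>.\<close>

lemma labels_complete:
  assumes fin: "finite W" and complete: "\<And>x y. x \<in> W \<Longrightarrow> y \<in> W \<Longrightarrow> x \<noteq> y \<Longrightarrow> adj x y"
    and bal: "balanced \<beta> W"
  shows "\<exists>\<mu>. labels \<mu> \<beta> W"
proof (cases "W = {}")
  case True
  then have "labels (\<lambda>_. 0) \<beta> W" by (auto simp: labels_def hole_def)
  then show ?thesis by blast
next
  case False
  then obtain r where r: "r \<in> W" by blast
  have tri: "\<exists>a b c. D = {a, b, c} \<and> a \<noteq> b \<and> b \<noteq> c \<and> a \<noteq> c" if D: "hole D" "D \<subseteq> W" "x \<in> D" for D x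
  proof -
    obtain p where p: "ring x p" "D = insert x (set p)" by (rule hole_rooted[OF D(1,3)])
    have "z = hd p \<or> z = last p" if "z \<in> set p" for z
      using complete[of x z] that p D by (auto simp: ring_def)
    moreover have "p \<noteq> []" using p by (auto simp: ring_def)
    ultimately have "set p = {hd p, last p}" by auto
    then have "D = {x, hd p, last p}" using p by simp
    moreover have "hd p \<noteq> last p" by (rule ring_hd_neq_last[OF p(1)])
    moreover have "hd p \<in> set p" "last p \<in> set p" "x \<notin> set p" using p(1) \<open>p \<noteq> []\<close> by (auto simp: ring_def)
    then have "x \<noteq> hd p" "x \<noteq> last p" by auto
    ultimately show ?thesis by blast
  qed
  define \<mu> where "\<mu> e = (if r \<in> e then 0 else \<beta> (insert r e))" for e
  have "\<beta> D = label_sum \<mu> D" if D: "hole D" "D \<subseteq> W" for D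
  proof (cases "r \<in> D")
    case True
    have "D - {r} \<subseteq> W" using D by blast
    obtain p where p: "ring r p" "D = insert r (set p)" by (rule hole_rooted[OF D(1) True])
    have "z = hd p \<or> z = last p" if "z \<in> set p" for z
      using complete[of r z] that p D by (auto simp: ring_def)
    moreover have "p \<noteq> []" using p by (auto simp: ring_def)
    ultimately have sp: "set p = {hd p, last p}" by auto
    have "hd p \<in> set p" "last p \<in> set p" "r \<notin> set p" using p(1) \<open>p \<noteq> []\<close> by (auto simp: ring_def)
    then have h: "hd p \<noteq> last p" "r \<noteq> hd p" "r \<noteq> last p" using ring_hd_neq_last[OF p(1)] by auto
    have W: "hd p \<in> W" "last p \<in> W" using sp p(2) D(2) by auto
    have D3: "D = {r, hd p, last p}" using p(2) sp by simp
    have "label_sum \<mu> D = \<mu> {r, hd p} + \<mu> {hd p, last p} + \<mu> {r, last p}"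
      unfolding D3 by (rule label_sum_triangle) (use complete W r h in auto)
    also have "\<dots> = \<beta> D" using h D3 by (simp add: \<mu>_def)
    finally show ?thesis by simp
  next
    case False
    obtain x where "x \<in> D" using D(1) by (auto simp: hole_def)
    then obtain a b c where abc: "D = {a, b, c}" "a \<noteq> b" "b \<noteq> c" "a \<noteq> c" using tri[OF D] by blast
    have n: "r \<noteq> a" "r \<noteq> b" "r \<noteq> c" using False abc by auto
    have W: "a \<in> W" "b \<in> W" "c \<in> W" using abc D by auto
    note ad = complete[OF W(1,2) abc(2)] complete[OF W(2,3) abc(3)] complete[OF W(1,3) abc(4)]
      complete[OF r W(1) n(1)] complete[OF r W(2) n(2)] complete[OF r W(3) n(3)]
    let ?S = "{r, a, b, c}"
    have N: "{z \<in> {a, b, c}. adj r z} = {a, b, c}" using ad by auto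
    have "wheel ?S"
      unfolding wheel_def
    proof (intro exI conjI)
      show "hole {a, b, c}" using hole_triangle ad by blast
      show "r \<notin> {a, b, c}" using n by auto
      show "3 \<le> card {z \<in> {a, b, c}. adj r z}" unfolding N using abc by simp
    qed simp
    then have "solid_set ?S" by (intro solid_graph_solid_set) (simp add: solid_graph_iff)
    then have z: "hole_sum \<beta> ?S = 0" using bal W r by (simp add: balanced_def)
    have "{D. hole D \<and> D \<subseteq> ?S} = {{a, b, c}, {r, b, c}, {r, a, c}, {r, a, b}}"
    proof (intro equalityI subsetI)
      fix X assume X: "X \<in> {D. hole D \<and> D \<subseteq> ?S}"
      then obtain x where x: "x \<in> X" by (auto simp: hole_def)
      have XW: "X \<subseteq> W" using X W r by auto
      obtain x1 x2 x3 where xs: "X = {x1, x2, x3}" "x1 \<noteq> x2" "x2 \<noteq> x3" "x1 \<noteq> x3"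
        using tri[of X x] X XW x by blast
      have "card X = 3" using xs by simp
      have "X \<noteq> ?S"
      proof
        assume "X = ?S"
        then show False using \<open>card X = 3\<close> n abc by simp
      qed
      then consider "r \<notin> X" | "a \<notin> X" | "b \<notin> X" | "c \<notin> X" using X by blast
      then show "X \<in> {{a, b, c}, {r, b, c}, {r, a, c}, {r, a, b}}"
      proof cases
        case 1
        then have "X \<subseteq> {a, b, c}" using X by blast
        then have "X = {a, b, c}" by (rule card_subset_eq[rotated]) (use \<open>card X = 3\<close> abc in auto)
        then show ?thesis by simp
      next
        case 2
        then have "X \<subseteq> {r, b, c}" using X by blast
        then have "X = {r, b, c}" by (rule card_subset_eq[rotated]) (use \<open>card X = 3\<close> abc n in auto)
        then show ?thesis by simp
      next
        case 3
        then have "X \<subseteq> {r, a, c}" using X by blast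
        then have "X = {r, a, c}" by (rule card_subset_eq[rotated]) (use \<open>card X = 3\<close> abc n in auto)
        then show ?thesis by simp
      next
        case 4
        then have "X \<subseteq> {r, a, b}" using X by blast
        then have "X = {r, a, b}" by (rule card_subset_eq[rotated]) (use \<open>card X = 3\<close> abc n in auto)
        then show ?thesis by simp
      qed
    next
      fix X assume "X \<in> {{a, b, c}, {r, b, c}, {r, a, c}, {r, a, b}}"
      moreover have "hole {a, b, c}" "hole {r, b, c}" "hole {r, a, c}" "hole {r, a, b}"
        by (rule hole_triangle; rule ad)+
      ultimately show "X \<in> {D. hole D \<and> D \<subseteq> ?S}" by auto
    qed
    moreover have "{a, b, c} \<noteq> {r, b, c}" "{a, b, c} \<noteq> {r, a, c}" "{a, b, c} \<noteq> {r, a, b}"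
      "{r, b, c} \<noteq> {r, a, c}" "{r, b, c} \<noteq> {r, a, b}" "{r, a, c} \<noteq> {r, a, b}"
    proof -
      have "a \<notin> {r, b, c}" "b \<notin> {r, a, c}" "c \<notin> {r, a, b}" using n abc by auto
      then show "{a, b, c} \<noteq> {r, b, c}" "{a, b, c} \<noteq> {r, a, c}" "{a, b, c} \<noteq> {r, a, b}"
        "{r, b, c} \<noteq> {r, a, c}" "{r, b, c} \<noteq> {r, a, b}" "{r, a, c} \<noteq> {r, a, b}"
        by (metis insertI1 insertI2)+
    qed
    ultimately have "hole_sum \<beta> ?S = \<beta> {a, b, c} + (\<beta> {r, b, c} + (\<beta> {r, a, c} + \<beta> {r, a, b}))"
      unfolding hole_sum_def by simp
    then have "\<beta> {a, b, c} = \<beta> {r, b, c} + (\<beta> {r, a, c} + \<beta> {r, a, b})"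
      using z bit_add_eq_0_iff by metis
    moreover have "label_sum \<mu> D = \<mu> {a, b} + \<mu> {b, c} + \<mu> {a, c}"
      unfolding abc(1) by (rule label_sum_triangle) (rule ad)+
    moreover have "\<mu> {a, b} = \<beta> {r, a, b}" "\<mu> {b, c} = \<beta> {r, b, c}" "\<mu> {a, c} = \<beta> {r, a, c}"
      using n by (auto simp: \<mu>_def)
    ultimately show ?thesis using abc(1) by (simp add: add_ac)
  qed
  then show ?thesis unfolding labels_def by blast
qed

text \<open>\<open>W\<close> is the only hole in \<open>W\<close>, so one of its edges can carry the
  whole value.\<close>

lemma labels_hole:
  assumes "hole W"
  shows "\<exists>\<mu>. labels \<mu> \<beta> W"
proof -
  obtain x p where r: "ring x p" "W = insert x (set p)" using assms by (auto simp: hole_def)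
  then have e: "{x, hd p} \<in> induced_edges W" using induced_edges_ring[OF r(1)] by simp
  define \<mu> where "\<mu> d = (if d = {x, hd p} then \<beta> W else 0)" for d
  have "label_sum \<mu> W = \<beta> W"
    unfolding label_sum_def \<mu>_def using e finite_induced_edges[OF hole_finite[OF assms]] by simp
  then have "labels \<mu> \<beta> W"
    unfolding labels_def using hole_subset_hole[OF _ assms] by metis
  then show ?thesis by blast
qed

text \<open>Induction on the size of \<open>W\<close>. The gluing case has a nonadjacent pair
  \<open>u\<close>, \<open>v\<close> with \<open>W - {u, v}\<close> connected; without such a pair,
  \<open>nonadjacent_noncut_pair\<close> leaves a disconnected set, a complete one or a
  hole.\<close>

theorem truemper:
  assumes "finite W" "balanced \<beta> W"
  shows "\<exists>\<mu>. labels \<mu> \<beta> W"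
  using assms
proof (induction "card W" arbitrary: W rule: less_induct)
  case less
  have sub: "\<exists>\<mu>. labels \<mu> \<beta> X" if "X \<subset> W" for X
    using less.hyps[OF psubset_card_mono[OF less.prems(1) that]] that less.prems
      finite_subset[of X W] unfolding balanced_def by blast
  consider "\<not> conn W" | "conn W" "\<And>x y. x \<in> W \<Longrightarrow> y \<in> W \<Longrightarrow> x \<noteq> y \<Longrightarrow> adj x y" |
    u v where "conn W" "u \<in> W" "v \<in> W" "u \<noteq> v" "\<not> adj u v" "hole W" |
    u v where "u \<in> W" "v \<in> W" "u \<noteq> v" "\<not> adj u v" "conn (W - {u, v})"
    using nonadjacent_noncut_pair[OF less.prems(1)] by metis
  then show ?case
  proof cases
    case 1
    then obtain y where y: "y \<in> W" "component W y \<noteq> W" using not_conn_component by blast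
    have s: "component W y \<subseteq> W" "y \<in> component W y" using component_subset component_self y by auto
    then obtain \<mu> where \<mu>: "labels \<mu> \<beta> (component W y)" using sub[of "component W y"] y by blast
    have "W - component W y \<subset> W" using s by blast
    then obtain \<nu> where \<nu>: "labels \<nu> \<beta> (W - component W y)" using sub by blast
    show ?thesis by (rule labels_disconnected[OF s(1) _ \<mu> \<nu>]) (use component_closed in blast)
  next
    case 2
    then show ?thesis using labels_complete less.prems by blast
  next
    case 3
    then show ?thesis using labels_hole by blast
  next
    case (4 u v)
    obtain \<mu> where \<mu>: "labels \<mu> \<beta> (W - {u})" using sub[of "W - {u}"] 4 by blast
    obtain \<nu> where \<nu>: "labels \<nu> \<beta> (W - {v})" using sub[of "W - {v}"] 4 by blast
    have "zero_on (W - {u, v}) (\<lambda>e. \<mu> e + \<nu> e)"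
      unfolding zero_on_def
    proof (intro allI impI)
      fix D assume D: "hole D" "D \<subseteq> W - {u, v}"
      then have "\<beta> D = label_sum \<mu> D" "\<beta> D = label_sum \<nu> D" using \<mu> \<nu> unfolding labels_def by blast+
      then show "label_sum (\<lambda>e. \<mu> e + \<nu> e) D = 0" by (simp add: label_sum_add)
    qed
    then obtain p where p: "\<And>x y. x \<in> W - {u, v} \<Longrightarrow> y \<in> W - {u, v} \<Longrightarrow> adj x y \<Longrightarrow> \<mu> {x, y} + \<nu> {x, y} = p x + p y"
      using potential_exists[OF 4(5)] by blast
    \<comment> \<open>On edges avoiding \<open>u\<close> this is \<open>\<mu>\<close>, and on
      \<open>W - {v}\<close> it differs from \<open>\<nu>\<close> by the coboundary of
      \<open>q\<close>, which is \<open>p\<close> with value 0 at \<open>u\<close>. So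
      \<open>\<rho>\<close> is right on every hole that misses \<open>u\<close> or \<open>v\<close>,
      and \<open>labels_all\<close> takes care of the others.\<close>
    define \<rho> where "\<rho> e = (if u \<in> e then \<nu> e + (\<Sum>x\<in>e - {u}. p x) else \<mu> e)" for e
    define q where "q = p(u := 0)"
    have "\<beta> D = label_sum \<rho> D" if D: "hole D" "D \<subseteq> W" "u \<notin> D \<or> v \<notin> D" for D
    proof (cases "u \<in> D")
      case False
      then have "label_sum \<rho> D = label_sum \<mu> D" by (intro label_sum_cong) (auto simp: \<rho>_def)
      moreover have "D \<subseteq> W - {u}" using D(2) False by blast
      ultimately show ?thesis using \<mu> D(1) unfolding labels_def by simp
    next
      case True
      then have v: "v \<notin> D" using D by blast
      have "\<rho> {x, y} + \<nu> {x, y} = q x + q y" if xy: "x \<in> D" "y \<in> D" "adj x y" for x y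
      proof -
        have ne: "x \<noteq> y" using xy by auto
        consider "x = u" "y \<noteq> u" | "y = u" "x \<noteq> u" | "x \<noteq> u" "y \<noteq> u" using ne by blast
        then show ?thesis
        proof cases
          case 1
          then have "{x, y} - {u} = {y}" by auto
          then show ?thesis using 1 by (simp add: \<rho>_def q_def add_ac)
        next
          case 2
          then have "{x, y} - {u} = {x}" by auto
          then show ?thesis using 2 by (simp add: \<rho>_def q_def add_ac)
        next
          case 3
          then show ?thesis using p[of x y] xy D v by (auto simp: \<rho>_def q_def)
        qed
      qed
      then have "label_sum (\<lambda>e. \<rho> e + \<nu> e) D = 0"
        by (rule label_sum_potential[OF D(1), of "\<lambda>e. \<rho> e + \<nu> e" q])
      then have "label_sum \<rho> D = label_sum \<nu> D" by (simp add: label_sum_add bit_add_eq_0_iff)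
      moreover have "D \<subseteq> W - {v}" using D(2) v by blast
      ultimately show ?thesis using \<nu> D(1) unfolding labels_def by simp
    qed
    then have "labels \<rho> \<beta> W" by (rule labels_all[OF less.prems(1) 4(1-5) less.prems(2)])
    then show ?thesis by blast
  qed
qed

section \<open>Edges crossing between two vertex sets\<close>

lemma labels_mono: "labels \<mu> \<beta> W \<Longrightarrow> X \<subseteq> W \<Longrightarrow> labels \<mu> \<beta> X"
  unfolding labels_def by blast

definition cross :: "'a set \<Rightarrow> 'a set \<Rightarrow> 'a set \<Rightarrow> bit" where
  "cross X Y e = (if e \<inter> X \<noteq> {} \<and> e \<inter> Y \<noteq> {} then 1 else 0)"

lemma walk_sum_zero_edges:
  assumes "walk_between W x l y" "\<And>a b. a \<in> W \<Longrightarrow> b \<in> W \<Longrightarrow> adj a b \<Longrightarrow> \<mu> {a, b} = 0"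
  shows "walk_sum \<mu> l = 0"
  using walk_sum_potential[of l W \<mu> "\<lambda>_. 0"] assms by (simp add: walk_between_def)

text \<open>The walk stays in \<open>X\<close> up to \<open>a\<close>, uses the edge to
  \<open>b\<close> and then stays in \<open>Y\<close>, so it crosses exactly once.\<close>

lemma link_exists:
  assumes "conn X" "conn Y" "X \<inter> Y = {}" "a \<in> X" "b \<in> Y" "adj a b" "r \<in> X" "s \<in> Y"
  shows "\<exists>l. walk_between (X \<union> Y) r l s \<and> walk_sum (cross X Y) l = 1"
proof -
  obtain l where l: "walk_between X r l a" using assms unfolding conn_def by blast
  obtain m where m: "walk_between Y b m s" using assms unfolding conn_def by blast
  have "walk_sum (cross X Y) l = 0" "walk_sum (cross X Y) m = 0"
    by (rule walk_sum_zero_edges[OF l], use assms(3) in \<open>auto simp: cross_def\<close>)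
      (rule walk_sum_zero_edges[OF m], use assms(3) in \<open>auto simp: cross_def\<close>)
  moreover have "cross X Y {last l, hd m} = 1" using l m assms by (auto simp: cross_def walk_between_def)
  ultimately have "walk_sum (cross X Y) (l @ m) = 1" using l m by (simp add: walk_sum_append walk_between_def)
  moreover have "walk_between (X \<union> Y) r (l @ m) s"
    using l m assms(6) by (auto simp: walk_between_def successively_append_iff)
  ultimately show ?thesis by blast
qed

text \<open>Inside \<open>X \<union> Y\<close> the labelling is the coboundary of the indicator of
  \<open>X\<close>, that is, a cut; a hole that misses \<open>X\<close> or \<open>Y\<close> has no
  edge between them.\<close>

lemma label_sum_cross_zero:
  assumes "hole D" "X \<inter> Y = {}" "D \<subseteq> X \<union> Y \<or> D \<inter> X = {} \<or> D \<inter> Y = {}"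
  shows "label_sum (cross X Y) D = 0"
proof (cases "D \<subseteq> X \<union> Y")
  case True
  show ?thesis
    by (rule label_sum_potential[OF assms(1), of _ "\<lambda>x. if x \<in> X then 1 else 0"])
      (use True assms(2) in \<open>auto simp: cross_def\<close>)
next
  case False
  show ?thesis
    by (rule label_sum_potential[OF assms(1), of _ "\<lambda>_. 0"]) (use False assms(3) in \<open>auto simp: cross_def\<close>)
qed

lemma hole_sum_add: "hole_sum (\<lambda>D. \<beta> D + \<gamma> D) S = hole_sum \<beta> S + hole_sum \<gamma> S"
  by (simp add: hole_sum_def sum.distrib)

lemma hole_sum_sum: "hole_sum (\<lambda>D. \<Sum>i\<in>I. \<beta> i D) S = (\<Sum>i\<in>I. hole_sum (\<beta> i) S)"
  unfolding hole_sum_def by (rule sum.swap)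

end

section \<open>Complete minors\<close>

text \<open>The roots \<open>r i\<close> and walks \<open>w i j\<close> map the edges of a simplex
  with \<open>n\<close> vertices into the graph. Each walk stays in its two parts and crosses
  between them an odd number of times; by \<open>link_rev\<close>, sums along it do not depend on
  the direction.\<close>

locale linked_parts = edge_set E for E :: "'a set set" +
  fixes B :: "nat \<Rightarrow> 'a set" and r :: "nat \<Rightarrow> 'a" and w :: "nat \<Rightarrow> nat \<Rightarrow> 'a list" and n :: nat
  assumes finite_part: "i < n \<Longrightarrow> finite (B i)"
    and disjoint_parts: "i < n \<Longrightarrow> j < n \<Longrightarrow> i \<noteq> j \<Longrightarrow> B i \<inter> B j = {}"
    and link: "i < n \<Longrightarrow> j < n \<Longrightarrow> i \<noteq> j \<Longrightarrow> walk_between (B i \<union> B j) (r i) (w i j) (r j)"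
    and link_rev: "i < n \<Longrightarrow> j < n \<Longrightarrow> i \<noteq> j \<Longrightarrow> w j i = rev (w i j)"
    and link_cross: "i < n \<Longrightarrow> j < n \<Longrightarrow> i \<noteq> j \<Longrightarrow> walk_sum (cross (B i) (B j)) (w i j) = 1"
begin

text \<open>The labels summed around the closed walk that bounds the triangle \<open>i j k\<close>
  of the simplex.\<close>

definition hat :: "('a set \<Rightarrow> bit) \<Rightarrow> nat \<Rightarrow> nat \<Rightarrow> nat \<Rightarrow> bit" where
  "hat \<mu> i j k = walk_sum \<mu> (w i j) + walk_sum \<mu> (w j k) + walk_sum \<mu> (w i k)"

text \<open>For hole values \<open>\<beta>\<close> that come from edge labels on the three parts,
  this is the value on the boundary of the triangle \<open>i j k\<close>. Two such labellings differ
  by one that vanishes on all holes there, so the choice does not matter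
  (\<open>circulation_eq\<close>); on other triples the value is arbitrary.\<close>

definition circulation :: "('a set \<Rightarrow> bit) \<Rightarrow> nat \<Rightarrow> nat \<Rightarrow> nat \<Rightarrow> bit" where
  "circulation \<beta> i j k = hat (SOME \<mu>. labels \<mu> \<beta> (B i \<union> B j \<union> B k)) i j k"

lemma hat_zero:
  assumes "i < n" "j < n" "k < n" "i \<noteq> j" "j \<noteq> k" "i \<noteq> k" "zero_on (B i \<union> B j \<union> B k) \<mu>"
  shows "hat \<mu> i j k = 0"
proof -
  have 1: "walk_between (B i \<union> B j \<union> B k) (r i) (w i j) (r j)" by (rule walk_between_mono[OF link]) (use assms in auto)
  have 2: "walk_between (B i \<union> B j \<union> B k) (r j) (w j k) (r k)" by (rule walk_between_mono[OF link]) (use assms in auto)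
  have 3: "walk_between (B i \<union> B j \<union> B k) (r i) (w i k) (r k)" by (rule walk_between_mono[OF link]) (use assms in auto)
  have "walk_sum \<mu> (w i j @ tl (w j k)) = walk_sum \<mu> (w i k)" by (rule walk_sum_walk_between_unique[OF assms(7) walk_between_join[OF 1 2] 3])
  then show ?thesis using walk_sum_walk_between_join[OF 1 2, of \<mu>] by (simp add: hat_def)
qed

lemma circulation_eq:
  assumes "i < n" "j < n" "k < n" "i \<noteq> j" "j \<noteq> k" "i \<noteq> k" "labels \<mu> \<beta> (B i \<union> B j \<union> B k)"
  shows "circulation \<beta> i j k = hat \<mu> i j k"
proof -
  define \<nu> where "\<nu> = (SOME \<mu>. labels \<mu> \<beta> (B i \<union> B j \<union> B k))"
  have \<nu>: "labels \<nu> \<beta> (B i \<union> B j \<union> B k)"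
    unfolding \<nu>_def by (rule someI[where P = "\<lambda>\<mu>. labels \<mu> \<beta> (B i \<union> B j \<union> B k)", OF assms(7)])
  have "zero_on (B i \<union> B j \<union> B k) (\<lambda>e. \<nu> e + \<mu> e)"
    unfolding zero_on_def
  proof (intro allI impI)
    fix D assume D: "hole D" "D \<subseteq> B i \<union> B j \<union> B k"
    then have "\<beta> D = label_sum \<mu> D" "\<beta> D = label_sum \<nu> D" using assms(7) \<nu> unfolding labels_def by blast+
    then show "label_sum (\<lambda>e. \<nu> e + \<mu> e) D = 0" by (simp add: label_sum_add)
  qed
  then have "hat (\<lambda>e. \<nu> e + \<mu> e) i j k = 0" by (rule hat_zero[OF assms(1-6)])
  then have "hat \<nu> i j k + hat \<mu> i j k = 0" by (simp add: hat_def walk_sum_add add_ac)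
  then show ?thesis by (simp add: circulation_def \<nu>_def[symmetric] bit_add_eq_0_iff)
qed

text \<open>A single labelling serves all four triangles, and each of the six links occurs in two of
  them.\<close>

lemma circulation_tetrahedron:
  assumes "a < n" "b < n" "c < n" "d < n" "distinct [a, b, c, d]"
    and "labels \<mu> \<beta> (B a \<union> B b \<union> B c \<union> B d)"
  shows "circulation \<beta> a b c + circulation \<beta> a b d + circulation \<beta> a c d + circulation \<beta> b c d = 0"
proof -
  have l: "labels \<mu> \<beta> (B a \<union> B b \<union> B c)" "labels \<mu> \<beta> (B a \<union> B b \<union> B d)"
    "labels \<mu> \<beta> (B a \<union> B c \<union> B d)" "labels \<mu> \<beta> (B b \<union> B c \<union> B d)"
    by (rule labels_mono[OF assms(6)], blast)+
  have "circulation \<beta> a b c = hat \<mu> a b c" "circulation \<beta> a b d = hat \<mu> a b d"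
    "circulation \<beta> a c d = hat \<mu> a c d" "circulation \<beta> b c d = hat \<mu> b c d"
    using l assms(1-5) by (simp_all add: circulation_eq)
  then show ?thesis by (simp add: hat_def add_ac)
qed

text \<open>\<open>circulation\<close> rests on a choice, so linearity is claimed only where all
  summands have labellings; these add up to a labelling of the sum.\<close>

lemma circulation_add_sum:
  assumes "i < n" "j < n" "k < n" "i \<noteq> j" "j \<noteq> k" "i \<noteq> k"
    "\<exists>\<mu>. labels \<mu> \<beta> (B i \<union> B j \<union> B k)"
    "\<And>s. s \<in> F \<Longrightarrow> \<exists>\<mu>. labels \<mu> (\<gamma> s) (B i \<union> B j \<union> B k)"
  shows "circulation (\<lambda>D. \<beta> D + (\<Sum>s\<in>F. \<gamma> s D)) i j k = circulation \<beta> i j k + (\<Sum>s\<in>F. circulation (\<gamma> s) i j k)"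
proof -
  obtain \<mu> where \<mu>: "labels \<mu> \<beta> (B i \<union> B j \<union> B k)" using assms(7) by blast
  obtain \<nu> where \<nu>: "\<And>s. s \<in> F \<Longrightarrow> labels (\<nu> s) (\<gamma> s) (B i \<union> B j \<union> B k)" using assms(8) by metis
  have "labels (\<lambda>e. \<mu> e + (\<Sum>s\<in>F. \<nu> s e)) (\<lambda>D. \<beta> D + (\<Sum>s\<in>F. \<gamma> s D)) (B i \<union> B j \<union> B k)"
    unfolding labels_def
  proof (intro allI impI)
    fix D assume D: "hole D" "D \<subseteq> B i \<union> B j \<union> B k"
    have "(\<Sum>s\<in>F. \<gamma> s D) = (\<Sum>s\<in>F. label_sum (\<nu> s) D)"
      using \<nu> D by (intro sum.cong) (auto simp: labels_def)
    then show "\<beta> D + (\<Sum>s\<in>F. \<gamma> s D) = label_sum (\<lambda>e. \<mu> e + (\<Sum>s\<in>F. \<nu> s e)) D"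
      using \<mu> D by (simp add: label_sum_add label_sum_sum labels_def)
  qed
  then have "circulation (\<lambda>D. \<beta> D + (\<Sum>s\<in>F. \<gamma> s D)) i j k = hat (\<lambda>e. \<mu> e + (\<Sum>s\<in>F. \<nu> s e)) i j k"
    by (rule circulation_eq[OF assms(1-6)])
  also have "\<dots> = hat \<mu> i j k + (\<Sum>s\<in>F. hat (\<nu> s) i j k)"
    by (simp add: hat_def walk_sum_add walk_sum_sum sum.distrib add_ac)
  also have "\<dots> = circulation \<beta> i j k + (\<Sum>s\<in>F. circulation (\<gamma> s) i j k)"
    using circulation_eq[OF assms(1-6) \<mu>] circulation_eq[OF assms(1-6) \<nu>] by simp
  finally show ?thesis .
qed

text \<open>The functional \<open>\<phi>\<close> of the proof, which counts the edges between \<open>B b\<close> and \<open>B c\<close> in holes missing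
  \<open>B a\<close>, vanishes on every solid that misses a branch set, yet its circulation around the tetrahedron
  \<open>a b c d\<close> is 1. If each full solid could be violated alone, correcting \<open>\<phi>\<close> on these solids would give
  a balanced labelling with nonzero total circulation.\<close>

lemma redundant_solid:
  assumes less: "o' < n" "a < n" "b < n" "c < n" "d < n" and dist: "distinct [o', a, b, c, d]"
  shows "\<exists>S. solid_set S \<and> S \<subseteq> B a \<union> B b \<union> B c \<union> B d \<and>
    S \<inter> B a \<noteq> {} \<and> S \<inter> B b \<noteq> {} \<and> S \<inter> B c \<noteq> {} \<and> S \<inter> B d \<noteq> {} \<and>
    (\<forall>\<beta>. (\<forall>S'. solid_set S' \<longrightarrow> S' \<noteq> S \<longrightarrow>
      S' \<subseteq> B a \<union> B b \<union> B c \<union> B d \<or> S' \<subseteq> B o' \<union> B a \<union> B b \<union> B c \<or> S' \<subseteq> B o' \<union> B a \<union> B b \<union> B d \<or>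
      S' \<subseteq> B o' \<union> B a \<union> B c \<union> B d \<or> S' \<subseteq> B o' \<union> B b \<union> B c \<union> B d \<longrightarrow> hole_sum \<beta> S' = 0) \<longrightarrow>
      hole_sum \<beta> S = 0)"
proof (rule ccontr)
  assume contra: "\<not> ?thesis"
  define U where "U = B a \<union> B b \<union> B c \<union> B d"
  define full where "full S \<longleftrightarrow> solid_set S \<and> S \<subseteq> U \<and> S \<inter> B a \<noteq> {} \<and> S \<inter> B b \<noteq> {} \<and> S \<inter> B c \<noteq> {} \<and> S \<inter> B d \<noteq> {}" for S
  \<comment> \<open>The sets within one of the five facets of the 4-simplex on \<open>o'\<close>,
    \<open>a\<close>, \<open>b\<close>, \<open>c\<close>, \<open>d\<close>.\<close>
  define near where "near S' \<longleftrightarrow> S' \<subseteq> U \<or> S' \<subseteq> B o' \<union> B a \<union> B b \<union> B c \<or> S' \<subseteq> B o' \<union> B a \<union> B b \<union> B d \<or>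
      S' \<subseteq> B o' \<union> B a \<union> B c \<union> B d \<or> S' \<subseteq> B o' \<union> B b \<union> B c \<union> B d" for S'
  have contra': "\<nexists>S. full S \<and> (\<forall>\<beta>. (\<forall>S'. solid_set S' \<longrightarrow> S' \<noteq> S \<longrightarrow> near S' \<longrightarrow> hole_sum \<beta> S' = 0) \<longrightarrow> hole_sum \<beta> S = 0)"
    using contra unfolding full_def near_def U_def by (simp only: conj_assoc not_False_eq_True)
  have "\<exists>\<beta>. (\<forall>S'. solid_set S' \<longrightarrow> S' \<noteq> S \<longrightarrow> near S' \<longrightarrow> hole_sum \<beta> S' = 0) \<and> hole_sum \<beta> S = 1" if "full S" for S
  proof (rule ccontr)
    assume no: "\<not> ?thesis"
    have "\<forall>\<beta>. (\<forall>S'. solid_set S' \<longrightarrow> S' \<noteq> S \<longrightarrow> near S' \<longrightarrow> hole_sum \<beta> S' = 0) \<longrightarrow> hole_sum \<beta> S = 0"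
    proof (intro allI impI)
      fix \<beta> assume "\<forall>S'. solid_set S' \<longrightarrow> S' \<noteq> S \<longrightarrow> near S' \<longrightarrow> hole_sum \<beta> S' = 0"
      then have "hole_sum \<beta> S \<noteq> 1" using no by blast
      then show "hole_sum \<beta> S = 0" by simp
    qed
    then show False using contra' that by blast
  qed
  then obtain \<gamma> where \<gamma>: "\<And>S S'. full S \<Longrightarrow> solid_set S' \<Longrightarrow> S' \<noteq> S \<Longrightarrow> near S' \<Longrightarrow> hole_sum (\<gamma> S) S' = 0"
    "\<And>S. full S \<Longrightarrow> hole_sum (\<gamma> S) S = 1" by metis
  have dis: "B a \<inter> B b = {}" "B a \<inter> B c = {}" "B a \<inter> B d = {}" "B b \<inter> B c = {}" "B b \<inter> B d = {}" "B c \<inter> B d = {}"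
    "B o' \<inter> B a = {}" "B o' \<inter> B b = {}" "B o' \<inter> B c = {}" "B o' \<inter> B d = {}"
    using less dist by (simp_all add: disjoint_parts)
  have fin: "finite (B o')" "finite (B a)" "finite (B b)" "finite (B c)" "finite (B d)"
    using less finite_part by auto
  define \<phi> where "\<phi> D = (if D \<inter> B a = {} then label_sum (cross (B b) (B c)) D else 0)" for D
  \<comment> \<open>\<open>F\<close> collects the full solids on which \<open>\<phi>\<close> fails.
    Among the near solids, \<open>\<gamma> S\<close> changes the sum on \<open>S\<close> alone, so
    \<open>\<psi>\<close> is balanced on \<open>U\<close>.\<close>
  define F where "F = {S. full S \<and> hole_sum \<phi> S = 1}"
  define \<psi> where "\<psi> D = \<phi> D + (\<Sum>S\<in>F. \<gamma> S D)" for D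
  have finF: "finite F" by (rule finite_subset[of _ "Pow U"]) (auto simp: F_def full_def U_def fin)
  have phi0: "\<phi> D = 0" if "hole D" "D \<subseteq> U" "D \<inter> B b = {} \<or> D \<inter> B c = {} \<or> D \<inter> B d = {}" for D
    using label_sum_cross_zero[OF that(1) dis(4)] that(2,3) unfolding \<phi>_def U_def by (auto split: if_splits)
  have phi_sum: "hole_sum \<phi> S = 0" if S: "solid_set S" "S \<subseteq> U" "\<not> full S" for S
  proof (cases "S \<inter> B a = {}")
    case True
    have "hole_sum \<phi> S = hole_sum (label_sum (cross (B b) (B c))) S"
      unfolding hole_sum_def by (rule sum.cong) (use True in \<open>auto simp: \<phi>_def\<close>)
    also have "\<dots> = 0" by (rule solid_set_hole_sum_label_sum[OF S(1)]) (use S(2) fin U_def in \<open>auto intro: finite_subset\<close>)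
    finally show ?thesis .
  next
    case False
    then have "S \<inter> B b = {} \<or> S \<inter> B c = {} \<or> S \<inter> B d = {}" using S by (auto simp: full_def)
    then show ?thesis unfolding hole_sum_def using phi0 S(2) by (intro sum.neutral) blast
  qed
  have "hole_sum \<psi> S = 0" if S: "solid_set S" "S \<subseteq> U" for S
  proof -
    have nS: "near S" using S by (simp add: near_def)
    have e: "hole_sum \<psi> S = hole_sum \<phi> S + (\<Sum>S'\<in>F. hole_sum (\<gamma> S') S)"
      unfolding \<psi>_def hole_sum_add hole_sum_sum ..
    have "(\<Sum>S'\<in>F. hole_sum (\<gamma> S') S) = (\<Sum>S'\<in>F. if S' = S then 1 else 0)"
      using \<gamma>(1)[OF _ S(1) _ nS] \<gamma>(2) by (intro sum.cong) (auto simp: F_def)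
    also have "\<dots> = (if S \<in> F then 1 else 0)" using finF by simp
    also have "\<dots> = hole_sum \<phi> S"
      using phi_sum[OF S] by (auto simp: F_def)
    finally show ?thesis using e by simp
  qed
  then have "balanced \<psi> U" by (simp add: balanced_def)
  then obtain \<mu> where "labels \<mu> \<psi> U" using truemper[of U \<psi>] fin U_def by auto
  then have psi: "circulation \<psi> a b c + circulation \<psi> a b d + circulation \<psi> a c d + circulation \<psi> b c d = 0"
    unfolding U_def using circulation_tetrahedron[of a b c d] less dist by simp
  have lphi0: "labels (\<lambda>_. 0) \<phi> X" if "X \<subseteq> B a \<union> B b \<union> B c \<or> X \<subseteq> B a \<union> B b \<union> B d \<or> X \<subseteq> B a \<union> B c \<union> B d" for X
    unfolding labels_def
  proof (intro allI impI)
    fix D assume D: "hole D" "D \<subseteq> X"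
    from that have "D \<inter> B d = {} \<or> D \<inter> B c = {} \<or> D \<inter> B b = {}"
    proof (elim disjE)
      assume "X \<subseteq> B a \<union> B b \<union> B c"
      then have "D \<inter> B d = {}" using D(2) dis(3,5,6) by blast
      then show ?thesis by simp
    next
      assume "X \<subseteq> B a \<union> B b \<union> B d"
      then have "D \<inter> B c = {}" using D(2) dis(2,4,6) by blast
      then show ?thesis by simp
    next
      assume "X \<subseteq> B a \<union> B c \<union> B d"
      then have "D \<inter> B b = {}" using D(2) dis(1,4,5) by blast
      then show ?thesis by simp
    qed
    moreover have "D \<subseteq> U" using D that by (auto simp: U_def)
    ultimately show "\<phi> D = label_sum (\<lambda>_. 0) D" using phi0[OF D(1)] by auto
  qed
  \<comment> \<open>On holes missing \<open>B a\<close>, \<open>\<phi>\<close> counts edges between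
    \<open>B b\<close> and \<open>B c\<close>. Around the triangle \<open>b c d\<close> only the
    link from \<open>b\<close> to \<open>c\<close> crosses between these, an odd number of times;
    this is the source of the 1.\<close>
  have lphi1: "labels (cross (B b) (B c)) \<phi> (B b \<union> B c \<union> B d)"
    unfolding labels_def \<phi>_def using dis by auto
  have phi_circ: "circulation \<phi> a b c = 0" "circulation \<phi> a b d = 0" "circulation \<phi> a c d = 0" "circulation \<phi> b c d = 1"
  proof -
    show "circulation \<phi> a b c = 0" using circulation_eq[OF _ _ _ _ _ _ lphi0, of a b c] less dist by (simp add: hat_def)
    show "circulation \<phi> a b d = 0" using circulation_eq[OF _ _ _ _ _ _ lphi0, of a b d] less dist by (simp add: hat_def)
    show "circulation \<phi> a c d = 0" using circulation_eq[OF _ _ _ _ _ _ lphi0, of a c d] less dist by (simp add: hat_def)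
    have "walk_sum (cross (B b) (B c)) (w c d) = 0"
      by (rule walk_sum_zero_edges[OF link]) (use less dist dis in \<open>auto simp: cross_def\<close>)
    moreover have "walk_sum (cross (B b) (B c)) (w b d) = 0"
      by (rule walk_sum_zero_edges[OF link]) (use less dist dis in \<open>auto simp: cross_def\<close>)
    ultimately show "circulation \<phi> b c d = 1"
      using circulation_eq[OF _ _ _ _ _ _ lphi1] less dist link_cross[of b c] by (simp add: hat_def)
  qed
  \<comment> \<open>This is applied to the four facets through \<open>o'\<close>: each misses one of
    the parts that \<open>S\<close> meets, so \<open>S\<close> does not lie in it and
    \<open>\<gamma> S\<close> is balanced there.\<close>
  have lab4: "\<exists>\<mu>. labels \<mu> (\<gamma> S) X" if S: "S \<in> F" and X: "near X" "\<not> U \<subseteq> X" "finite X" "\<not> S \<subseteq> X" for S X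
  proof (rule truemper[OF X(3)])
    have fS: "full S" using S by (simp add: F_def)
    show "balanced (\<gamma> S) X"
      unfolding balanced_def
    proof (intro allI impI)
      fix S' assume S': "solid_set S'" "S' \<subseteq> X"
      then have "near S'" using X(1) unfolding near_def by blast
      moreover have "S' \<noteq> S" using S' X(4) by blast
      ultimately show "hole_sum (\<gamma> S) S' = 0" using \<gamma>(1)[OF fS S'(1)] by blast
    qed
  qed
  have lab4s: "\<exists>\<mu>. labels \<mu> (\<gamma> S) (B o' \<union> B a \<union> B b \<union> B c)" "\<exists>\<mu>. labels \<mu> (\<gamma> S) (B o' \<union> B a \<union> B b \<union> B d)"
    "\<exists>\<mu>. labels \<mu> (\<gamma> S) (B o' \<union> B a \<union> B c \<union> B d)" "\<exists>\<mu>. labels \<mu> (\<gamma> S) (B o' \<union> B b \<union> B c \<union> B d)"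
    if S: "S \<in> F" for S
  proof -
    have s: "S \<subseteq> U" "S \<inter> B a \<noteq> {}" "S \<inter> B b \<noteq> {}" "S \<inter> B c \<noteq> {}" "S \<inter> B d \<noteq> {}"
      using S by (auto simp: F_def full_def)
    have key: "\<exists>\<mu>. labels \<mu> (\<gamma> S) X" if "near X" "finite X" "X \<inter> B a = {} \<or> X \<inter> B b = {} \<or> X \<inter> B c = {} \<or> X \<inter> B d = {}" for X
      by (rule lab4[OF S that(1) _ that(2)]) (use s that(3) in blast)+
    have "distinct [d, c, b, a]" using dist by auto
    then have "B d \<inter> B c = {}" "B c \<inter> B b = {}" "B d \<inter> B b = {}" "B b \<inter> B a = {}" "B c \<inter> B a = {}" "B d \<inter> B a = {}"
      using less by (simp_all add: disjoint_parts)
    then have "(B o' \<union> B a \<union> B b \<union> B c) \<inter> B d = {}" "(B o' \<union> B a \<union> B b \<union> B d) \<inter> B c = {}"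
      "(B o' \<union> B a \<union> B c \<union> B d) \<inter> B b = {}" "(B o' \<union> B b \<union> B c \<union> B d) \<inter> B a = {}"
      using dis by (simp_all add: Int_Un_distrib2)
    then show "\<exists>\<mu>. labels \<mu> (\<gamma> S) (B o' \<union> B a \<union> B b \<union> B c)" "\<exists>\<mu>. labels \<mu> (\<gamma> S) (B o' \<union> B a \<union> B b \<union> B d)"
      "\<exists>\<mu>. labels \<mu> (\<gamma> S) (B o' \<union> B a \<union> B c \<union> B d)" "\<exists>\<mu>. labels \<mu> (\<gamma> S) (B o' \<union> B b \<union> B c \<union> B d)"
      using key fin unfolding near_def by simp_all
  qed
  \<comment> \<open>In the sum of the tetrahedron equations of the four facets through
    \<open>o'\<close>, every triangle containing \<open>o'\<close> occurs twice and cancels; the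
    boundary of \<open>a b c d\<close> remains.\<close>
  have gam: "circulation (\<gamma> S) a b c + circulation (\<gamma> S) a b d + circulation (\<gamma> S) a c d + circulation (\<gamma> S) b c d = 0"
    if S: "S \<in> F" for S
  proof -
    obtain \<mu>1 \<mu>2 \<mu>3 \<mu>4 where m: "labels \<mu>1 (\<gamma> S) (B o' \<union> B a \<union> B b \<union> B c)" "labels \<mu>2 (\<gamma> S) (B o' \<union> B a \<union> B b \<union> B d)"
      "labels \<mu>3 (\<gamma> S) (B o' \<union> B a \<union> B c \<union> B d)" "labels \<mu>4 (\<gamma> S) (B o' \<union> B b \<union> B c \<union> B d)"
      using lab4s[OF S] by blast
    let ?c = "circulation (\<gamma> S)"
    have t: "?c o' a b + ?c o' a c + ?c o' b c + ?c a b c = 0" "?c o' a b + ?c o' a d + ?c o' b d + ?c a b d = 0"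
      "?c o' a c + ?c o' a d + ?c o' c d + ?c a c d = 0" "?c o' b c + ?c o' b d + ?c o' c d + ?c b c d = 0"
      using m less dist by (auto intro!: circulation_tetrahedron)
    have "?c a b c = ?c o' a b + ?c o' a c + ?c o' b c" "?c a b d = ?c o' a b + ?c o' a d + ?c o' b d"
      "?c a c d = ?c o' a c + ?c o' a d + ?c o' c d" "?c b c d = ?c o' b c + ?c o' b d + ?c o' c d"
      using t by (simp_all only: bit_add_eq_0_iff)
    then show ?thesis by (simp add: add_ac)
  qed
  have add: "circulation \<psi> i j k = circulation \<phi> i j k + (\<Sum>S\<in>F. circulation (\<gamma> S) i j k)"
    if ijk: "i < n" "j < n" "k < n" "i \<noteq> j" "j \<noteq> k" "i \<noteq> k" and "\<exists>\<mu>. labels \<mu> \<phi> (B i \<union> B j \<union> B k)"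
      "\<And>S. S \<in> F \<Longrightarrow> \<exists>\<mu>. labels \<mu> (\<gamma> S) (B i \<union> B j \<union> B k)" for i j k
    unfolding \<psi>_def by (rule circulation_add_sum[OF ijk that(7,8)])
  have g3: "\<exists>\<mu>. labels \<mu> (\<gamma> S) (B a \<union> B b \<union> B c)" "\<exists>\<mu>. labels \<mu> (\<gamma> S) (B a \<union> B b \<union> B d)"
    "\<exists>\<mu>. labels \<mu> (\<gamma> S) (B a \<union> B c \<union> B d)" "\<exists>\<mu>. labels \<mu> (\<gamma> S) (B b \<union> B c \<union> B d)" if S: "S \<in> F" for S
    using lab4s[OF S] by (meson labels_mono Un_upper1 Un_upper2 Un_mono subset_refl sup.mono sup_ge2 order_trans)+
  have p3: "\<exists>\<mu>. labels \<mu> \<phi> (B a \<union> B b \<union> B c)" "\<exists>\<mu>. labels \<mu> \<phi> (B a \<union> B b \<union> B d)"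
    "\<exists>\<mu>. labels \<mu> \<phi> (B a \<union> B c \<union> B d)" "\<exists>\<mu>. labels \<mu> \<phi> (B b \<union> B c \<union> B d)"
    using lphi0[of "B a \<union> B b \<union> B c"] lphi0[of "B a \<union> B b \<union> B d"] lphi0[of "B a \<union> B c \<union> B d"] lphi1 by auto
  have ne: "a \<noteq> b" "a \<noteq> c" "a \<noteq> d" "b \<noteq> c" "b \<noteq> d" "c \<noteq> d" using dist by auto
  note add[OF less(2,3,4) ne(1,4,2) p3(1) g3(1)] add[OF less(2,3,5) ne(1,5,3) p3(2) g3(2)]
    add[OF less(2,4,5) ne(2,6,3) p3(3) g3(3)] add[OF less(3,4,5) ne(4,6,5) p3(4) g3(4)]
  \<comment> \<open>By linearity the four circulations of \<open>\<psi>\<close> add up to the 1 of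
    \<open>\<phi>\<close> plus the contributions of the \<open>\<gamma> S\<close>, which vanish by
    \<open>gam\<close>.\<close>
  then have "0 = 1 + (\<Sum>S\<in>F. circulation (\<gamma> S) a b c + circulation (\<gamma> S) a b d + circulation (\<gamma> S) a c d + circulation (\<gamma> S) b c d)"
    using psi phi_circ by (simp add: sum.distrib add_ac)
  then show False using gam by simp
qed

end

section \<open>Counting labellings\<close>

definition supported :: "'x set \<Rightarrow> ('x \<Rightarrow> bit) set" where
  "supported H = {f. \<forall>x. x \<notin> H \<longrightarrow> f x = 0}"

lemma card_supported:
  assumes "finite H"
  shows "card (supported H) = 2 ^ card H" "finite (supported H)"
proof -
  have b: "bij_betw (\<lambda>X x. if x \<in> X then 1 else 0) (Pow H) (supported H)"
    by (rule bij_betw_byWitness[where f' = "\<lambda>f. {x. f x = 1}"])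
      (auto simp: supported_def fun_eq_iff)
  then show "card (supported H) = 2 ^ card H" using bij_betw_same_card card_Pow[OF assms] by metis
  show "finite (supported H)" using bij_betw_finite[OF b] assms by simp
qed

text \<open>The homomorphism theorem in counting form. Adding a preimage \<open>g\<close> of
  \<open>y\<close> maps the fibre over \<open>y\<close> onto the kernel; as the values are bits,
  this map is its own inverse.\<close>

lemma card_image_kernel:
  fixes T :: "('x \<Rightarrow> bit) \<Rightarrow> ('y \<Rightarrow> bit)"
  assumes "finite A" "\<And>f g. f \<in> A \<Longrightarrow> g \<in> A \<Longrightarrow> (\<lambda>x. f x + g x) \<in> A"
    "\<And>f g. T (\<lambda>x. f x + g x) = (\<lambda>y. T f y + T g y)"
  shows "card A = card (T ` A) * card {f \<in> A. T f = (\<lambda>_. 0)}"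
proof -
  have fib: "card {f \<in> A. T f = y} = card {f \<in> A. T f = (\<lambda>_. 0)}" if y: "y \<in> T ` A" for y
  proof -
    obtain g where g: "g \<in> A" "y = T g" using y by blast
    have "bij_betw (\<lambda>f x. f x + g x) {f \<in> A. T f = y} {f \<in> A. T f = (\<lambda>_. 0)}"
      by (rule bij_betw_byWitness[where f' = "\<lambda>f x. f x + g x"])
        (use g assms(2,3) in \<open>auto simp: add.assoc\<close>)
    then show ?thesis by (rule bij_betw_same_card)
  qed
  have "card A = (\<Sum>f\<in>A. 1)" by simp
  also have "\<dots> = (\<Sum>y\<in>T ` A. \<Sum>f\<in>{f \<in> A. T f = y}. 1)" by (rule sum.image_gen[OF assms(1)])
  also have "\<dots> = (\<Sum>y\<in>T ` A. card {f \<in> A. T f = (\<lambda>_. 0)})" using fib by simp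
  finally show ?thesis by simp
qed

text \<open>By Pascal's rule the alternating sum telescopes to \<open>h - 1 choose 4\<close> minus
  \<open>h - 1 choose 0\<close>. At \<open>h = 0\<close> the left side would be 0 and the right side
  -1, because subtraction on naturals truncates.\<close>

lemma binomial_alternating:
  assumes "1 \<le> h"
  shows "int (h choose 4) - int (h choose 3) + int (h choose 2) - int (h choose 1) = int ((h - 1) choose 4) - 1"
proof -
  obtain k where k: "h = Suc k" using assms by (cases h) auto
  have "4 = Suc 3" "3 = Suc 2" "2 = Suc (1::nat)" by simp_all
  then show ?thesis unfolding k by (simp add: numeral_eq_Suc)
qed

context edge_set
begin

lemma hole_count_le:
  assumes V: "finite V" "conn V" "V \<noteq> {}" and SS: "finite SS"
    and bal: "\<And>\<beta>. (\<And>S. S \<in> SS \<Longrightarrow> hole_sum \<beta> S = 0) \<Longrightarrow> balanced \<beta> V"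
  shows "card {D. hole D \<and> D \<subseteq> V} + card V \<le> card SS + card (induced_edges V) + 1"
proof -
  define C where "C = {D. hole D \<and> D \<subseteq> V}"
  \<comment> \<open>Values outside \<open>SS\<close> and \<open>C\<close> are set to 0 to keep the
    images of \<open>T1\<close> and \<open>T2\<close> in the finite spaces
    \<open>supported\<close>.\<close>
  define T1 where "T1 \<beta> = (\<lambda>S. if S \<in> SS then hole_sum \<beta> S else 0)" for \<beta>
  define T2 where "T2 \<mu> = (\<lambda>D. if D \<in> C then label_sum \<mu> D else 0)" for \<mu>
  define L where "L = {\<beta> \<in> supported C. T1 \<beta> = (\<lambda>_. 0)}"
  define K where "K = {\<mu> \<in> supported (induced_edges V). T2 \<mu> = (\<lambda>_. 0)}"
  have fin: "finite C" "finite (induced_edges V)" using finite_holes[OF V(1)] finite_induced_edges[OF V(1)] by (auto simp: C_def)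
  have "card (supported C) = card (T1 ` supported C) * card L"
    unfolding L_def by (rule card_image_kernel)
      (use card_supported[OF fin(1)] in \<open>auto simp: supported_def T1_def hole_sum_add fun_eq_iff\<close>)
  moreover have "card (T1 ` supported C) \<le> card (supported SS)"
    by (rule card_mono[OF card_supported(2)[OF SS]]) (auto simp: T1_def supported_def)
  ultimately have 1: "2 ^ card C \<le> 2 ^ card SS * card L"
    using card_supported(1)[OF fin(1)] card_supported(1)[OF SS] by (metis mult_le_mono1)
  have 2: "2 ^ card (induced_edges V) = card (T2 ` supported (induced_edges V)) * card K"
    unfolding K_def card_supported(1)[OF fin(2), symmetric] by (rule card_image_kernel)
      (use card_supported[OF fin(2)] in \<open>auto simp: supported_def T2_def label_sum_add fun_eq_iff\<close>)
  have "L \<subseteq> T2 ` supported (induced_edges V)"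
  proof
    fix \<beta> assume \<beta>: "\<beta> \<in> L"
    have "T1 \<beta> S = 0" for S using \<beta> unfolding L_def by simp
    then have "hole_sum \<beta> S = 0" if S: "S \<in> SS" for S
      using S unfolding T1_def by metis
    then obtain \<mu> where \<mu>: "labels \<mu> \<beta> V" using truemper[OF V(1) bal] by blast
    define \<nu> where "\<nu> e = (if e \<in> induced_edges V then \<mu> e else 0)" for e
    have "label_sum \<nu> D = \<beta> D" if D: "D \<in> C" for D
    proof -
      have "label_sum \<nu> D = label_sum \<mu> D" by (rule label_sum_cong) (use D in \<open>auto simp: \<nu>_def in_induced_edges C_def\<close>)
      then show ?thesis using \<mu> D by (simp add: labels_def C_def)
    qed
    moreover have "\<beta> D = 0" if "D \<notin> C" for D using \<beta> that by (simp add: L_def supported_def)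
    ultimately have "\<beta> = T2 \<nu>" by (auto simp: T2_def fun_eq_iff)
    moreover have "\<nu> \<in> supported (induced_edges V)" by (simp add: \<nu>_def supported_def)
    ultimately show "\<beta> \<in> T2 ` supported (induced_edges V)" by blast
  qed
  then have 3: "card L \<le> card (T2 ` supported (induced_edges V))"
    by (rule card_mono[rotated]) (use card_supported(2)[OF fin(2)] in simp)
  obtain r where r: "r \<in> V" using V(3) by blast
  \<comment> \<open>The coboundary of \<open>p\<close>. Fixing \<open>p r = 0\<close> excludes the
    nonzero constant potential, so on the connected set \<open>V\<close> distinct \<open>p\<close>
    give distinct elements of the kernel, \<open>2 ^ (card V - 1)\<close> in number.\<close>
  define \<delta> where "\<delta> p = (\<lambda>e. if e \<in> induced_edges V then \<Sum>x\<in>e. p x else 0)" for p :: "'a \<Rightarrow> bit"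
  have \<delta>: "\<delta> p {x, y} = p x + p y" if "x \<in> V" "y \<in> V" "adj x y" for p x y
  proof -
    have "x \<noteq> y" using that by auto
    then show ?thesis using that by (simp add: \<delta>_def in_induced_edges)
  qed
  have "\<delta> ` supported (V - {r}) \<subseteq> K"
  proof
    fix \<mu> assume "\<mu> \<in> \<delta> ` supported (V - {r})"
    then obtain p where p: "\<mu> = \<delta> p" by blast
    have "label_sum \<mu> D = 0" if D: "D \<in> C" for D
      by (rule label_sum_potential[of D \<mu> p]) (use D \<delta> p in \<open>auto simp: C_def\<close>)
    then show "\<mu> \<in> K" using p by (auto simp: K_def T2_def supported_def \<delta>_def)
  qed
  moreover have "inj_on \<delta> (supported (V - {r}))"
  proof (rule inj_onI)
    fix p q assume p: "p \<in> supported (V - {r})" and q: "q \<in> supported (V - {r})" and eq: "\<delta> p = \<delta> q"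
    define d where "d x = p x + q x" for x
    have "d x = 0" for x
    proof (cases "x \<in> V")
      case True
      obtain l where l: "walk_between V r l x" using V(2) r True unfolding conn_def by blast
      have "(0::bit) = d x + d y" if "x \<in> V" "y \<in> V" "adj x y" for x y
      proof -
        have "p x + p y = q x + q y" using \<delta>[OF that, of p] \<delta>[OF that, of q] eq by simp
        then show ?thesis unfolding d_def by (metis add.assoc add.commute bit_add_self)
      qed
      then have "walk_sum (\<lambda>_. 0) l = d (hd l) + d (last l)"
        using walk_sum_potential[of l V "\<lambda>_. 0" d] l unfolding walk_between_def by blast
      then have "d r = d x" using l by (simp add: walk_between_def bit_add_eq_0_iff eq_commute[of 0])
      moreover have "d r = 0" using p q by (simp add: d_def supported_def)
      ultimately show ?thesis by simp
    qed (use p q in \<open>simp add: d_def supported_def\<close>)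
    then show "p = q" by (simp add: d_def fun_eq_iff bit_add_eq_0_iff)
  qed
  moreover have "finite K" by (rule finite_subset[OF _ card_supported(2)[OF fin(2)]]) (auto simp: K_def)
  ultimately have "card (supported (V - {r})) \<le> card K"
    by (metis card_image card_mono)
  then have 4: "2 ^ (card V - 1) \<le> card K"
    using card_supported(1)[of "V - {r}"] V(1) r by simp
  \<comment> \<open>Division of powers is avoided: the estimates for \<open>L\<close>, the image of
    \<open>T2\<close> and \<open>K\<close> are multiplied, and then exponents are compared.\<close>
  have "(2::nat) ^ (card C + (card V - 1)) \<le> (2 ^ card SS * card L) * card K"
    unfolding power_add using 1 4 by (rule mult_le_mono)
  also have "\<dots> \<le> 2 ^ card SS * (card (T2 ` supported (induced_edges V)) * card K)"
    using 3 by simp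
  also have "\<dots> = 2 ^ (card SS + card (induced_edges V))" unfolding 2[symmetric] power_add ..
  finally have "card C + (card V - 1) \<le> card SS + card (induced_edges V)" by simp
  moreover have "1 \<le> card V" using V by (simp add: Suc_le_eq card_gt_0_iff)
  ultimately show ?thesis by (simp add: C_def)
qed

lemma path_edges_walk: "path_edges p \<subseteq> E \<Longrightarrow> walk p"
proof (induction p)
  case (Cons x p)
  then show ?case by (cases p) (auto simp: adj_def)
qed simp

lemma connected_graph_conn:
  assumes "connected_graph (X, F)" "F \<subseteq> E"
  shows "X \<noteq> {}" "conn X"
proof -
  show "X \<noteq> {}" using assms(1) by (simp add: connected_graph_def)
  show "conn X"
    unfolding conn_def
  proof (intro ballI)
    fix u v assume "u \<in> X" "v \<in> X"
    moreover have "\<forall>u\<in>X. \<forall>v\<in>X. \<exists>p. is_path u p v \<and> set p \<subseteq> X \<and> path_edges p \<subseteq> F"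
      using assms(1) by (simp add: connected_graph_def)
    ultimately obtain p where "is_path u p v" "set p \<subseteq> X" "path_edges p \<subseteq> F" by blast
    then have "walk_between X u p v" using path_edges_walk[of p] assms(2) by (auto simp: walk_between_def is_path_def)
    then show "\<exists>l. walk_between X u l v" by blast
  qed
qed

end

lemma (in linked_parts) solid_bound:
  assumes V: "finite V" "conn V" "\<And>i. i < n \<Longrightarrow> B i \<subseteq> V" and n: "1 \<le> n" "V \<noteq> {}"
  shows "card {D. hole D \<and> D \<subseteq> V} + card V + ((n - 1) choose 4) \<le> card {S. solid_set S \<and> S \<subseteq> V} + card (induced_edges V) + 1"
proof -
  define U where "U Q = (\<Union>i\<in>Q. B i)" for Q
  define \<Q> where "\<Q> = {Q. Q \<subseteq> {1..<n} \<and> card Q = 4}"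
  define red where "red Q S \<longleftrightarrow> solid_set S \<and> S \<subseteq> U Q \<and> (\<forall>i\<in>Q. S \<inter> B i \<noteq> {}) \<and>
    (\<forall>\<beta>. (\<forall>S'. solid_set S' \<longrightarrow> S' \<noteq> S \<longrightarrow> S' \<subseteq> U Q \<or> (\<exists>i\<in>Q. S' \<subseteq> U (insert 0 (Q - {i}))) \<longrightarrow> hole_sum \<beta> S' = 0) \<longrightarrow>
      hole_sum \<beta> S = 0)" for Q S
  have "\<exists>S. red Q S" if Q: "Q \<in> \<Q>" for Q
  proof -
    have "card Q = Suc (Suc (Suc (Suc 0)))" using Q by (simp add: \<Q>_def)
    then obtain a b c d where abcd: "Q = {a, b, c, d}" "distinct [a, b, c, d]"
      by (auto simp: card_Suc_eq)
    have less: "0 < n" "a < n" "b < n" "c < n" "d < n" "0 \<notin> Q" using Q abcd n(1) by (auto simp: \<Q>_def)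
    then have dist: "distinct [0, a, b, c, d]" using abcd by auto
    have un: "U Q = B a \<union> B b \<union> B c \<union> B d" using abcd(1) by (auto simp: U_def)
    have diffs: "Q - {d} = {a, b, c}" "Q - {c} = {a, b, d}" "Q - {b} = {a, c, d}" "Q - {a} = {b, c, d}"
      using abcd by auto
    have ex: "(\<exists>i\<in>Q. S' \<subseteq> U (insert 0 (Q - {i}))) \<longleftrightarrow>
      S' \<subseteq> B 0 \<union> B a \<union> B b \<union> B c \<or> S' \<subseteq> B 0 \<union> B a \<union> B b \<union> B d \<or>
      S' \<subseteq> B 0 \<union> B a \<union> B c \<union> B d \<or> S' \<subseteq> B 0 \<union> B b \<union> B c \<union> B d" for S'
    proof -
      have "(\<exists>i\<in>Q. S' \<subseteq> U (insert 0 (Q - {i}))) \<longleftrightarrow>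
        S' \<subseteq> U (insert 0 (Q - {d})) \<or> S' \<subseteq> U (insert 0 (Q - {c})) \<or>
        S' \<subseteq> U (insert 0 (Q - {b})) \<or> S' \<subseteq> U (insert 0 (Q - {a}))"
        unfolding abcd(1) by blast
      then show ?thesis unfolding diffs U_def by (simp add: Un_assoc)
    qed
    show ?thesis
      using redundant_solid[OF less(1-5) dist] unfolding red_def ex un unfolding abcd(1)
      by (elim exE) (rule exI, simp)
  qed
  then obtain f where f: "\<And>Q. Q \<in> \<Q> \<Longrightarrow> red Q (f Q)" by metis
  have fin\<Q>: "finite \<Q>" by (rule finite_subset[of _ "Pow {1..<n}"]) (auto simp: \<Q>_def)
  have card\<Q>: "card \<Q> = (n - 1) choose 4" unfolding \<Q>_def by (subst n_subsets) auto
  \<comment> \<open>\<open>f Q\<close> meets every part in \<open>Q\<close>, so it fits into the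
    union of the parts in \<open>X\<close> only if \<open>Q \<subseteq> X\<close>. This also makes
    \<open>f\<close> injective.\<close>
  have miss: False if Q: "Q \<in> \<Q>" and X: "f Q \<subseteq> U X" "X \<subseteq> {..<n}" and i: "i \<in> Q" "i \<notin> X" for Q X i
  proof -
    have "f Q \<inter> B i \<noteq> {}" using f[OF Q] i unfolding red_def by blast
    then obtain x where x: "x \<in> f Q" "x \<in> B i" by blast
    then obtain j where j: "j \<in> X" "x \<in> B j" using X(1) unfolding U_def by blast
    have "i < n" using Q i by (auto simp: \<Q>_def)
    then show False using disjoint_parts[of i j] j X i x by auto
  qed
  have sub: "Q \<subseteq> Q'" if "Q \<in> \<Q>" "Q' \<in> \<Q>" "f Q \<subseteq> U Q'" for Q Q'
  proof
    fix i assume "i \<in> Q"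
    moreover have "Q' \<subseteq> {..<n}" using that(2) by (auto simp: \<Q>_def)
    ultimately show "i \<in> Q'" using miss[OF that(1,3)] by blast
  qed
  have eqQ: "Q = Q'" if "Q \<in> \<Q>" "Q' \<in> \<Q>" "f Q \<subseteq> U Q'" for Q Q'
  proof (rule card_subset_eq)
    show "finite Q'" using that(2) finite_subset[of Q' "{1..<n}"] by (auto simp: \<Q>_def)
    show "Q \<subseteq> Q'" using sub[OF that] .
    show "card Q = card Q'" using that by (simp add: \<Q>_def)
  qed
  have fU: "f Q \<subseteq> U Q" "solid_set (f Q)" if "Q \<in> \<Q>" for Q using f[OF that] by (auto simp: red_def)
  have UV: "U X \<subseteq> V" if "X \<subseteq> {..<n}" for X using V(3) that unfolding U_def by blast
  have \<Q>n: "Q \<subseteq> {..<n}" if "Q \<in> \<Q>" for Q using that by (auto simp: \<Q>_def)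
  have inj: "inj_on f \<Q>"
  proof (rule inj_onI)
    fix Q Q' assume "Q \<in> \<Q>" "Q' \<in> \<Q>" "f Q = f Q'"
    then show "Q = Q'" using eqQ fU by metis
  qed
  define SS where "SS = {S. solid_set S \<and> S \<subseteq> V} - f ` \<Q>"
  have finS: "finite {S. solid_set S \<and> S \<subseteq> V}" by (rule finite_subset[of _ "Pow V"]) (use V in auto)
  have im: "f ` \<Q> \<subseteq> {S. solid_set S \<and> S \<subseteq> V}" using fU UV \<Q>n by blast
  have "card SS + ((n - 1) choose 4) = card {S. solid_set S \<and> S \<subseteq> V}"
    using card_Diff_subset[OF finite_imageI[OF fin\<Q>] im] card_mono[OF finS im] card_image[OF inj] card\<Q>
    by (simp add: SS_def)
  moreover have "card {D. hole D \<and> D \<subseteq> V} + card V \<le> card SS + card (induced_edges V) + 1"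
  proof (rule hole_count_le[OF V(1,2) n(2)])
    show "finite SS" using finS by (simp add: SS_def)
    fix \<beta> assume z: "\<And>S. S \<in> SS \<Longrightarrow> hole_sum \<beta> S = 0"
    show "balanced \<beta> V"
      unfolding balanced_def
    proof (intro allI impI)
      fix S assume S: "solid_set S" "S \<subseteq> V"
      show "hole_sum \<beta> S = 0"
      proof (cases "S \<in> f ` \<Q>")
        case False
        then show ?thesis using z S by (simp add: SS_def)
      next
        case True
        then obtain Q where Q: "Q \<in> \<Q>" "S = f Q" by blast
        have finQ: "finite Q" using Q(1) finite_subset[of Q "{1..<n}"] by (auto simp: \<Q>_def)
        have "hole_sum \<beta> S' = 0" if S': "solid_set S'" "S' \<noteq> f Q" "S' \<subseteq> U Q \<or> (\<exists>i\<in>Q. S' \<subseteq> U (insert 0 (Q - {i})))" for S'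
        proof (rule z)
          have "0 < n" using n by simp
          then have ins: "insert 0 (Q - {i}) \<subseteq> {..<n}" for i using \<Q>n[OF Q(1)] by auto
          have "S' \<subseteq> V" using S'(3) UV[OF \<Q>n[OF Q(1)]] UV[OF ins] by blast
          moreover have "S' \<notin> f ` \<Q>"
          proof
            assume "S' \<in> f ` \<Q>"
            then obtain Q' where Q': "Q' \<in> \<Q>" "S' = f Q'" by blast
            from S'(3) show False
            proof
              assume "S' \<subseteq> U Q"
              then have "Q' = Q" using eqQ[OF Q'(1) Q(1)] Q' by simp
              then show False using S'(2) Q' by simp
            next
              assume "\<exists>i\<in>Q. S' \<subseteq> U (insert 0 (Q - {i}))"
              then obtain i where i: "i \<in> Q" "f Q' \<subseteq> U (insert 0 (Q - {i}))" using Q' by blast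
              \<comment> \<open>Here the exclusion of 0 from the index sets enters:
                \<open>Q'\<close> would have to fit into the three-element set
                \<open>Q - {i}\<close>.\<close>
              have "Q' \<subseteq> insert 0 (Q - {i})" using miss[OF Q'(1) i(2) ins] by blast
              moreover have "0 \<notin> Q'" using Q'(1) by (auto simp: \<Q>_def)
              ultimately have "Q' \<subseteq> Q - {i}" by blast
              then have "card Q' \<le> card (Q - {i})" using finQ by (intro card_mono) auto
              also have "\<dots> < card Q" using i finQ by (intro card_Diff1_less)
              finally show False using Q Q' by (simp add: \<Q>_def)
            qed
          qed
          ultimately show "S' \<in> SS" using S' by (simp add: SS_def)
        qed
        then have "hole_sum \<beta> (f Q) = 0" using f[OF Q(1)] unfolding red_def by blast
        then show ?thesis using Q(2) by simp
      qed
    qed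
  qed
  ultimately show ?thesis by simp
qed

section \<open>The given graph, complete graphs and the Hadwiger number\<close>

lemma simple_graph_edge_set: "simple_graph G \<Longrightarrow> edge_set (edges G)"
  by unfold_locales (auto simp: simple_graph_def)

lemma induced_subgraph_eq:
  assumes "edge_set (edges G)"
  shows "induced_subgraph G W = (W, edge_set.induced_edges (edges G) W)"
  by (simp add: induced_subgraph_def edge_set.induced_edges_def[OF assms])

lemma beth3_eq:
  fixes G :: "'a graph"
  assumes "simple_graph G"
  defines "E \<equiv> edges G"
  shows "beth3 G = int (card {S. edge_set.solid_set E S \<and> S \<subseteq> verts G}) -
     int (card {D. edge_set.hole E D \<and> D \<subseteq> verts G}) + int (card (edges G)) - int (card (verts G))"
proof -
  interpret edge_set E unfolding E_def by (rule simple_graph_edge_set[OF assms(1)])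
  have ind: "induced_subgraph G W = (W, induced_edges W)" for W
    using induced_subgraph_eq[of G W] edge_set_axioms by (simp add: E_def)
  have inj: "inj_on (\<lambda>W. (W, induced_edges W)) A" for A by (auto simp: inj_on_def)
  have "solids G = (\<lambda>W. (W, induced_edges W)) ` {S. solid_set S \<and> S \<subseteq> verts G}"
    unfolding solids_def induced_subgraphs_def ind solid_set_def by auto
  moreover have "induced_cycles G = (\<lambda>W. (W, induced_edges W)) ` {D. hole D \<and> D \<subseteq> verts G}"
    unfolding induced_cycles_def induced_subgraphs_def ind is_cycle_iff_hole[symmetric] by auto
  ultimately show ?thesis using inj by (simp add: beth3_def card_image)
qed

text \<open>An upper bound suffices to derive the first inequality of the theorem from the second:
  the solids are among the four-sets, and all three-sets are holes.\<close>

lemma beth3_complete_graph_le: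
  "beth3 (complete_graph t) \<le>
     int (t choose 4) - int (t choose 3) + int (t choose 2) - int (t choose 1)"
proof -
  let ?V = "{..<t}"
  have vE: "verts (complete_graph t) = ?V" "edges (complete_graph t) = {e. e \<subseteq> ?V \<and> card e = 2}"
    by (simp_all add: complete_graph_def)
  have s: "simple_graph (complete_graph t)" by (auto simp: simple_graph_def vE)
  interpret edge_set "edges (complete_graph t)" by (rule simple_graph_edge_set[OF s])
  have ad: "adj a b" if "a \<in> ?V" "b \<in> ?V" "a \<noteq> b" for a b
  proof -
    have "{a, b} \<in> edges (complete_graph t)" unfolding vE using that by simp
    then show ?thesis by (simp only: adj_def)
  qed
  have "{S. solid_set S \<and> S \<subseteq> ?V} \<subseteq> {S. S \<subseteq> ?V \<and> card S = 4}"
    using solid_set_complete_card ad by blast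
  then have "card {S. solid_set S \<and> S \<subseteq> ?V} \<le> card {S. S \<subseteq> ?V \<and> card S = 4}"
    by (intro card_mono) auto
  also have "\<dots> = t choose 4" by (subst n_subsets) auto
  finally have 4: "card {S. solid_set S \<and> S \<subseteq> ?V} \<le> t choose 4" .
  have "{D. D \<subseteq> ?V \<and> card D = 3} \<subseteq> {D. hole D \<and> D \<subseteq> ?V}"
  proof
    fix D assume D: "D \<in> {D. D \<subseteq> ?V \<and> card D = 3}"
    then obtain a b c where "D = {a, b, c}" "a \<noteq> b" "b \<noteq> c" "a \<noteq> c" by (auto simp: card_3_iff)
    then show "D \<in> {D. hole D \<and> D \<subseteq> ?V}" using D ad hole_triangle by auto
  qed
  then have "card {D. D \<subseteq> ?V \<and> card D = 3} \<le> card {D. hole D \<and> D \<subseteq> ?V}"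
    by (intro card_mono) (auto intro: finite_holes)
  moreover have "card {D. D \<subseteq> ?V \<and> card D = 3} = t choose 3" by (subst n_subsets) auto
  moreover have "card (edges (complete_graph t)) = t choose 2" unfolding vE by (subst n_subsets) auto
  ultimately show ?thesis using 4 by (simp add: beth3_eq[OF s] vE(1))
qed

text \<open>\<open>Max\<close> requires a finite nonempty set. Choosing a vertex in each branch set
  bounds \<open>t\<close> by the number of vertices, and connectedness of \<open>G\<close> makes its
  whole vertex set a branch set for \<open>t = 1\<close>.\<close>

lemma hadwiger_minor:
  assumes "simple_graph G" "connected_graph G"
  shows "is_minor (complete_graph (hadwiger G)) G" "1 \<le> hadwiger G"
proof -
  let ?T = "{t. is_minor (complete_graph t) G}"
  have fin: "finite (verts G)" using assms by (simp add: simple_graph_def)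
  have "t \<le> card (verts G)" if minor: "t \<in> ?T" for t
  proof -
    have t: "verts (complete_graph t) = {..<t}" by (simp add: complete_graph_def)
    obtain B where B: "\<forall>v\<in>{..<t}. B v \<subseteq> verts G \<and> connected_graph (induced_subgraph G (B v))"
      "\<forall>u\<in>{..<t}. \<forall>v\<in>{..<t}. u \<noteq> v \<longrightarrow> B u \<inter> B v = {}"
      using minor unfolding mem_Collect_eq is_minor_def t by blast
    have "\<exists>x. x \<in> B v" if "v < t" for v
      using B(1) that by (auto simp: connected_graph_def induced_subgraph_def)
    then obtain x where x: "\<And>v. v < t \<Longrightarrow> x v \<in> B v" by metis
    have "inj_on x {..<t}"
    proof (rule inj_onI)
      fix u v assume uv: "u \<in> {..<t}" "v \<in> {..<t}" "x u = x v"
      then have "x u \<in> B u \<inter> B v" using x[of u] x[of v] by simp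
      then show "u = v" using B(2) uv by blast
    qed
    moreover have "x ` {..<t} \<subseteq> verts G" using x B(1) by auto
    ultimately show ?thesis using card_inj_on_le[OF _ _ fin] by (metis card_lessThan)
  qed
  then have finT: "finite ?T" by (meson finite_nat_set_iff_bounded_le)
  have "is_minor (complete_graph 1) G"
    unfolding is_minor_def
  proof (intro exI[of _ "\<lambda>_. verts G"] conjI allI impI)
    have "induced_subgraph G (verts G) = G"
      using assms(1) by (auto simp: induced_subgraph_def simple_graph_def prod_eq_iff)
    then show "\<forall>v\<in>verts (complete_graph 1). verts G \<subseteq> verts G \<and> connected_graph (induced_subgraph G (verts G))"
      using assms(2) by simp
    show "\<forall>u\<in>verts (complete_graph 1). \<forall>v\<in>verts (complete_graph 1). u \<noteq> v \<longrightarrow> verts G \<inter> verts G = {}"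
      by (auto simp: complete_graph_def)
    fix u v :: nat assume "{u, v} \<in> edges (complete_graph 1)"
    then have "u = 0" "v = 0" "card {u, v} = 2" by (auto simp: complete_graph_def)
    then show "\<exists>a\<in>verts G. \<exists>b\<in>verts G. {a, b} \<in> edges G" by simp
  qed
  then have 1: "1 \<in> ?T" by simp
  show "1 \<le> hadwiger G" unfolding hadwiger_def using Max_ge[OF finT 1] .
  have "Max ?T \<in> ?T" by (rule Max_in[OF finT]) (use 1 in auto)
  then show "is_minor (complete_graph (hadwiger G)) G" by (simp add: hadwiger_def)
qed

theorem corollary4p2p1:
  fixes G :: "'a graph"
  assumes "simple_graph G" and "connected_graph G"
  shows "beth3 (complete_graph (hadwiger G)) \<le> beth3 G \<and>
    int (hadwiger G choose 4) - int (hadwiger G choose 3)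
      + int (hadwiger G choose 2) - int (hadwiger G choose 1) \<le> beth3 G"
proof -
  let ?V = "verts G" and ?h = "hadwiger G"
  interpret edge_set "edges G" by (rule simple_graph_edge_set[OF assms(1)])
  have fin: "finite ?V" using assms(1) by (simp add: simple_graph_def)
  have ieV: "induced_edges ?V = edges G" using assms(1) by (auto simp: induced_edges_def simple_graph_def)
  have V: "?V \<noteq> {}" "conn ?V" using connected_graph_conn[of ?V "edges G"] assms(2) by auto
  have h: "1 \<le> ?h" by (rule hadwiger_minor[OF assms])
  obtain B where Bv: "\<forall>v\<in>verts (complete_graph ?h). B v \<subseteq> ?V \<and> connected_graph (induced_subgraph G (B v))"
    and Bd: "\<forall>u\<in>verts (complete_graph ?h). \<forall>v\<in>verts (complete_graph ?h). u \<noteq> v \<longrightarrow> B u \<inter> B v = {}"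
    and Be: "\<forall>u v. {u, v} \<in> edges (complete_graph ?h) \<longrightarrow> (\<exists>a\<in>B u. \<exists>b\<in>B v. {a, b} \<in> edges G)"
    using hadwiger_minor(1)[OF assms] unfolding is_minor_def by blast
  have B: "B i \<subseteq> ?V" "B i \<noteq> {}" "conn (B i)" if "i < ?h" for i
  proof -
    have "B i \<subseteq> ?V" "connected_graph (B i, induced_edges (B i))"
      using Bv that by (auto simp: complete_graph_def induced_subgraph_eq[OF edge_set_axioms])
    then show "B i \<subseteq> ?V" "B i \<noteq> {}" "conn (B i)"
      using connected_graph_conn[of "B i" "induced_edges (B i)"] by (auto simp: induced_edges_def)
  qed
  have dis: "B i \<inter> B j = {}" if "i < ?h" "j < ?h" "i \<noteq> j" for i j
    using Bd that by (simp add: complete_graph_def)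
  have edge: "\<exists>a\<in>B i. \<exists>b\<in>B j. adj a b" if "i < ?h" "j < ?h" "i \<noteq> j" for i j
    using Be that by (simp add: complete_graph_def adj_def)
  have "\<exists>x. x \<in> B i" if "i < ?h" for i using B(2)[OF that] by blast
  then obtain r where r: "\<And>i. i < ?h \<Longrightarrow> r i \<in> B i" by metis
  have "\<exists>l. walk_between (B i \<union> B j) (r i) l (r j) \<and> walk_sum (cross (B i) (B j)) l = 1"
    if "i < ?h" "j < ?h" "i \<noteq> j" for i j
    using link_exists[OF B(3)[OF that(1)] B(3)[OF that(2)] dis[OF that]] edge[OF that] r that by metis
  then obtain l where l: "\<And>i j. i < ?h \<Longrightarrow> j < ?h \<Longrightarrow> i \<noteq> j \<Longrightarrow>
    walk_between (B i \<union> B j) (r i) (l i j) (r j) \<and> walk_sum (cross (B i) (B j)) (l i j) = 1" by metis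
  \<comment> \<open>Walks are chosen for \<open>i < j\<close> and reversed otherwise, which gives
    the symmetry demanded by \<open>link_rev\<close>.\<close>
  define w where "w i j = (if i < j then l i j else rev (l j i))" for i j
  interpret linked_parts "edges G" B r w ?h
  proof
    fix i assume "i < ?h"
    then show "finite (B i)" using B(1) fin finite_subset by blast
  next
    fix i j assume ij: "i < ?h" "j < ?h" "i \<noteq> j"
    show "B i \<inter> B j = {}" by (rule dis[OF ij])
    show "w j i = rev (w i j)" using ij by (auto simp: w_def)
    show "walk_between (B i \<union> B j) (r i) (w i j) (r j)"
      using l[of i j] l[of j i] walk_between_rev[of "B j \<union> B i" "r j" "l j i" "r i"] ij
      by (auto simp: w_def Un_commute)
    have "cross (B j) (B i) = cross (B i) (B j)" by (auto simp: cross_def fun_eq_iff)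
    then show "walk_sum (cross (B i) (B j)) (w i j) = 1"
      using l[of i j] l[of j i] ij by (auto simp: w_def)
  qed
  have "card {D. hole D \<and> D \<subseteq> ?V} + card ?V + ((?h - 1) choose 4) \<le>
      card {S. solid_set S \<and> S \<subseteq> ?V} + card (edges G) + 1"
    using solid_bound[OF fin V(2) B(1) h V(1)] by (simp add: ieV)
  then have "int ((?h - 1) choose 4) - 1 \<le> beth3 G"
    unfolding beth3_eq[OF assms(1)] by linarith
  then show ?thesis
    using binomial_alternating[OF h] beth3_complete_graph_le[of ?h] by linarith
qed

end
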